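(* Let $k$ be a field. (1) There is a category $\underline{\mathrm{Alg}}$ whose objects are $k$-algebras and whose hom-objects are the universal measuring coalgebras $P(A,B)$; $\underline{\mathrm{Alg}}$ has the structure of an enriched category (enriched over coalgebras). (2) There is a category $\underline{\mathrm{Coalg}}$ whose objects are $k$-coalgebras and whose hom-objects are the universal measuring coalgebras $P(H,K)$; $\underline{\mathrm{Coalg}}$ has the structure of an enriched category (enriched over coalgebras).
   Context: Everything is over an arbitrary field $k$; algebras are associative unital, coalgebras coassociative counital; the category of coalgebras is monoidal under $\otimes_k$. Sweedler notation: $\triangle h=\sum_{(h)}h_{(2)}\otimes h_{(1)}$, counit $\epsilon$. For algebras $A,B$ and a coalgebra $H$, a linear map $\rho:H\to\mathrm{Hom}_k(A,B)$ measures if $\rho(h)(aa')=\sum_{(h)}\rho(h_{(2)})(a)\rho(h_{(1)})(a')$ and $\rho(h)(1_A)=\epsilon(h)1_B$. The universal measuring coalgebra $\pi:P(A,B)\to\mathrm{Hom}_k(A,B)$ is the measuring coalgebra such that for every measuring coalgebra $\rho:H\to\mathrm{Hom}_k(A,B)$ there is a unique coalgebra map $P(\rho):H\to P(A,B)$ with $\pi\circ P(\rho)=\rho$; it exists. For coalgebras $H,K,L$, a linear map $\lambda:L\to\mathrm{Hom}_k(H,K)$ measures if the corresponding map $L\otimes H\to K$ is a coalgebra map. The universal measuring coalgebra $\pi:P(H,K)\to\mathrm{Hom}_k(H,K)$ is the measuring coalgebra such that every measuring $\lambda:L\to\mathrm{Hom}_k(H,K)$ factors as $\pi$ composed with a unique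 coalgebra map $L\to P(H,K)$; it exists. Composition $P(B,C)\otimes P(A,B)\to P(A,C)$ (and likewise for coalgebras) is the unique coalgebra map compatible with composition of linear maps $\mathrm{Hom}_k(B,C)\otimes\mathrm{Hom}_k(A,B)\to\mathrm{Hom}_k(A,C)$; the identity $k\to P(A,A)$ is induced by the one-dimensional coalgebra on a grouplike element sent to the identity map. *)

theory Defs
  imports "HOL-Algebra.AbelCoset" "HOL-Algebra.Module"
begin

section \<open>Vector spaces, linear maps, spaces of linear maps\<close>

text \<open>
  Vector spaces over the field \<open>K\<close> are modules \<open>module K V\<close> in the sense of HOL-Algebra.  The
  record type of modules has ring components \<open>mult\<close> and \<open>one\<close>, which carry no information for a
  bare vector space; below they are set to \<open>undefined\<close>.
\<close>

definition linear_map ::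
  "('k, 'r) ring_scheme \<Rightarrow> ('k, 'v, 'm) module_scheme \<Rightarrow> ('k, 'w, 'n) module_scheme \<Rightarrow> ('v \<Rightarrow> 'w) \<Rightarrow> bool"
  where "linear_map K V W f \<longleftrightarrow>
    f \<in> carrier V \<rightarrow> carrier W \<and>
    (\<forall>x\<in>carrier V. \<forall>y\<in>carrier V. f (x \<oplus>\<^bsub>V\<^esub> y) = f x \<oplus>\<^bsub>W\<^esub> f y) \<and>
    (\<forall>a\<in>carrier K. \<forall>x\<in>carrier V. f (a \<odot>\<^bsub>V\<^esub> x) = a \<odot>\<^bsub>W\<^esub> f x)"

text \<open>Elements are extensional, so that equality in the space is equality of maps on \<open>carrier V\<close>.\<close>

definition hom_module ::
  "('k, 'r) ring_scheme \<Rightarrow> ('k, 'v, 'm) module_scheme \<Rightarrow> ('k, 'w, 'n) module_scheme \<Rightarrow> ('k, 'v \<Rightarrow> 'w) module"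
  where "hom_module K V W =
    \<lparr>carrier = {f \<in> extensional (carrier V). linear_map K V W f},
     mult = undefined, one = undefined,
     zero = (\<lambda>x\<in>carrier V. \<zero>\<^bsub>W\<^esub>),
     add = (\<lambda>f g. \<lambda>x\<in>carrier V. f x \<oplus>\<^bsub>W\<^esub> g x),
     smult = (\<lambda>a f. \<lambda>x\<in>carrier V. a \<odot>\<^bsub>W\<^esub> f x)\<rparr>"

definition self_module :: "('k, 'r) ring_scheme \<Rightarrow> ('k, 'k) module"
  where "self_module K =
    \<lparr>carrier = carrier K, mult = mult K, one = one K, zero = zero K, add = add K, smult = mult K\<rparr>"


section \<open>Tensor products\<close>

text \<open>
  \<open>V \<otimes> W\<close> is the free vector space on \<open>carrier V \<times> carrier W\<close> (finitely supported functions)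
  modulo the subspace generated by the bilinearity relations; its elements are cosets.
\<close>

type_synonym ('k, 'v, 'w) tensor = "('v \<times> 'w \<Rightarrow> 'k) set"

definition free_module :: "('k, 'r) ring_scheme \<Rightarrow> 's set \<Rightarrow> ('k, 's \<Rightarrow> 'k) module"
  where "free_module K S =
    \<lparr>carrier = {r. range r \<subseteq> carrier K \<and> finite {p. r p \<noteq> \<zero>\<^bsub>K\<^esub>} \<and> {p. r p \<noteq> \<zero>\<^bsub>K\<^esub>} \<subseteq> S},
     mult = undefined, one = undefined,
     zero = (\<lambda>p. \<zero>\<^bsub>K\<^esub>),
     add = (\<lambda>r s p. r p \<oplus>\<^bsub>K\<^esub> s p),
     smult = (\<lambda>a r p. a \<otimes>\<^bsub>K\<^esub> r p)\<rparr>"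

definition free_gen :: "('k, 'r) ring_scheme \<Rightarrow> 's \<Rightarrow> 's \<Rightarrow> 'k"
  where "free_gen K p = (\<lambda>q. if q = p then \<one>\<^bsub>K\<^esub> else \<zero>\<^bsub>K\<^esub>)"

abbreviation tensor_free ::
  "('k, 'r) ring_scheme \<Rightarrow> ('k, 'v, 'm) module_scheme \<Rightarrow> ('k, 'w, 'n) module_scheme \<Rightarrow> ('k, 'v \<times> 'w \<Rightarrow> 'k) module"
  where "tensor_free K V W \<equiv> free_module K (carrier V \<times> carrier W)"

inductive_set tensor_relators ::
  "('k, 'r) ring_scheme \<Rightarrow> ('k, 'v, 'm) module_scheme \<Rightarrow> ('k, 'w, 'n) module_scheme \<Rightarrow> ('v \<times> 'w \<Rightarrow> 'k) set"
  for K :: "('k, 'r) ring_scheme" and V :: "('k, 'v, 'm) module_scheme"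
    and W :: "('k, 'w, 'n) module_scheme"
  where
    add_left: "\<lbrakk>v \<in> carrier V; v' \<in> carrier V; w \<in> carrier W\<rbrakk> \<Longrightarrow>
      free_gen K (v \<oplus>\<^bsub>V\<^esub> v', w) \<ominus>\<^bsub>tensor_free K V W\<^esub>
        (free_gen K (v, w) \<oplus>\<^bsub>tensor_free K V W\<^esub> free_gen K (v', w)) \<in> tensor_relators K V W"
  | add_right: "\<lbrakk>v \<in> carrier V; w \<in> carrier W; w' \<in> carrier W\<rbrakk> \<Longrightarrow>
      free_gen K (v, w \<oplus>\<^bsub>W\<^esub> w') \<ominus>\<^bsub>tensor_free K V W\<^esub>
        (free_gen K (v, w) \<oplus>\<^bsub>tensor_free K V W\<^esub> free_gen K (v, w')) \<in> tensor_relators K V W"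
  | smult_left: "\<lbrakk>a \<in> carrier K; v \<in> carrier V; w \<in> carrier W\<rbrakk> \<Longrightarrow>
      free_gen K (a \<odot>\<^bsub>V\<^esub> v, w) \<ominus>\<^bsub>tensor_free K V W\<^esub>
        (a \<odot>\<^bsub>tensor_free K V W\<^esub> free_gen K (v, w)) \<in> tensor_relators K V W"
  | smult_right: "\<lbrakk>a \<in> carrier K; v \<in> carrier V; w \<in> carrier W\<rbrakk> \<Longrightarrow>
      free_gen K (v, a \<odot>\<^bsub>W\<^esub> w) \<ominus>\<^bsub>tensor_free K V W\<^esub>
        (a \<odot>\<^bsub>tensor_free K V W\<^esub> free_gen K (v, w)) \<in> tensor_relators K V W"

definition tensor_null ::
  "('k, 'r) ring_scheme \<Rightarrow> ('k, 'v, 'm) module_scheme \<Rightarrow> ('k, 'w, 'n) module_scheme \<Rightarrow> ('v \<times> 'w \<Rightarrow> 'k) set"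
  where "tensor_null K V W =
    \<Inter> {N. submodule N K (tensor_free K V W) \<and> tensor_relators K V W \<subseteq> N}"

definition tensor_module ::
  "('k, 'r) ring_scheme \<Rightarrow> ('k, 'v, 'm) module_scheme \<Rightarrow> ('k, 'w, 'n) module_scheme
    \<Rightarrow> ('k, ('k, 'v, 'w) tensor) module"
  where "tensor_module K V W =
    (let F = tensor_free K V W; N = tensor_null K V W in
      \<lparr>carrier = a_rcosets\<^bsub>F\<^esub> N,
       mult = undefined, one = undefined,
       zero = N,
       add = (\<lambda>X Y. X <+>\<^bsub>F\<^esub> Y),
       smult = (\<lambda>a X. \<Union>x\<in>X. N +>\<^bsub>F\<^esub> (a \<odot>\<^bsub>F\<^esub> x))\<rparr>)"

definition pure_tensor ::
  "('k, 'r) ring_scheme \<Rightarrow> ('k, 'v, 'm) module_scheme \<Rightarrow> ('k, 'w, 'n) module_scheme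
    \<Rightarrow> 'v \<Rightarrow> 'w \<Rightarrow> ('k, 'v, 'w) tensor"
  where "pure_tensor K V W v w = tensor_null K V W +>\<^bsub>tensor_free K V W\<^esub> free_gen K (v, w)"

text \<open>
  The linear map \<open>V \<otimes> W \<rightarrow> U\<close>, \<open>v \<otimes> w \<mapsto> f v w\<close>, induced by a bilinear map \<open>f\<close>: all
  representatives of a coset have the same image under the linear extension of \<open>f\<close>.
\<close>

definition tensor_lift ::
  "('k, 'r) ring_scheme \<Rightarrow> ('k, 'u, 'm) module_scheme \<Rightarrow> ('v \<Rightarrow> 'w \<Rightarrow> 'u) \<Rightarrow> ('k, 'v, 'w) tensor \<Rightarrow> 'u"
  where "tensor_lift K U f X = the_elem
    ((\<lambda>r. \<Oplus>\<^bsub>U\<^esub>p\<in>{p. r p \<noteq> \<zero>\<^bsub>K\<^esub>}. r p \<odot>\<^bsub>U\<^esub> f (fst p) (snd p)) ` X)"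

text \<open>\<open>f \<otimes> g\<close> for linear maps into \<open>V\<close> and \<open>W\<close>.\<close>

definition tensor_map ::
  "('k, 'r) ring_scheme \<Rightarrow> ('k, 'v, 'm) module_scheme \<Rightarrow> ('k, 'w, 'n) module_scheme
    \<Rightarrow> ('x \<Rightarrow> 'v) \<Rightarrow> ('y \<Rightarrow> 'w) \<Rightarrow> ('k, 'x, 'y) tensor \<Rightarrow> ('k, 'v, 'w) tensor"
  where "tensor_map K V W f g =
    tensor_lift K (tensor_module K V W) (\<lambda>x y. pure_tensor K V W (f x) (g y))"

text \<open>The associator \<open>(U \<otimes> V) \<otimes> W \<rightarrow> U \<otimes> (V \<otimes> W)\<close>.\<close>

definition tensor_assoc ::
  "('k, 'r) ring_scheme \<Rightarrow> ('k, 'u, 'l) module_scheme \<Rightarrow> ('k, 'v, 'm) module_scheme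
    \<Rightarrow> ('k, 'w, 'n) module_scheme
    \<Rightarrow> ('k, ('k, 'u, 'v) tensor, 'w) tensor \<Rightarrow> ('k, 'u, ('k, 'v, 'w) tensor) tensor"
  where "tensor_assoc K U V W =
    (let VW = tensor_module K V W; T = tensor_module K U VW in
      tensor_lift K T (\<lambda>t w.
        tensor_lift K T (\<lambda>u v. pure_tensor K U VW u (pure_tensor K V W v w)) t))"

text \<open>The unitors \<open>K \<otimes> V \<rightarrow> V\<close> and \<open>V \<otimes> K \<rightarrow> V\<close>.\<close>

definition tensor_lunit ::
  "('k, 'r) ring_scheme \<Rightarrow> ('k, 'v, 'm) module_scheme \<Rightarrow> ('k, 'k, 'v) tensor \<Rightarrow> 'v"
  where "tensor_lunit K V = tensor_lift K V (\<lambda>a v. a \<odot>\<^bsub>V\<^esub> v)"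

definition tensor_runit ::
  "('k, 'r) ring_scheme \<Rightarrow> ('k, 'v, 'm) module_scheme \<Rightarrow> ('k, 'v, 'k) tensor \<Rightarrow> 'v"
  where "tensor_runit K V = tensor_lift K V (\<lambda>v a. a \<odot>\<^bsub>V\<^esub> v)"

text \<open>
  The middle-four interchange
  \<open>(V \<otimes> V) \<otimes> (W \<otimes> W) \<rightarrow> (V \<otimes> W) \<otimes> (V \<otimes> W)\<close>,
  \<open>(v \<otimes> v') \<otimes> (w \<otimes> w') \<mapsto> (v \<otimes> w) \<otimes> (v' \<otimes> w')\<close>.
\<close>

definition tensor_interchange ::
  "('k, 'r) ring_scheme \<Rightarrow> ('k, 'v, 'm) module_scheme \<Rightarrow> ('k, 'w, 'n) module_scheme
    \<Rightarrow> ('k, ('k, 'v, 'v) tensor, ('k, 'w, 'w) tensor) tensor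
    \<Rightarrow> ('k, ('k, 'v, 'w) tensor, ('k, 'v, 'w) tensor) tensor"
  where "tensor_interchange K V W =
    (let VW = tensor_module K V W; T = tensor_module K VW VW in
      tensor_lift K T (\<lambda>s t.
        tensor_lift K T (\<lambda>v v'.
          tensor_lift K T (\<lambda>w w'.
            pure_tensor K VW VW (pure_tensor K V W v w) (pure_tensor K V W v' w')) t) s))"


section \<open>Algebras and coalgebras\<close>

text \<open>The HOL-Algebra locale \<open>algebra\<close> is restricted to commutative algebras.\<close>

locale assoc_algebra = R?: field K + module K A + A?: ring A
  for K (structure) and A (structure) +
  assumes smult_mult_left: "\<lbrakk>c \<in> carrier K; x \<in> carrier A; y \<in> carrier A\<rbrakk> \<Longrightarrow>
      (c \<odot>\<^bsub>A\<^esub> x) \<otimes>\<^bsub>A\<^esub> y = c \<odot>\<^bsub>A\<^esub> (x \<otimes>\<^bsub>A\<^esub> y)"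
    and smult_mult_right: "\<lbrakk>c \<in> carrier K; x \<in> carrier A; y \<in> carrier A\<rbrakk> \<Longrightarrow>
      x \<otimes>\<^bsub>A\<^esub> (c \<odot>\<^bsub>A\<^esub> y) = c \<odot>\<^bsub>A\<^esub> (x \<otimes>\<^bsub>A\<^esub> y)"

record ('k, 'c) coalgebra = "('k, 'c) module" +
  comult :: "'c \<Rightarrow> ('k, 'c, 'c) tensor"
  counit :: "'c \<Rightarrow> 'k"

locale coalgebra = R?: field K + module K C
  for K (structure) and C :: "('k, 'c, 'm) coalgebra_scheme" (structure) +
  assumes comult_linear: "linear_map K C (tensor_module K C C) (comult C)"
    and counit_linear: "linear_map K C (self_module K) (counit C)"
    and coassoc: "c \<in> carrier C \<Longrightarrow>
      tensor_assoc K C C C (tensor_map K (tensor_module K C C) C (comult C) (\<lambda>x. x) (comult C c)) =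
      tensor_map K C (tensor_module K C C) (\<lambda>x. x) (comult C) (comult C c)"
    and counit_left: "c \<in> carrier C \<Longrightarrow>
      tensor_lunit K C (tensor_map K (self_module K) C (counit C) (\<lambda>x. x) (comult C c)) = c"
    and counit_right: "c \<in> carrier C \<Longrightarrow>
      tensor_runit K C (tensor_map K C (self_module K) (\<lambda>x. x) (counit C) (comult C c)) = c"

definition coalgebra_map ::
  "('k, 'r) ring_scheme \<Rightarrow> ('k, 'c, 'm) coalgebra_scheme \<Rightarrow> ('k, 'd, 'n) coalgebra_scheme
    \<Rightarrow> ('c \<Rightarrow> 'd) \<Rightarrow> bool"
  where "coalgebra_map K C D f \<longleftrightarrow>
    linear_map K C D f \<and>
    (\<forall>c\<in>carrier C. comult D (f c) = tensor_map K D D f f (comult C c)) \<and>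
    (\<forall>c\<in>carrier C. counit D (f c) = counit C c)"

text \<open>The tensor product and the unit object of the monoidal category of coalgebras.\<close>

definition tensor_coalgebra ::
  "('k, 'r) ring_scheme \<Rightarrow> ('k, 'c, 'm) coalgebra_scheme \<Rightarrow> ('k, 'd, 'n) coalgebra_scheme
    \<Rightarrow> ('k, ('k, 'c, 'd) tensor) coalgebra"
  where "tensor_coalgebra K C D =
    \<lparr>carrier = carrier (tensor_module K C D),
     mult = undefined, one = undefined,
     zero = zero (tensor_module K C D),
     add = add (tensor_module K C D),
     smult = smult (tensor_module K C D),
     comult = tensor_interchange K C D \<circ>
       tensor_map K (tensor_module K C C) (tensor_module K D D) (comult C) (comult D),
     counit = tensor_lift K (self_module K) (\<lambda>c d. counit C c \<otimes>\<^bsub>K\<^esub> counit D d)\<rparr>"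

definition unit_coalgebra :: "('k, 'r) ring_scheme \<Rightarrow> ('k, 'k) coalgebra"
  where "unit_coalgebra K =
    \<lparr>carrier = carrier K, mult = undefined, one = undefined,
     zero = zero K, add = add K, smult = mult K,
     comult = (\<lambda>a. pure_tensor K (self_module K) (self_module K) a \<one>\<^bsub>K\<^esub>),
     counit = (\<lambda>a. a)\<rparr>"


section \<open>Universal measuring coalgebras\<close>

text \<open>
  In the convention \<open>\<triangle>h = \<Sum> h\<^sub>(\<^sub>2\<^sub>) \<otimes> h\<^sub>(\<^sub>1\<^sub>)\<close> the tensor factor \<open>h\<^sub>(\<^sub>2\<^sub>)\<close>, which
  acts on the first argument of a product, is the left-hand one.
\<close>

definition measures_alg ::
  "('k, 'r) ring_scheme \<Rightarrow> ('k, 'a, 'm) module_scheme \<Rightarrow> ('k, 'b, 'n) module_scheme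
    \<Rightarrow> ('k, 'h, 'l) coalgebra_scheme \<Rightarrow> ('h \<Rightarrow> 'a \<Rightarrow> 'b) \<Rightarrow> bool"
  where "measures_alg K A B H \<rho> \<longleftrightarrow>
    coalgebra K H \<and>
    linear_map K H (hom_module K A B) \<rho> \<and>
    (\<forall>h\<in>carrier H. \<forall>a\<in>carrier A. \<forall>a'\<in>carrier A.
      \<rho> h (a \<otimes>\<^bsub>A\<^esub> a') = tensor_lift K B (\<lambda>x y. \<rho> x a \<otimes>\<^bsub>B\<^esub> \<rho> y a') (comult H h)) \<and>
    (\<forall>h\<in>carrier H. \<rho> h \<one>\<^bsub>A\<^esub> = counit H h \<odot>\<^bsub>B\<^esub> \<one>\<^bsub>B\<^esub>)"

definition measures_coalg ::
  "('k, 'r) ring_scheme \<Rightarrow> ('k, 'c, 'm) coalgebra_scheme \<Rightarrow> ('k, 'd, 'n) coalgebra_scheme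
    \<Rightarrow> ('k, 'h, 'l) coalgebra_scheme \<Rightarrow> ('h \<Rightarrow> 'c \<Rightarrow> 'd) \<Rightarrow> bool"
  where "measures_coalg K C D L \<phi> \<longleftrightarrow>
    coalgebra K L \<and>
    linear_map K L (hom_module K C D) \<phi> \<and>
    coalgebra_map K (tensor_coalgebra K L C) D (tensor_lift K D \<phi>)"

text \<open>
  \<open>(P, \<pi>)\<close> is universal among the measurings \<open>meas H \<rho>\<close> by coalgebras \<open>H\<close> whose carrier is a
  set of elements of type \<open>'h\<close>.  HOL does not quantify over types inside a formula, so the type
  of the test coalgebras is a parameter.  The universal measuring coalgebra in the usual sense has
  this property for every type \<open>'h\<close>, so as a hypothesis the property for one type is weaker than
  universality.  The mediating map is unique as a map on \<open>carrier H\<close>.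
\<close>

definition universal_measuring ::
  "'h itself \<Rightarrow> ('k, 'r) ring_scheme \<Rightarrow> (('k, 'h) coalgebra \<Rightarrow> ('h \<Rightarrow> 'a \<Rightarrow> 'b) \<Rightarrow> bool)
    \<Rightarrow> ('k, 'p) coalgebra \<Rightarrow> ('p \<Rightarrow> 'a \<Rightarrow> 'b) \<Rightarrow> bool"
  where "universal_measuring T K meas P \<pi> \<longleftrightarrow>
    (\<forall>H \<rho>. meas H \<rho> \<longrightarrow>
      (\<exists>!f. f \<in> extensional (carrier H) \<and> coalgebra_map K H P f \<and> (\<forall>h\<in>carrier H. \<pi> (f h) = \<rho> h)))"

definition universal_measuring_alg ::
  "'h itself \<Rightarrow> ('k, 'r) ring_scheme \<Rightarrow> ('k, 'a, 'm) module_scheme \<Rightarrow> ('k, 'b, 'n) module_scheme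
    \<Rightarrow> ('k, 'p) coalgebra \<Rightarrow> ('p \<Rightarrow> 'a \<Rightarrow> 'b) \<Rightarrow> bool"
  where "universal_measuring_alg T K A B P \<pi> \<longleftrightarrow>
    measures_alg K A B P \<pi> \<and> universal_measuring T K (measures_alg K A B) P \<pi>"

definition universal_measuring_coalg ::
  "'h itself \<Rightarrow> ('k, 'r) ring_scheme \<Rightarrow> ('k, 'c, 'm) coalgebra_scheme \<Rightarrow> ('k, 'd, 'n) coalgebra_scheme
    \<Rightarrow> ('k, 'p) coalgebra \<Rightarrow> ('p \<Rightarrow> 'c \<Rightarrow> 'd) \<Rightarrow> bool"
  where "universal_measuring_coalg T K C D P \<pi> \<longleftrightarrow>
    measures_coalg K C D P \<pi> \<and> universal_measuring T K (measures_coalg K C D) P \<pi>"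


section \<open>Composition and identities\<close>

definition unique_on :: "'x set \<Rightarrow> (('x \<Rightarrow> 'y) \<Rightarrow> bool) \<Rightarrow> ('x \<Rightarrow> 'y) \<Rightarrow> bool"
  where "unique_on X Q f \<longleftrightarrow> Q f \<and> (\<forall>g. Q g \<longrightarrow> (\<forall>x\<in>X. g x = f x))"

text \<open>
  In the following two definitions \<open>(P A B, \<pi> A B)\<close> is the chosen universal measuring coalgebra of
  \<open>A\<close> and \<open>B\<close>.  The second one describes the map sending the grouplike element \<open>1\<close> of the unit
  coalgebra to an element over the identity map of \<open>A\<close>.
\<close>

definition is_composition ::
  "('k, 'r) ring_scheme \<Rightarrow> (('k, 'a, 'm) module_scheme \<Rightarrow> ('k, 'a, 'm) module_scheme \<Rightarrow> ('k, 'p) coalgebra)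
    \<Rightarrow> (('k, 'a, 'm) module_scheme \<Rightarrow> ('k, 'a, 'm) module_scheme \<Rightarrow> 'p \<Rightarrow> 'a \<Rightarrow> 'a)
    \<Rightarrow> ('k, 'a, 'm) module_scheme \<Rightarrow> ('k, 'a, 'm) module_scheme \<Rightarrow> ('k, 'a, 'm) module_scheme
    \<Rightarrow> (('k, 'p, 'p) tensor \<Rightarrow> 'p) \<Rightarrow> bool"
  where "is_composition K P \<pi> A B C =
    unique_on (carrier (tensor_coalgebra K (P B C) (P A B))) (\<lambda>\<mu>.
      coalgebra_map K (tensor_coalgebra K (P B C) (P A B)) (P A C) \<mu> \<and>
      (\<forall>g\<in>carrier (P B C). \<forall>f\<in>carrier (P A B).
        \<pi> A C (\<mu> (pure_tensor K (P B C) (P A B) g f)) = compose (carrier A) (\<pi> B C g) (\<pi> A B f)))"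

definition is_identity ::
  "('k, 'r) ring_scheme \<Rightarrow> (('k, 'a, 'm) module_scheme \<Rightarrow> ('k, 'a, 'm) module_scheme \<Rightarrow> ('k, 'p) coalgebra)
    \<Rightarrow> (('k, 'a, 'm) module_scheme \<Rightarrow> ('k, 'a, 'm) module_scheme \<Rightarrow> 'p \<Rightarrow> 'a \<Rightarrow> 'a)
    \<Rightarrow> ('k, 'a, 'm) module_scheme \<Rightarrow> ('k \<Rightarrow> 'p) \<Rightarrow> bool"
  where "is_identity K P \<pi> A =
    unique_on (carrier (unit_coalgebra K)) (\<lambda>\<eta>.
      coalgebra_map K (unit_coalgebra K) (P A A) \<eta> \<and>
      \<pi> A A (\<eta> \<one>\<^bsub>K\<^esub>) = (\<lambda>a\<in>carrier A. a))"


section \<open>Categories enriched over coalgebras\<close>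

text \<open>
  Enrichment over the monoidal category of coalgebras over \<open>K\<close>: hom-coalgebras, composition and
  identities that are coalgebra maps, associativity, and the two unit laws.
\<close>

locale coalgebra_enriched_category =
  fixes K :: "('k, 'r) ring_scheme" (structure)
    and Ob :: "'o set"
    and hom :: "'o \<Rightarrow> 'o \<Rightarrow> ('k, 'p) coalgebra"
    and comp :: "'o \<Rightarrow> 'o \<Rightarrow> 'o \<Rightarrow> ('k, 'p, 'p) tensor \<Rightarrow> 'p"
    and ident :: "'o \<Rightarrow> 'k \<Rightarrow> 'p"
  assumes hom_coalgebra: "\<lbrakk>A \<in> Ob; B \<in> Ob\<rbrakk> \<Longrightarrow> coalgebra K (hom A B)"
    and comp_map: "\<lbrakk>A \<in> Ob; B \<in> Ob; C \<in> Ob\<rbrakk> \<Longrightarrow>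
      coalgebra_map K (tensor_coalgebra K (hom B C) (hom A B)) (hom A C) (comp A B C)"
    and ident_map: "A \<in> Ob \<Longrightarrow> coalgebra_map K (unit_coalgebra K) (hom A A) (ident A)"
    and comp_assoc: "\<lbrakk>A \<in> Ob; B \<in> Ob; C \<in> Ob; D \<in> Ob;
        x \<in> carrier (tensor_coalgebra K (tensor_coalgebra K (hom C D) (hom B C)) (hom A B))\<rbrakk> \<Longrightarrow>
      comp A B D (tensor_map K (hom B D) (hom A B) (comp B C D) (\<lambda>u. u) x) =
      comp A C D (tensor_map K (hom C D) (hom A C) (\<lambda>u. u) (comp A B C)
        (tensor_assoc K (hom C D) (hom B C) (hom A B) x))"
    and ident_left: "\<lbrakk>A \<in> Ob; B \<in> Ob; y \<in> carrier (tensor_coalgebra K (unit_coalgebra K) (hom A B))\<rbrakk> \<Longrightarrow>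
      comp A B B (tensor_map K (hom B B) (hom A B) (ident B) (\<lambda>u. u) y) = tensor_lunit K (hom A B) y"
    and ident_right: "\<lbrakk>A \<in> Ob; B \<in> Ob; z \<in> carrier (tensor_coalgebra K (hom A B) (unit_coalgebra K))\<rbrakk> \<Longrightarrow>
      comp A A B (tensor_map K (hom A B) (hom A A) (\<lambda>u. u) (ident A) z) = tensor_runit K (hom A B) z"

end

theory Submission
  imports Defs
begin

text \<open>
  Measurings are closed under composition, contain the identity, and can be precomposed with
  coalgebra maps.  Hence the composites of linear maps make \<open>P(B,C) \<otimes> P(A,B)\<close> a measuring coalgebra,
  and universality turns this into a coalgebra map to \<open>P(A,C)\<close>; identities arise likewise from the unit
  coalgebra.  A coalgebra map into \<open>P(A,B)\<close> is determined by its composite with \<open>\<pi>\<close>, and both sides of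
  the associativity and unit laws are coalgebra maps, so the laws reduce to those for linear maps.
  Identities between maps on iterated tensor products are checked on pure tensors, after the
  comultiplications in them have been replaced by arbitrary tensors.
\<close>

section \<open>Linear maps\<close>

text \<open>The coproduct of an element is in general not a pure tensor, so a law that mentions
  \<open>comult\<close> cannot simply be evaluated. Replacing each coproduct by an arbitrary tensor
  works because both sides are then linear in every inserted tensor: an identity costs one linearity
  check per tensor and one evaluation on generators. A second obstacle is typing. Universality is
  assumed only for test coalgebras with elements of type \<open>'h\<close>, whereas the laws involve
  coalgebras on the field and on iterated tensors. These are copied along injections of types, and
  the measuring property of such a coalgebra is expressed through its precomposites with coalgebra
  maps from coalgebras on \<open>'h\<close>. The two halves of the theorem differ only in the notion
  of measuring. Once its closure properties are known, that notion is dropped: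
  \<open>measuring_category\<close> retains linear actions, uniqueness of coalgebra maps with a
  given action, and existence of maps realising composites and identities, and the category laws are
  derived there once for both.\<close>

lemma linear_mapI:
  assumes "\<And>x. x \<in> carrier V \<Longrightarrow> f x \<in> carrier W"
    and "\<And>x y. \<lbrakk>x \<in> carrier V; y \<in> carrier V\<rbrakk> \<Longrightarrow> f (x \<oplus>\<^bsub>V\<^esub> y) = f x \<oplus>\<^bsub>W\<^esub> f y"
    and "\<And>a x. \<lbrakk>a \<in> carrier K; x \<in> carrier V\<rbrakk> \<Longrightarrow> f (a \<odot>\<^bsub>V\<^esub> x) = a \<odot>\<^bsub>W\<^esub> f x"
  shows "linear_map K V W f"
  using assms by (simp add: linear_map_def Pi_iff)

lemma linear_map_closed: "\<lbrakk>linear_map K V W f; x \<in> carrier V\<rbrakk> \<Longrightarrow> f x \<in> carrier W"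
  by (auto simp: linear_map_def)

lemma linear_map_add:
  "\<lbrakk>linear_map K V W f; x \<in> carrier V; y \<in> carrier V\<rbrakk> \<Longrightarrow> f (x \<oplus>\<^bsub>V\<^esub> y) = f x \<oplus>\<^bsub>W\<^esub> f y"
  by (auto simp: linear_map_def)

lemma linear_map_smult:
  "\<lbrakk>linear_map K V W f; a \<in> carrier K; x \<in> carrier V\<rbrakk> \<Longrightarrow> f (a \<odot>\<^bsub>V\<^esub> x) = a \<odot>\<^bsub>W\<^esub> f x"
  by (auto simp: linear_map_def)

lemma linear_map_id [simp, intro]: "linear_map K V V (\<lambda>x. x)"
  by (simp add: linear_map_def)

lemma linear_map_comp:
  "\<lbrakk>linear_map K V W f; linear_map K U V g\<rbrakk> \<Longrightarrow> linear_map K U W (\<lambda>x. f (g x))"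
  by (simp add: linear_map_def Pi_iff)

lemma linear_map_cong:
  assumes "linear_map K V W f" "module K V" "\<And>x. x \<in> carrier V \<Longrightarrow> g x = f x"
  shows "linear_map K V W g"
proof -
  interpret module K V by fact
  show ?thesis using assms(1,3) by (simp add: linear_map_def Pi_iff)
qed

lemma linear_map_zero:
  assumes "linear_map K V W f" "module K V" "module K W"
  shows "f \<zero>\<^bsub>V\<^esub> = \<zero>\<^bsub>W\<^esub>"
proof -
  interpret V: module K V by fact
  interpret W: module K W by fact
  have "f (\<zero>\<^bsub>K\<^esub> \<odot>\<^bsub>V\<^esub> \<zero>\<^bsub>V\<^esub>) = \<zero>\<^bsub>K\<^esub> \<odot>\<^bsub>W\<^esub> f \<zero>\<^bsub>V\<^esub>"
    using assms(1) by (intro linear_map_smult) auto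
  then show ?thesis
    using linear_map_closed[OF assms(1)] by simp
qed

lemma linear_map_minus:
  assumes "linear_map K V W f" "module K V" "module K W" "x \<in> carrier V" "y \<in> carrier V"
  shows "f (x \<ominus>\<^bsub>V\<^esub> y) = f x \<ominus>\<^bsub>W\<^esub> f y"
proof -
  interpret V: module K V by fact
  interpret W: module K W by fact
  note f = linear_map_closed[OF assms(1)] linear_map_add[OF assms(1)]
  have "f x = f ((x \<ominus>\<^bsub>V\<^esub> y) \<oplus>\<^bsub>V\<^esub> y)"
    using assms(4,5) by (simp add: a_minus_def V.a_assoc V.l_neg)
  also have "\<dots> = f (x \<ominus>\<^bsub>V\<^esub> y) \<oplus>\<^bsub>W\<^esub> f y"
    using assms(4,5) by (simp add: f)
  finally show ?thesis
    unfolding a_minus_def[of W] using assms(4,5) by (simp add: f W.add.inv_solve_right)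
qed

text \<open>Relators of a tensor product are differences; this turns the vanishing of a map on them
  into an equation between its values.\<close>

lemma (in abelian_group) minus_eq_zero_iff:
  "\<lbrakk>x \<in> carrier G; y \<in> carrier G\<rbrakk> \<Longrightarrow> x \<ominus> y = \<zero> \<longleftrightarrow> x = y"
  unfolding a_minus_def using add.inv_solve_right[of "\<zero>" x y] by auto

section \<open>Bilinear maps\<close>

definition bilinear_map ::
  "('k, 'r) ring_scheme \<Rightarrow> ('k, 'v, 'l) module_scheme \<Rightarrow> ('k, 'w, 'm) module_scheme
    \<Rightarrow> ('k, 'u, 'n) module_scheme \<Rightarrow> ('v \<Rightarrow> 'w \<Rightarrow> 'u) \<Rightarrow> bool"
  where "bilinear_map K V W U f \<longleftrightarrow>
    (\<forall>v\<in>carrier V. linear_map K W U (f v)) \<and> (\<forall>w\<in>carrier W. linear_map K V U (\<lambda>v. f v w))"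

lemma bilinear_mapI:
  assumes "\<And>v. v \<in> carrier V \<Longrightarrow> linear_map K W U (f v)"
    and "\<And>w. w \<in> carrier W \<Longrightarrow> linear_map K V U (\<lambda>v. f v w)"
  shows "bilinear_map K V W U f"
  using assms by (simp add: bilinear_map_def)

lemma bilinear_mapD:
  assumes "bilinear_map K V W U f"
  shows "v \<in> carrier V \<Longrightarrow> linear_map K W U (f v)"
    and "w \<in> carrier W \<Longrightarrow> linear_map K V U (\<lambda>v. f v w)"
  using assms by (simp_all add: bilinear_map_def)

lemma bilinear_map_closed:
  "\<lbrakk>bilinear_map K V W U f; v \<in> carrier V; w \<in> carrier W\<rbrakk> \<Longrightarrow> f v w \<in> carrier U"
  by (metis bilinear_mapD(1) linear_map_closed)

lemma bilinear_map_cong: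
  assumes "bilinear_map K V W U f" "module K V" "module K W"
    and "\<And>v w. \<lbrakk>v \<in> carrier V; w \<in> carrier W\<rbrakk> \<Longrightarrow> g v w = f v w"
  shows "bilinear_map K V W U g"
proof (rule bilinear_mapI)
  show "linear_map K W U (g v)" if "v \<in> carrier V" for v
    using bilinear_mapD(1)[OF assms(1) that] assms(3) by (rule linear_map_cong) (simp add: assms(4) that)
  show "linear_map K V U (\<lambda>v. g v w)" if "w \<in> carrier W" for w
    using bilinear_mapD(2)[OF assms(1) that] assms(2) by (rule linear_map_cong) (simp add: assms(4) that)
qed

lemma bilinear_map_comp:
  assumes "bilinear_map K V W U f" "linear_map K U U' h" "linear_map K V' V g" "linear_map K W' W g'"
  shows "bilinear_map K V' W' U' (\<lambda>v w. h (f (g v) (g' w)))"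
proof (rule bilinear_mapI)
  show "linear_map K W' U' (\<lambda>w. h (f (g v) (g' w)))" if "v \<in> carrier V'" for v
    by (rule linear_map_comp[OF assms(2)] linear_map_comp[OF bilinear_mapD(1)[OF assms(1)]]
      assms linear_map_closed[OF assms(3)] that)+
  show "linear_map K V' U' (\<lambda>v. h (f (g v) (g' w)))" if "w \<in> carrier W'" for w
  proof -
    have "linear_map K V U (\<lambda>v. f v (g' w))"
      using bilinear_mapD(2)[OF assms(1)] linear_map_closed[OF assms(4) that] by blast
    from linear_map_comp[OF this assms(3)] show ?thesis
      by (rule linear_map_comp[OF assms(2)])
  qed
qed

text \<open>Each module axiom is an equation in \<open>F\<close> pushed forward through
  \<open>h\<close>, which is onto. In the applications \<open>h\<close> is the coset map of a
  quotient, the identity between records of different types, or an injection along which structure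
  is transported.\<close>

lemma (in cring) module_image:
  assumes "module R F"
    and carrier: "carrier T = h ` carrier F"
    and zero: "\<zero>\<^bsub>T\<^esub> = h \<zero>\<^bsub>F\<^esub>"
    and add: "\<And>x y. \<lbrakk>x \<in> carrier F; y \<in> carrier F\<rbrakk> \<Longrightarrow> h x \<oplus>\<^bsub>T\<^esub> h y = h (x \<oplus>\<^bsub>F\<^esub> y)"
    and smult: "\<And>a x. \<lbrakk>a \<in> carrier R; x \<in> carrier F\<rbrakk> \<Longrightarrow> a \<odot>\<^bsub>T\<^esub> h x = h (a \<odot>\<^bsub>F\<^esub> x)"
  shows "module R T"
proof -
  interpret F: module R F by fact
  show ?thesis
  proof (intro moduleI abelian_groupI)
    show "cring R" by (rule is_cring)
    fix x assume "x \<in> carrier T"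
    then obtain r where "r \<in> carrier F" "x = h r" by (auto simp: carrier)
    then show "\<exists>y\<in>carrier T. y \<oplus>\<^bsub>T\<^esub> x = \<zero>\<^bsub>T\<^esub>"
      by (auto simp: carrier zero add F.l_neg intro!: bexI[of _ "\<ominus>\<^bsub>F\<^esub> r"])
  qed (auto simp: carrier zero add smult F.a_ac F.smult_l_distr F.smult_r_distr F.smult_assoc1)
qed

lemma self_module_simps [simp]:
  "carrier (self_module K) = carrier K" "add (self_module K) = add K"
  "smult (self_module K) = mult K" "zero (self_module K) = zero K"
  by (simp_all add: self_module_def)

lemma (in cring) module_self: "module R (self_module R)"
proof -
  interpret abelian_group "self_module R"
    by (rule abelian_groupI) (auto simp: a_ac intro: l_neg)
  show ?thesis
    by (rule moduleI)
      (simp_all add: is_cring abelian_group_axioms l_distr r_distr m_assoc)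
qed

section \<open>Free modules\<close>

lemma free_module_simps:
  "carrier (free_module K S) =
    {r. range r \<subseteq> carrier K \<and> finite {p. r p \<noteq> \<zero>\<^bsub>K\<^esub>} \<and> {p. r p \<noteq> \<zero>\<^bsub>K\<^esub>} \<subseteq> S}"
  "zero (free_module K S) = (\<lambda>p. \<zero>\<^bsub>K\<^esub>)"
  "add (free_module K S) = (\<lambda>r s p. r p \<oplus>\<^bsub>K\<^esub> s p)"
  "smult (free_module K S) = (\<lambda>a r p. a \<otimes>\<^bsub>K\<^esub> r p)"
  by (simp_all add: free_module_def)

context cring
begin

lemma free_module_in_R: "r \<in> carrier (free_module R S) \<Longrightarrow> r p \<in> carrier R"
  by (auto simp: free_module_simps)

lemma free_module_closed:
  assumes r: "r \<in> carrier (free_module R S)"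
  shows "s \<in> carrier (free_module R S) \<Longrightarrow> (\<lambda>p. r p \<oplus> s p) \<in> carrier (free_module R S)"
    and "a \<in> carrier R \<Longrightarrow> (\<lambda>p. a \<otimes> r p) \<in> carrier (free_module R S)"
    and "(\<lambda>p. \<ominus> r p) \<in> carrier (free_module R S)"
proof -
  \<comment> \<open>The support of \<open>t\<close> lies in the union of the supports of
    \<open>r\<close> and \<open>s\<close>, so it is finite and inside \<open>S\<close>. Scaling and
    negation take \<open>s = r\<close>.\<close>
  have *: "(\<lambda>p. t p) \<in> carrier (free_module R S)"
    if "\<And>p. t p \<in> carrier R" "\<And>p. \<lbrakk>r p = \<zero>; s p = \<zero>\<rbrakk> \<Longrightarrow> t p = \<zero>" "s \<in> carrier (free_module R S)" for s t
  proof -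
    have "{p. t p \<noteq> \<zero>} \<subseteq> {p. r p \<noteq> \<zero>} \<union> {p. s p \<noteq> \<zero>}" using that(2) by auto
    then show ?thesis
      using r that(1,3) unfolding free_module_simps
      by (simp add: image_subset_iff) (meson finite_Un finite_subset le_sup_iff subset_trans)
  qed
  show "s \<in> carrier (free_module R S) \<Longrightarrow> (\<lambda>p. r p \<oplus> s p) \<in> carrier (free_module R S)"
    by (rule *) (simp_all add: free_module_in_R[OF r] free_module_in_R)
  show "a \<in> carrier R \<Longrightarrow> (\<lambda>p. a \<otimes> r p) \<in> carrier (free_module R S)"
    by (rule *[OF _ _ r]) (simp_all add: free_module_in_R[OF r])
  show "(\<lambda>p. \<ominus> r p) \<in> carrier (free_module R S)"
    by (rule *[OF _ _ r]) (simp_all add: free_module_in_R[OF r])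
qed

lemma module_free: "module R (free_module R S)"
proof (intro moduleI abelian_groupI)
  show "\<exists>y\<in>carrier (free_module R S). y \<oplus>\<^bsub>free_module R S\<^esub> x = \<zero>\<^bsub>free_module R S\<^esub>"
    if "x \<in> carrier (free_module R S)" for x
    using free_module_closed(3)[OF that] free_module_in_R[OF that]
    by (intro bexI[of _ "\<lambda>p. \<ominus> x p"]) (simp_all add: free_module_simps(2-4) l_neg)
  show "\<zero>\<^bsub>free_module R S\<^esub> \<in> carrier (free_module R S)"
    by (auto simp: free_module_simps)
qed (simp_all add: free_module_simps(2-4) free_module_closed free_module_in_R is_cring fun_eq_iff
    a_ac m_assoc l_distr r_distr)

lemma free_gen_closed: "p \<in> S \<Longrightarrow> free_gen R p \<in> carrier (free_module R S)"
proof -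
  have "{q. free_gen R p q \<noteq> \<zero>} \<subseteq> {p}" by (auto simp: free_gen_def)
  then show "p \<in> S \<Longrightarrow> free_gen R p \<in> carrier (free_module R S)"
    by (auto simp: free_module_simps intro: finite_subset) (auto simp: free_gen_def)
qed

text \<open>Induction on the size of the support: one support point \<open>p\<close> is deleted and
  put back as \<open>r p\<close> times a generator.\<close>

lemma free_module_induct [consumes 1, case_names zero add]:
  assumes "r \<in> carrier (free_module R S)"
    and zero: "P \<zero>\<^bsub>free_module R S\<^esub>"
    and add: "\<And>r a p. \<lbrakk>r \<in> carrier (free_module R S); a \<in> carrier R; p \<in> S; P r\<rbrakk> \<Longrightarrow>
      P (r \<oplus>\<^bsub>free_module R S\<^esub> a \<odot>\<^bsub>free_module R S\<^esub> free_gen R p)"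
  shows "P r"
  using assms(1)
proof (induction "card {p. r p \<noteq> \<zero>}" arbitrary: r)
  case 0
  then have "r = \<zero>\<^bsub>free_module R S\<^esub>"
    by (auto simp: free_module_simps)
  then show ?case using zero by simp
next
  case (Suc n)
  then have fin: "finite {p. r p \<noteq> \<zero>}" and R: "r q \<in> carrier R" and S: "{p. r p \<noteq> \<zero>} \<subseteq> S" for q
    by (auto simp: free_module_simps)
  obtain p where p: "r p \<noteq> \<zero>" using Suc.hyps(2) by fastforce
  define s where "s = r(p := \<zero>)"
  have supp: "{q. s q \<noteq> \<zero>} = {q. r q \<noteq> \<zero>} - {p}" by (auto simp: s_def)
  have s: "s \<in> carrier (free_module R S)"
    using supp fin R S by (auto simp: free_module_simps s_def)
  have "card {q. s q \<noteq> \<zero>} = n"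
    using supp fin p Suc.hyps(2) by simp
  then have "P s" using Suc.hyps(1) s by blast
  with s p S R have "P (s \<oplus>\<^bsub>free_module R S\<^esub> r p \<odot>\<^bsub>free_module R S\<^esub> free_gen R p)"
    by (intro add) auto
  also have "s \<oplus>\<^bsub>free_module R S\<^esub> r p \<odot>\<^bsub>free_module R S\<^esub> free_gen R p = r"
    using R by (auto simp: free_module_simps free_gen_def s_def)
  finally show ?case .
qed

text \<open>This is the sum that \<open>tensor_lift\<close> evaluates on a representative of a
  coset, so that \<open>tensor_lift\<close> becomes its descent to the quotient.\<close>

definition free_lift :: "('a, 'u, 'm) module_scheme \<Rightarrow> ('s \<Rightarrow> 'u) \<Rightarrow> ('s \<Rightarrow> 'a) \<Rightarrow> 'u"
  where "free_lift U f r = (\<Oplus>\<^bsub>U\<^esub>p\<in>{p. r p \<noteq> \<zero>}. r p \<odot>\<^bsub>U\<^esub> f p)"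

text \<open>The defining sum ranges over a support that changes with \<open>r\<close>. Terms outside
  the support are zero, so sums for different functions can be compared over one common finite
  set.\<close>

lemma free_lift_superset:
  assumes "module R U" "f \<in> S \<rightarrow> carrier U" "r \<in> carrier (free_module R S)"
    and "finite A" "{p. r p \<noteq> \<zero>} \<subseteq> A" "A \<subseteq> S"
  shows "free_lift U f r = (\<Oplus>\<^bsub>U\<^esub>p\<in>A. r p \<odot>\<^bsub>U\<^esub> f p)"
proof -
  interpret U: module R U by fact
  show ?thesis
    unfolding free_lift_def using assms free_module_in_R[OF assms(3)]
    by (intro U.add.finprod_mono_neutral_cong_left) (auto simp: Pi_iff subset_iff)
qed

lemma free_lift_linear:
  assumes "module R U" "f \<in> S \<rightarrow> carrier U"
  shows "linear_map R (free_module R S) U (free_lift U f)"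
proof -
  interpret U: module R U by fact
  interpret F: module R "free_module R S" by (rule module_free)
  note E = free_lift_superset[OF assms]
  note in_R = free_module_in_R
  have supp: "finite {p. r p \<noteq> \<zero>}" "{p. r p \<noteq> \<zero>} \<subseteq> S" if "r \<in> carrier (free_module R S)" for r
    using that by (auto simp: free_module_simps)
  have fin: "(\<lambda>p. r p \<odot>\<^bsub>U\<^esub> f p) \<in> A \<rightarrow> carrier U" if "r \<in> carrier (free_module R S)" "A \<subseteq> S" for r A
    using that in_R assms(2) by (auto intro!: U.smult_closed)
  show ?thesis
  proof (rule linear_mapI)
    fix r assume r: "r \<in> carrier (free_module R S)"
    show "free_lift U f r \<in> carrier U"
      unfolding free_lift_def by (intro U.finsum_closed fin r supp)
    show "free_lift U f (a \<odot>\<^bsub>free_module R S\<^esub> r) = a \<odot>\<^bsub>U\<^esub> free_lift U f r" if a: "a \<in> carrier R" for a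
    proof -
      let ?A = "{p. r p \<noteq> \<zero>}"
      have "free_lift U f (a \<odot>\<^bsub>free_module R S\<^esub> r) = (\<Oplus>\<^bsub>U\<^esub>p\<in>?A. (a \<odot>\<^bsub>free_module R S\<^esub> r) p \<odot>\<^bsub>U\<^esub> f p)"
        using supp[OF r] a r in_R[OF r] by (intro E F.smult_closed) (auto simp: free_module_simps(4))
      also have "\<dots> = (\<Oplus>\<^bsub>U\<^esub>p\<in>?A. a \<odot>\<^bsub>U\<^esub> (r p \<odot>\<^bsub>U\<^esub> f p))"
        using a in_R[OF r] assms(2) supp(2)[OF r]
        by (intro U.finsum_cong') (auto simp: free_module_simps(4) U.smult_assoc1 Pi_iff subset_iff)
      also have "\<dots> = a \<odot>\<^bsub>U\<^esub> free_lift U f r"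
        unfolding free_lift_def by (intro U.finsum_smult_ldistr[symmetric] supp r a fin)
      finally show ?thesis .
    qed
    fix s assume s: "s \<in> carrier (free_module R S)"
    \<comment> \<open>A common index set for \<open>r\<close>, \<open>s\<close> and their sum;
      cancellation may make the support of the sum strictly smaller.\<close>
    let ?A = "{p. r p \<noteq> \<zero>} \<union> {p. s p \<noteq> \<zero>}"
    have A: "finite ?A" "?A \<subseteq> S" using supp[OF r] supp[OF s] by auto
    have rs: "r \<oplus>\<^bsub>free_module R S\<^esub> s \<in> carrier (free_module R S)" using r s by simp
    have "free_lift U f (r \<oplus>\<^bsub>free_module R S\<^esub> s) =
        (\<Oplus>\<^bsub>U\<^esub>p\<in>?A. (r \<oplus>\<^bsub>free_module R S\<^esub> s) p \<odot>\<^bsub>U\<^esub> f p)"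
      using A rs by (intro E) (auto simp: free_module_simps(3))
    also have "\<dots> = (\<Oplus>\<^bsub>U\<^esub>p\<in>?A. r p \<odot>\<^bsub>U\<^esub> f p \<oplus>\<^bsub>U\<^esub> s p \<odot>\<^bsub>U\<^esub> f p)"
      using in_R[OF r] in_R[OF s] assms(2) A(2)
      by (intro U.finsum_cong') (auto simp: free_module_simps(3) U.smult_l_distr Pi_iff subset_iff)
    also have "\<dots> = (\<Oplus>\<^bsub>U\<^esub>p\<in>?A. r p \<odot>\<^bsub>U\<^esub> f p) \<oplus>\<^bsub>U\<^esub> (\<Oplus>\<^bsub>U\<^esub>p\<in>?A. s p \<odot>\<^bsub>U\<^esub> f p)"
      by (intro U.finsum_addf fin r s A)
    also have "(\<Oplus>\<^bsub>U\<^esub>p\<in>?A. r p \<odot>\<^bsub>U\<^esub> f p) = free_lift U f r"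
      using A by (intro E[symmetric] r) auto
    also have "(\<Oplus>\<^bsub>U\<^esub>p\<in>?A. s p \<odot>\<^bsub>U\<^esub> f p) = free_lift U f s"
      using A by (intro E[symmetric] s) auto
    finally show "free_lift U f (r \<oplus>\<^bsub>free_module R S\<^esub> s) = free_lift U f r \<oplus>\<^bsub>U\<^esub> free_lift U f s" .
  qed
qed

lemma free_lift_gen:
  assumes "module R U" "f \<in> S \<rightarrow> carrier U" "p \<in> S"
  shows "free_lift U f (free_gen R p) = f p"
proof -
  interpret U: module R U by fact
  have "free_lift U f (free_gen R p) = (\<Oplus>\<^bsub>U\<^esub>q\<in>{p}. free_gen R p q \<odot>\<^bsub>U\<^esub> f q)"
    using assms by (intro free_lift_superset free_gen_closed) (auto simp: free_gen_def)
  also have "\<dots> = f p"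
    using assms by (subst U.finsum_insert) (auto simp: free_gen_def Pi_iff)
  finally show ?thesis .
qed

end

section \<open>Tensor products\<close>

context cring
begin

section \<open>Construction of the tensor product as a quotient of a free module\<close>

context
  fixes V :: "('a, 'v, 'm) module_scheme" and W :: "('a, 'w, 'n) module_scheme"
  assumes V: "module R V" and W: "module R W"
begin

interpretation V: module R V by (rule V)
interpretation W: module R W by (rule W)
interpretation F: module R "tensor_free R V W" by (rule module_free)

lemma tensor_gen_closed:
  "\<lbrakk>v \<in> carrier V; w \<in> carrier W\<rbrakk> \<Longrightarrow> free_gen R (v, w) \<in> carrier (tensor_free R V W)"
  by (rule free_gen_closed) simp

lemma tensor_relators_closed: "tensor_relators R V W \<subseteq> carrier (tensor_free R V W)"
  by (auto elim!: tensor_relators.cases intro!: F.minus_closed F.a_closed F.smult_closed tensor_gen_closed)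

lemma submodule_tensor_null: "submodule (tensor_null R V W) R (tensor_free R V W)"
proof (rule F.submoduleI)
  let ?S = "{N. submodule N R (tensor_free R V W) \<and> tensor_relators R V W \<subseteq> N}"
  \<comment> \<open>The whole free module is a member of the family, so the intersection is over a
    nonempty family and stays inside the carrier.\<close>
  have "carrier (tensor_free R V W) \<in> ?S"
    using F.carrier_is_submodule tensor_relators_closed by simp
  then show "tensor_null R V W \<subseteq> carrier (tensor_free R V W)"
    unfolding tensor_null_def by blast
  show "\<zero>\<^bsub>tensor_free R V W\<^esub> \<in> tensor_null R V W"
    unfolding tensor_null_def using subgroup.one_closed[OF submodule.axioms(1)] by fastforce
  show "\<ominus>\<^bsub>tensor_free R V W\<^esub> a \<in> tensor_null R V W" if "a \<in> tensor_null R V W" for a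
    using that F.submoduleE(3) unfolding tensor_null_def by blast
  show "a \<oplus>\<^bsub>tensor_free R V W\<^esub> b \<in> tensor_null R V W"
    if "a \<in> tensor_null R V W" "b \<in> tensor_null R V W" for a b
    using that F.submoduleE(5) unfolding tensor_null_def by blast
  show "a \<odot>\<^bsub>tensor_free R V W\<^esub> x \<in> tensor_null R V W"
    if "a \<in> carrier R" "x \<in> tensor_null R V W" for a x
    using that F.submoduleE(4) unfolding tensor_null_def by blast
qed

lemma tensor_relators_null: "tensor_relators R V W \<subseteq> tensor_null R V W"
  unfolding tensor_null_def by blast

abbreviation (input) tensor_class :: "('v \<times> 'w \<Rightarrow> 'a) \<Rightarrow> ('a, 'v, 'w) tensor"
  where "tensor_class r \<equiv> tensor_null R V W +>\<^bsub>tensor_free R V W\<^esub> r"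

interpretation N: abelian_subgroup "tensor_null R V W" "tensor_free R V W"
  using submodule.axioms(1)[OF submodule_tensor_null]
  by (intro abelian_subgroupI3 additive_subgroupI F.abelian_group_axioms)

lemma tensor_class_eqI:
  assumes "r \<in> carrier (tensor_free R V W)" "s \<in> carrier (tensor_free R V W)"
    and "r \<ominus>\<^bsub>tensor_free R V W\<^esub> s \<in> tensor_null R V W"
  shows "tensor_class r = tensor_class s"
  using N.a_rcos_module[OF assms(2,1)] N.a_repr_independence'[OF _ assms(2)] assms(3)
  by (simp add: a_minus_def)

lemma tensor_module_carrier:
  "carrier (tensor_module R V W) = tensor_class ` carrier (tensor_free R V W)"
  by (auto simp: tensor_module_def A_RCOSETS_def' Let_def)

lemma tensor_module_zero: "\<zero>\<^bsub>tensor_module R V W\<^esub> = tensor_class \<zero>\<^bsub>tensor_free R V W\<^esub>"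
  using N.a_rcos_const[OF N.zero_closed] by (simp add: tensor_module_def Let_def)

lemma tensor_module_add:
  assumes "r \<in> carrier (tensor_free R V W)" "s \<in> carrier (tensor_free R V W)"
  shows "tensor_class r \<oplus>\<^bsub>tensor_module R V W\<^esub> tensor_class s = tensor_class (r \<oplus>\<^bsub>tensor_free R V W\<^esub> s)"
  using N.a_rcos_sum[OF assms] by (simp add: tensor_module_def Let_def)

text \<open>The scalar multiple is a union over all representatives. It collapses to a single coset
  because the null submodule is stable under scaling.\<close>

lemma tensor_module_smult:
  assumes a: "a \<in> carrier R" and r: "r \<in> carrier (tensor_free R V W)"
  shows "a \<odot>\<^bsub>tensor_module R V W\<^esub> tensor_class r = tensor_class (a \<odot>\<^bsub>tensor_free R V W\<^esub> r)"
proof -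
  have eq: "tensor_class (a \<odot>\<^bsub>tensor_free R V W\<^esub> x) = tensor_class (a \<odot>\<^bsub>tensor_free R V W\<^esub> r)"
    if x: "x \<in> tensor_class r" for x
  proof -
    have x': "x \<in> carrier (tensor_free R V W)" using N.a_elemrcos_carrier[OF r x] .
    have "x \<ominus>\<^bsub>tensor_free R V W\<^esub> r \<in> tensor_null R V W"
      using N.a_rcos_module[OF r x'] x by (simp add: a_minus_def)
    then have "a \<odot>\<^bsub>tensor_free R V W\<^esub> (x \<ominus>\<^bsub>tensor_free R V W\<^esub> r) \<in> tensor_null R V W"
      using F.submoduleE(4)[OF submodule_tensor_null a] by blast
    then show ?thesis
      using a r x' by (intro tensor_class_eqI) (simp_all add: a_minus_def F.smult_r_distr F.smult_r_minus)
  qed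
  have "a \<odot>\<^bsub>tensor_module R V W\<^esub> tensor_class r =
      (\<Union>x\<in>tensor_class r. tensor_class (a \<odot>\<^bsub>tensor_free R V W\<^esub> x))"
    by (simp add: tensor_module_def Let_def)
  also have "\<dots> = tensor_class (a \<odot>\<^bsub>tensor_free R V W\<^esub> r)"
    using eq N.a_rcos_self[OF r] by blast
  finally show ?thesis .
qed

lemma module_tensor [simp, intro]: "module R (tensor_module R V W)"
  by (rule module_image[OF F.module_axioms tensor_module_carrier])
    (simp_all add: tensor_module_zero tensor_module_add tensor_module_smult)

text \<open>Each of the four laws is one of the four kinds of relators, whose differences are
  null.\<close>

lemma pure_tensor_bilinear: "bilinear_map R V W (tensor_module R V W) (pure_tensor R V W)"
proof (intro bilinear_mapI linear_mapI)
  note gen = tensor_gen_closed and rel = subsetD[OF tensor_relators_null]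
  fix v w assume v: "v \<in> carrier V" and w: "w \<in> carrier W"
  show closed: "pure_tensor R V W v w \<in> carrier (tensor_module R V W)"
    using v w by (simp add: pure_tensor_def tensor_module_carrier gen)
  then show "pure_tensor R V W v w \<in> carrier (tensor_module R V W)" .
  show "pure_tensor R V W (v \<oplus>\<^bsub>V\<^esub> v') w =
      pure_tensor R V W v w \<oplus>\<^bsub>tensor_module R V W\<^esub> pure_tensor R V W v' w" if "v' \<in> carrier V" for v'
    using v w that unfolding pure_tensor_def
    by (subst tensor_module_add) (simp_all add: gen tensor_class_eqI rel tensor_relators.add_left)
  show "pure_tensor R V W v (w \<oplus>\<^bsub>W\<^esub> w') =
      pure_tensor R V W v w \<oplus>\<^bsub>tensor_module R V W\<^esub> pure_tensor R V W v w'" if "w' \<in> carrier W" for w'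
    using v w that unfolding pure_tensor_def
    by (subst tensor_module_add) (simp_all add: gen tensor_class_eqI rel tensor_relators.add_right)
  show "pure_tensor R V W (a \<odot>\<^bsub>V\<^esub> v) w = a \<odot>\<^bsub>tensor_module R V W\<^esub> pure_tensor R V W v w"
    if "a \<in> carrier R" for a
    using v w that unfolding pure_tensor_def
    by (subst tensor_module_smult) (simp_all add: gen tensor_class_eqI rel tensor_relators.smult_left)
  show "pure_tensor R V W v (a \<odot>\<^bsub>W\<^esub> w) = a \<odot>\<^bsub>tensor_module R V W\<^esub> pure_tensor R V W v w"
    if "a \<in> carrier R" for a
    using v w that unfolding pure_tensor_def
    by (subst tensor_module_smult) (simp_all add: gen tensor_class_eqI rel tensor_relators.smult_right)
qed

text \<open>There is no case for scalars or zero: a scalar is absorbed into the left factor of a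
  pure tensor, and the zero class is the pure tensor of two zeros.\<close>

lemma tensor_induct [consumes 1, case_names pure add]:
  assumes t: "t \<in> carrier (tensor_module R V W)"
    and pure: "\<And>v w. \<lbrakk>v \<in> carrier V; w \<in> carrier W\<rbrakk> \<Longrightarrow> P (pure_tensor R V W v w)"
    and add: "\<And>s t. \<lbrakk>s \<in> carrier (tensor_module R V W); t \<in> carrier (tensor_module R V W); P s; P t\<rbrakk>
      \<Longrightarrow> P (s \<oplus>\<^bsub>tensor_module R V W\<^esub> t)"
  shows "P t"
proof -
  have pure_smult: "tensor_class (a \<odot>\<^bsub>tensor_free R V W\<^esub> free_gen R (v, w)) = pure_tensor R V W (a \<odot>\<^bsub>V\<^esub> v) w"
    if "a \<in> carrier R" "v \<in> carrier V" "w \<in> carrier W" for a v w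
    using tensor_module_smult[OF that(1) tensor_gen_closed[OF that(2,3)]]
      linear_map_smult[OF bilinear_mapD(2)[OF pure_tensor_bilinear that(3)] that(1,2)]
    by (simp add: pure_tensor_def)
  have "P (tensor_class r)" if "r \<in> carrier (tensor_free R V W)" for r
    using that
  proof (induction rule: free_module_induct)
    case zero
    have "tensor_class \<zero>\<^bsub>tensor_free R V W\<^esub> =
        tensor_class (\<zero> \<odot>\<^bsub>tensor_free R V W\<^esub> free_gen R (\<zero>\<^bsub>V\<^esub>, \<zero>\<^bsub>W\<^esub>))"
      by (simp add: tensor_gen_closed)
    then show ?case
      using pure_smult pure by simp
  next
    case (add r a p)
    then obtain v w where p: "p = (v, w)" "v \<in> carrier V" "w \<in> carrier W" by auto
    have av: "a \<odot>\<^bsub>V\<^esub> v \<in> carrier V"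
      using add.hyps(2) p(2) by simp
    have "tensor_class (r \<oplus>\<^bsub>tensor_free R V W\<^esub> a \<odot>\<^bsub>tensor_free R V W\<^esub> free_gen R p) =
        tensor_class r \<oplus>\<^bsub>tensor_module R V W\<^esub> pure_tensor R V W (a \<odot>\<^bsub>V\<^esub> v) w"
      unfolding p(1) pure_smult[OF add.hyps(2) p(2,3), symmetric]
      using add.hyps p by (intro tensor_module_add[symmetric] F.smult_closed tensor_gen_closed)
    moreover have "P (tensor_class r \<oplus>\<^bsub>tensor_module R V W\<^esub> pure_tensor R V W (a \<odot>\<^bsub>V\<^esub> v) w)"
      using add.hyps(1)
      by (intro assms(3) pure add.IH av p(3) bilinear_map_closed[OF pure_tensor_bilinear])
        (simp add: tensor_module_carrier)
    ultimately show ?case by (simp only:)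
  qed
  then show ?thesis using t by (auto simp: tensor_module_carrier)
qed

section \<open>Universal property of the tensor product\<close>

context
  fixes U :: "('a, 'u, 'l) module_scheme" and f :: "'v \<Rightarrow> 'w \<Rightarrow> 'u"
  assumes U: "module R U" and f: "bilinear_map R V W U f"
begin

interpretation U: module R U by (rule U)

abbreviation (input) free_ext :: "('v \<times> 'w \<Rightarrow> 'a) \<Rightarrow> 'u"
  where "free_ext \<equiv> free_lift U (\<lambda>p. f (fst p) (snd p))"

lemma free_ext_linear: "linear_map R (tensor_free R V W) U free_ext"
  using bilinear_map_closed[OF f] by (intro free_lift_linear U) auto

lemma free_ext_gen:
  assumes "v \<in> carrier V" "w \<in> carrier W"
  shows "free_ext (free_gen R (v, w)) = f v w"
  using assms bilinear_map_closed[OF f] by (subst free_lift_gen[OF U, of _ "carrier V \<times> carrier W"]) auto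

text \<open>The kernel of \<open>free_ext\<close> is a submodule, and bilinearity of
  \<open>f\<close> puts every relator into it; \<open>tensor_null\<close> is the least submodule of
  this kind.\<close>

lemma free_ext_null:
  assumes "r \<in> tensor_null R V W"
  shows "free_ext r = \<zero>\<^bsub>U\<^esub>"
proof -
  let ?F = "tensor_free R V W"
  let ?N = "{r \<in> carrier ?F. free_ext r = \<zero>\<^bsub>U\<^esub>}"
  note gen = tensor_gen_closed
  note ext = linear_map_minus[OF free_ext_linear F.module_axioms U] linear_map_add[OF free_ext_linear]
    linear_map_smult[OF free_ext_linear] linear_map_zero[OF free_ext_linear F.module_axioms U]
  have inv: "free_ext (\<ominus>\<^bsub>?F\<^esub> r) = \<zero>\<^bsub>U\<^esub>" if "r \<in> carrier ?F" "free_ext r = \<zero>\<^bsub>U\<^esub>" for r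
    using ext(1)[of "\<zero>\<^bsub>?F\<^esub>" r] that by (simp add: ext a_minus_def)
  have "submodule ?N R ?F"
    by (rule F.submoduleI) (auto simp: ext inv)
  moreover have "tensor_relators R V W \<subseteq> ?N"
  proof
    fix r assume r: "r \<in> tensor_relators R V W"
    then have "r \<in> carrier ?F" using tensor_relators_closed by blast
    moreover have "free_ext r = \<zero>\<^bsub>U\<^esub>"
      using r
    proof cases
      case (add_left v v' w)
      then show ?thesis
        using linear_map_add[OF bilinear_mapD(2)[OF f]] bilinear_map_closed[OF f]
        by (simp add: ext gen free_ext_gen U.minus_eq_zero_iff)
    next
      case (add_right v w w')
      then show ?thesis
        using linear_map_add[OF bilinear_mapD(1)[OF f]] bilinear_map_closed[OF f]
        by (simp add: ext gen free_ext_gen U.minus_eq_zero_iff)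
    next
      case (smult_left a v w)
      then show ?thesis
        using linear_map_smult[OF bilinear_mapD(2)[OF f]] bilinear_map_closed[OF f]
        by (simp add: ext gen free_ext_gen U.minus_eq_zero_iff)
    next
      case (smult_right a v w)
      then show ?thesis
        using linear_map_smult[OF bilinear_mapD(1)[OF f]] bilinear_map_closed[OF f]
        by (simp add: ext gen free_ext_gen U.minus_eq_zero_iff)
    qed
    ultimately show "r \<in> ?N" by simp
  qed
  ultimately show ?thesis
    using assms unfolding tensor_null_def by blast
qed

text \<open>This gives \<open>the_elem\<close> in \<open>tensor_lift\<close> its meaning:
  representatives of a coset differ by null elements, on which \<open>free_ext\<close> vanishes, so
  the image of the coset is a singleton.\<close>

lemma tensor_lift_class:
  assumes r: "r \<in> carrier (tensor_free R V W)"
  shows "tensor_lift R U f (tensor_class r) = free_ext r"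
proof -
  have "free_ext x = free_ext r" if x: "x \<in> tensor_class r" for x
  proof -
    have x': "x \<in> carrier (tensor_free R V W)" using N.a_elemrcos_carrier[OF r x] .
    have "free_ext (x \<ominus>\<^bsub>tensor_free R V W\<^esub> r) = \<zero>\<^bsub>U\<^esub>"
      using N.a_rcos_module[OF r x'] x by (intro free_ext_null) (simp add: a_minus_def)
    then show ?thesis
      using linear_map_closed[OF free_ext_linear] r x'
      by (simp add: linear_map_minus[OF free_ext_linear F.module_axioms U] U.minus_eq_zero_iff)
  qed
  then have "free_ext ` tensor_class r = {free_ext r}"
    using N.a_rcos_self[OF r] by blast
  then show ?thesis
    by (simp add: tensor_lift_def free_lift_def)
qed

lemma tensor_lift_linear: "linear_map R (tensor_module R V W) U (tensor_lift R U f)"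
  using linear_map_closed[OF free_ext_linear] linear_map_add[OF free_ext_linear]
    linear_map_smult[OF free_ext_linear]
  by (intro linear_mapI)
    (auto simp: tensor_module_carrier tensor_module_add tensor_module_smult tensor_lift_class)

lemma tensor_lift_pure:
  assumes "v \<in> carrier V" "w \<in> carrier W"
  shows "tensor_lift R U f (pure_tensor R V W v w) = f v w"
  using assms by (simp add: pure_tensor_def tensor_lift_class tensor_gen_closed free_ext_gen)

end

end

end

text \<open>
  Coassociativity of a tensor product of coalgebras needs the interchange with four different factors.
\<close>

definition middle_four ::
  "('k, 'r) ring_scheme \<Rightarrow> ('k, 'u, 'l) module_scheme \<Rightarrow> ('k, 'v, 'm) module_scheme
    \<Rightarrow> ('k, 'w, 'n) module_scheme \<Rightarrow> ('k, 'x, 'o) module_scheme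
    \<Rightarrow> ('k, ('k, 'u, 'v) tensor, ('k, 'w, 'x) tensor) tensor
    \<Rightarrow> ('k, ('k, 'u, 'w) tensor, ('k, 'v, 'x) tensor) tensor"
  where "middle_four K U V W X =
    (let UW = tensor_module K U W; VX = tensor_module K V X; T = tensor_module K UW VX in
      tensor_lift K T (\<lambda>s t. tensor_lift K T (\<lambda>u v. tensor_lift K T (\<lambda>w x.
        pure_tensor K UW VX (pure_tensor K U W u w) (pure_tensor K V X v x)) t) s))"

lemma tensor_interchange_middle_four: "tensor_interchange K V W = middle_four K V V W W"
  by (simp add: tensor_interchange_def middle_four_def Let_def)

context cring
begin

section \<open>Extensionality and linearity rules for maps on tensor products\<close>

lemma module_closed:
  assumes "module R V"
  shows "\<lbrakk>x \<in> carrier V; y \<in> carrier V\<rbrakk> \<Longrightarrow> x \<oplus>\<^bsub>V\<^esub> y \<in> carrier V"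
    and "\<lbrakk>a \<in> carrier R; x \<in> carrier V\<rbrakk> \<Longrightarrow> a \<odot>\<^bsub>V\<^esub> x \<in> carrier V"
proof -
  interpret module R V by fact
  show "\<lbrakk>x \<in> carrier V; y \<in> carrier V\<rbrakk> \<Longrightarrow> x \<oplus>\<^bsub>V\<^esub> y \<in> carrier V" by simp
  show "\<lbrakk>a \<in> carrier R; x \<in> carrier V\<rbrakk> \<Longrightarrow> a \<odot>\<^bsub>V\<^esub> x \<in> carrier V" by simp
qed

lemma pure_tensor_closed [simp]:
  assumes "module R V" "module R W" "v \<in> carrier V" "w \<in> carrier W"
  shows "pure_tensor R V W v w \<in> carrier (tensor_module R V W)"
  by (rule bilinear_map_closed[OF pure_tensor_bilinear]) fact+

lemma pure_tensor_smult:
  assumes "module R V" "module R W" "v \<in> carrier V" "w \<in> carrier W" "a \<in> carrier R"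
  shows "pure_tensor R V W (a \<odot>\<^bsub>V\<^esub> v) w = a \<odot>\<^bsub>tensor_module R V W\<^esub> pure_tensor R V W v w"
    and "pure_tensor R V W v (a \<odot>\<^bsub>W\<^esub> w) = a \<odot>\<^bsub>tensor_module R V W\<^esub> pure_tensor R V W v w"
  using linear_map_smult[OF bilinear_mapD(2)[OF pure_tensor_bilinear[OF assms(1,2)] assms(4)] assms(5,3)]
    linear_map_smult[OF bilinear_mapD(1)[OF pure_tensor_bilinear[OF assms(1,2)] assms(3)] assms(5,4)]
  by simp_all

text \<open>The conclusion is a bounded statement about all tensors, so that it can serve as a
  rewrite rule for the particular tensors \<open>comult C c\<close> met later.\<close>

lemma tensor_ext:
  assumes "module R V" "module R W"
    and f: "linear_map R (tensor_module R V W) U f"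
    and g: "linear_map R (tensor_module R V W) U g"
    and eq: "\<And>v w. \<lbrakk>v \<in> carrier V; w \<in> carrier W\<rbrakk> \<Longrightarrow>
      f (pure_tensor R V W v w) = g (pure_tensor R V W v w)"
  shows "\<forall>t\<in>carrier (tensor_module R V W). f t = g t"
proof
  show "f t = g t" if "t \<in> carrier (tensor_module R V W)" for t
    using that by (induction rule: tensor_induct[OF assms(1,2), consumes 1])
      (simp_all add: eq linear_map_add[OF f] linear_map_add[OF g])
qed

text \<open>For expressions linear in each of two tensors, such as those obtained when the
  coproducts in two coalgebras are both made arbitrary. Agreement is extended in \<open>t\<close>
  for pure \<open>s\<close>, then in \<open>s\<close>.\<close>

lemma tensor_ext2:
  assumes modules: "module R V" "module R W" "module R V'" "module R W'"
    and f: "\<And>t. t \<in> carrier (tensor_module R V' W') \<Longrightarrow> linear_map R (tensor_module R V W) U (\<lambda>s. f s t)"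
    and g: "\<And>t. t \<in> carrier (tensor_module R V' W') \<Longrightarrow> linear_map R (tensor_module R V W) U (\<lambda>s. g s t)"
    and f': "\<And>s. s \<in> carrier (tensor_module R V W) \<Longrightarrow> linear_map R (tensor_module R V' W') U (f s)"
    and g': "\<And>s. s \<in> carrier (tensor_module R V W) \<Longrightarrow> linear_map R (tensor_module R V' W') U (g s)"
    and eq: "\<And>v w v' w'. \<lbrakk>v \<in> carrier V; w \<in> carrier W; v' \<in> carrier V'; w' \<in> carrier W'\<rbrakk> \<Longrightarrow>
      f (pure_tensor R V W v w) (pure_tensor R V' W' v' w') =
      g (pure_tensor R V W v w) (pure_tensor R V' W' v' w')"
  shows "\<forall>s\<in>carrier (tensor_module R V W). \<forall>t\<in>carrier (tensor_module R V' W'). f s t = g s t"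
proof -
  have "\<forall>t\<in>carrier (tensor_module R V' W'). f (pure_tensor R V W v w) t = g (pure_tensor R V W v w) t"
    if "v \<in> carrier V" "w \<in> carrier W" for v w
    using that modules by (intro tensor_ext[where U = U] f' g' eq) auto
  then have "\<forall>s\<in>carrier (tensor_module R V W). f s t = g s t" if "t \<in> carrier (tensor_module R V' W')" for t
    using that modules by (intro tensor_ext[where U = U] f g) auto
  then show ?thesis by blast
qed

lemma tensor_ext_left:
  assumes "module R U" "module R V" "module R W"
    and f: "linear_map R (tensor_module R (tensor_module R U V) W) X f"
    and g: "linear_map R (tensor_module R (tensor_module R U V) W) X g"
    and eq: "\<And>u v w. \<lbrakk>u \<in> carrier U; v \<in> carrier V; w \<in> carrier W\<rbrakk> \<Longrightarrow>
      f (pure_tensor R (tensor_module R U V) W (pure_tensor R U V u v) w) =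
      g (pure_tensor R (tensor_module R U V) W (pure_tensor R U V u v) w)"
  shows "\<forall>t\<in>carrier (tensor_module R (tensor_module R U V) W). f t = g t"
proof (rule tensor_ext[OF _ _ f g])
  note pure = bilinear_mapD(2)[OF pure_tensor_bilinear[OF module_tensor[OF assms(1,2)] assms(3)]]
  have "\<forall>s\<in>carrier (tensor_module R U V). f (pure_tensor R (tensor_module R U V) W s w) =
      g (pure_tensor R (tensor_module R U V) W s w)" if "w \<in> carrier W" for w
    using that assms by (intro tensor_ext[where U = X] linear_map_comp[OF f] linear_map_comp[OF g] pure eq)
  then show "f (pure_tensor R (tensor_module R U V) W s w) = g (pure_tensor R (tensor_module R U V) W s w)"
    if "s \<in> carrier (tensor_module R U V)" "w \<in> carrier W" for s w
    using that by blast
qed (use assms in auto)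

text \<open>The associator brings in three coproducts at once, hence three independent
  tensors.\<close>

lemma tensor_ext3:
  assumes modules: "module R V" "module R W" "module R V'" "module R W'" "module R V''" "module R W''"
    and f: "\<And>s t. \<lbrakk>s \<in> carrier (tensor_module R V' W'); t \<in> carrier (tensor_module R V'' W'')\<rbrakk> \<Longrightarrow>
      linear_map R (tensor_module R V W) U (\<lambda>r. f r s t)"
    and g: "\<And>s t. \<lbrakk>s \<in> carrier (tensor_module R V' W'); t \<in> carrier (tensor_module R V'' W'')\<rbrakk> \<Longrightarrow>
      linear_map R (tensor_module R V W) U (\<lambda>r. g r s t)"
    and f': "\<And>r t. \<lbrakk>r \<in> carrier (tensor_module R V W); t \<in> carrier (tensor_module R V'' W'')\<rbrakk> \<Longrightarrow>
      linear_map R (tensor_module R V' W') U (\<lambda>s. f r s t)"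
    and g': "\<And>r t. \<lbrakk>r \<in> carrier (tensor_module R V W); t \<in> carrier (tensor_module R V'' W'')\<rbrakk> \<Longrightarrow>
      linear_map R (tensor_module R V' W') U (\<lambda>s. g r s t)"
    and f'': "\<And>r s. \<lbrakk>r \<in> carrier (tensor_module R V W); s \<in> carrier (tensor_module R V' W')\<rbrakk> \<Longrightarrow>
      linear_map R (tensor_module R V'' W'') U (f r s)"
    and g'': "\<And>r s. \<lbrakk>r \<in> carrier (tensor_module R V W); s \<in> carrier (tensor_module R V' W')\<rbrakk> \<Longrightarrow>
      linear_map R (tensor_module R V'' W'') U (g r s)"
    and eq: "\<And>v w v' w' v'' w''. \<lbrakk>v \<in> carrier V; w \<in> carrier W; v' \<in> carrier V'; w' \<in> carrier W';
        v'' \<in> carrier V''; w'' \<in> carrier W''\<rbrakk> \<Longrightarrow>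
      f (pure_tensor R V W v w) (pure_tensor R V' W' v' w') (pure_tensor R V'' W'' v'' w'') =
      g (pure_tensor R V W v w) (pure_tensor R V' W' v' w') (pure_tensor R V'' W'' v'' w'')"
  shows "\<forall>r\<in>carrier (tensor_module R V W). \<forall>s\<in>carrier (tensor_module R V' W').
    \<forall>t\<in>carrier (tensor_module R V'' W''). f r s t = g r s t"
proof -
  have "\<forall>s\<in>carrier (tensor_module R V' W'). \<forall>t\<in>carrier (tensor_module R V'' W'').
      f (pure_tensor R V W v w) s t = g (pure_tensor R V W v w) s t"
    if "v \<in> carrier V" "w \<in> carrier W" for v w
    using that modules by (intro tensor_ext2[where U = U] f' g' f'' g'' eq) auto
  then have "\<forall>r\<in>carrier (tensor_module R V W). f r s t = g r s t"
    if "s \<in> carrier (tensor_module R V' W')" "t \<in> carrier (tensor_module R V'' W'')" for s t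
    using that modules by (intro tensor_ext[where U = U] f g) auto
  then show ?thesis by blast
qed

text \<open>Here the argument \<open>x\<close> sits inside the lifted bilinear map while the tensor
  \<open>t\<close> is fixed, so composition of linear maps does not apply and induction on
  \<open>t\<close> is used. It makes nested lifts, as in the associator and the interchange,
  bilinear.\<close>

lemma tensor_lift_linear_param:
  assumes modules: "module R V" "module R W" "module R U" "module R X"
    and bil: "\<And>x. x \<in> carrier X \<Longrightarrow> bilinear_map R V W U (f x)"
    and lin: "\<And>v w. \<lbrakk>v \<in> carrier V; w \<in> carrier W\<rbrakk> \<Longrightarrow> linear_map R X U (\<lambda>x. f x v w)"
    and t: "t \<in> carrier (tensor_module R V W)"
  shows "linear_map R X U (\<lambda>x. tensor_lift R U (f x) t)"
proof -
  interpret U: module R U by fact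
  note lift = tensor_lift_linear[OF modules(1-3) bil] tensor_lift_pure[OF modules(1-3) bil]
  note closed = linear_map_closed[OF lift(1)] module_closed[OF modules(4)]
  note add = linear_map_add[OF lift(1)]
  show ?thesis
  proof (rule linear_mapI)
    show "tensor_lift R U (f x) t \<in> carrier U" if "x \<in> carrier X" for x
      using that t by (rule closed)
    show "tensor_lift R U (f (x \<oplus>\<^bsub>X\<^esub> y)) t = tensor_lift R U (f x) t \<oplus>\<^bsub>U\<^esub> tensor_lift R U (f y) t"
      if "x \<in> carrier X" "y \<in> carrier X" for x y
      using t that by (induction rule: tensor_induct[OF modules(1,2), consumes 1])
        (simp_all add: lift closed add linear_map_add[OF lin] U.a_ac)
    show "tensor_lift R U (f (a \<odot>\<^bsub>X\<^esub> x)) t = a \<odot>\<^bsub>U\<^esub> tensor_lift R U (f x) t"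
      if "a \<in> carrier R" "x \<in> carrier X" for a x
      using t that by (induction rule: tensor_induct[OF modules(1,2), consumes 1])
        (simp_all add: lift closed add linear_map_smult[OF lin] U.smult_r_distr)
  qed
qed

text \<open>This and the following linearity rules carry an inner linear map \<open>h\<close>, so
  that linearity of a nested expression is found by peeling off one constructor at a time.\<close>

lemma linear_map_tensor_lift:
  assumes "linear_map R X (tensor_module R V W) h" "module R V" "module R W" "module R U"
    and "bilinear_map R V W U f"
  shows "linear_map R X U (\<lambda>x. tensor_lift R U f (h x))"
  by (rule linear_map_comp[OF tensor_lift_linear]) fact+

lemma linear_map_pure_tensor_left:
  assumes "linear_map R X V h" "module R V" "module R W" "w \<in> carrier W"
  shows "linear_map R X (tensor_module R V W) (\<lambda>x. pure_tensor R V W (h x) w)"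
  using assms by (intro linear_map_comp[OF bilinear_mapD(2)[OF pure_tensor_bilinear]]) auto

lemma linear_map_pure_tensor_right:
  assumes "linear_map R X W h" "module R V" "module R W" "v \<in> carrier V"
  shows "linear_map R X (tensor_module R V W) (\<lambda>x. pure_tensor R V W v (h x))"
  using assms by (intro linear_map_comp[OF bilinear_mapD(1)[OF pure_tensor_bilinear]]) auto

lemma tensor_lift_cong:
  assumes "module R V" "module R W" "module R U" "bilinear_map R V W U f"
    and "\<And>v w. \<lbrakk>v \<in> carrier V; w \<in> carrier W\<rbrakk> \<Longrightarrow> g v w = f v w"
    and t: "t \<in> carrier (tensor_module R V W)"
  shows "tensor_lift R U g t = tensor_lift R U f t"
proof -
  have g: "bilinear_map R V W U g"
    using assms(4,1,2,5) by (rule bilinear_map_cong)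
  have "\<forall>t\<in>carrier (tensor_module R V W). tensor_lift R U g t = tensor_lift R U f t"
    using assms g by (intro tensor_ext[where U = U] tensor_lift_linear) (auto simp: tensor_lift_pure)
  with t show ?thesis by blast
qed

lemma bilinear_map_pure_tensor:
  assumes "module R V" "module R W" "linear_map R V' V f" "linear_map R W' W g"
  shows "bilinear_map R V' W' (tensor_module R V W) (\<lambda>v w. pure_tensor R V W (f v) (g w))"
  by (rule bilinear_map_comp[OF pure_tensor_bilinear linear_map_id]) fact+

lemma linear_map_tensor_map:
  assumes "linear_map R X (tensor_module R V' W') h" "module R V" "module R W" "module R V'" "module R W'"
    and "linear_map R V' V f" "linear_map R W' W g"
  shows "linear_map R X (tensor_module R V W) (\<lambda>x. tensor_map R V W f g (h x))"
  unfolding tensor_map_def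
  by (rule linear_map_tensor_lift[OF assms(1,4,5) module_tensor[OF assms(2,3)] bilinear_map_pure_tensor]) fact+

lemma tensor_map_pure [simp]:
  assumes "module R V" "module R W" "module R V'" "module R W'" "linear_map R V' V f" "linear_map R W' W g"
    and "v \<in> carrier V'" "w \<in> carrier W'"
  shows "tensor_map R V W f g (pure_tensor R V' W' v w) = pure_tensor R V W (f v) (g w)"
  unfolding tensor_map_def using assms
  by (subst tensor_lift_pure[OF assms(3,4) _ bilinear_map_pure_tensor]) auto

lemma tensor_map_cong:
  assumes "module R V" "module R W" "module R V'" "module R W'" "linear_map R V' V f" "linear_map R W' W g"
    and "\<And>v. v \<in> carrier V' \<Longrightarrow> f' v = f v" "\<And>w. w \<in> carrier W' \<Longrightarrow> g' w = g w"
    and "t \<in> carrier (tensor_module R V' W')"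
  shows "tensor_map R V W f' g' t = tensor_map R V W f g t"
  unfolding tensor_map_def using assms
  by (intro tensor_lift_cong[of V' W'] bilinear_map_pure_tensor) auto

lemma tensor_map_id:
  assumes "module R V" "module R W" "t \<in> carrier (tensor_module R V W)"
  shows "tensor_map R V W (\<lambda>x. x) (\<lambda>x. x) t = t"
proof -
  have "\<forall>t\<in>carrier (tensor_module R V W). tensor_map R V W (\<lambda>x. x) (\<lambda>x. x) t = t"
    by (rule tensor_ext) (rule linear_map_tensor_map linear_map_id | simp add: assms(1,2))+
  with assms(3) show ?thesis by blast
qed

lemma tensor_lift_tensor_map:
  assumes modules: "module R V" "module R W" "module R V'" "module R W'" "module R U"
    and F: "bilinear_map R V W U F" and f: "linear_map R V' V f" and g: "linear_map R W' W g"
    and t: "t \<in> carrier (tensor_module R V' W')"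
  shows "tensor_lift R U F (tensor_map R V W f g t) = tensor_lift R U (\<lambda>v w. F (f v) (g w)) t"
proof -
  have bil: "bilinear_map R V' W' U (\<lambda>v w. F (f v) (g w))"
    using bilinear_map_comp[OF F linear_map_id f g] .
  have "\<forall>t\<in>carrier (tensor_module R V' W').
      tensor_lift R U F (tensor_map R V W f g t) = tensor_lift R U (\<lambda>v w. F (f v) (g w)) t"
    using modules F f g bil linear_map_closed[OF f] linear_map_closed[OF g]
    by (intro tensor_ext[where U = U] linear_map_tensor_lift[of _ V W] tensor_lift_linear
        linear_map_tensor_map[of _ V' W']) (auto simp: tensor_lift_pure)
  with t show ?thesis by blast
qed

lemma tensor_map_tensor_map:
  assumes modules: "module R V" "module R W" "module R V'" "module R W'" "module R V''" "module R W''"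
    and f: "linear_map R V' V f" and g: "linear_map R W' W g"
    and f': "linear_map R V'' V' f'" and g': "linear_map R W'' W' g'"
    and t: "t \<in> carrier (tensor_module R V'' W'')"
  shows "tensor_map R V W f g (tensor_map R V' W' f' g' t) = tensor_map R V W (\<lambda>x. f (f' x)) (\<lambda>x. g (g' x)) t"
  unfolding tensor_map_def[of R V W]
  by (rule tensor_lift_tensor_map[OF modules(3-6) module_tensor[OF modules(1,2)] _ f' g' t])
    (rule bilinear_map_pure_tensor[OF modules(1,2) f g])

section \<open>The associator\<close>

context
  fixes U :: "('a, 'u, 'l) module_scheme" and V :: "('a, 'v, 'm) module_scheme" and W :: "('a, 'w, 'n) module_scheme"
  assumes modules [simp]: "module R U" "module R V" "module R W"
begin

private lemma assoc_bilinear: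
  "w \<in> carrier W \<Longrightarrow> bilinear_map R U V (tensor_module R U (tensor_module R V W))
    (\<lambda>u v. pure_tensor R U (tensor_module R V W) u (pure_tensor R V W v w))"
  by (intro bilinear_mapI linear_map_pure_tensor_left linear_map_pure_tensor_right linear_map_id) auto

private lemma assoc_bilinear':
  "bilinear_map R (tensor_module R U V) W (tensor_module R U (tensor_module R V W))
    (\<lambda>t w. tensor_lift R (tensor_module R U (tensor_module R V W))
      (\<lambda>u v. pure_tensor R U (tensor_module R V W) u (pure_tensor R V W v w)) t)"
  by (intro bilinear_mapI tensor_lift_linear_param[of U V] linear_map_tensor_lift[of _ U V]
      assoc_bilinear linear_map_pure_tensor_right linear_map_id) auto

lemma linear_map_tensor_assoc:
  assumes "linear_map R X (tensor_module R (tensor_module R U V) W) h"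
  shows "linear_map R X (tensor_module R U (tensor_module R V W)) (\<lambda>x. tensor_assoc R U V W (h x))"
  unfolding tensor_assoc_def Let_def
  by (rule linear_map_tensor_lift[OF assms _ _ _ assoc_bilinear']) auto

lemma tensor_assoc_pure [simp]:
  "\<lbrakk>u \<in> carrier U; v \<in> carrier V; w \<in> carrier W\<rbrakk> \<Longrightarrow>
    tensor_assoc R U V W (pure_tensor R (tensor_module R U V) W (pure_tensor R U V u v) w) =
    pure_tensor R U (tensor_module R V W) u (pure_tensor R V W v w)"
  unfolding tensor_assoc_def Let_def
  by (simp add: tensor_lift_pure[OF _ _ _ assoc_bilinear'] tensor_lift_pure[OF _ _ _ assoc_bilinear])

end

section \<open>The middle-four interchange\<close>

context
  fixes U :: "('a, 'u, 'l) module_scheme" and V :: "('a, 'v, 'm) module_scheme"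
    and W :: "('a, 'w, 'n) module_scheme" and X :: "('a, 'x, 'o) module_scheme"
  assumes modules [simp]: "module R U" "module R V" "module R W" "module R X"
begin

private abbreviation (input) "UW \<equiv> tensor_module R U W"

private abbreviation (input) "VX \<equiv> tensor_module R V X"

text \<open>The three nested lifts are shown bilinear from the inside outwards: in \<open>w\<close>
  and \<open>x\<close>, then in \<open>u\<close> and \<open>v\<close> for a fixed tensor
  \<open>t\<close>, then in the two tensors \<open>s\<close> and \<open>t\<close>.\<close>

private lemma middle_four_bilinear:
  "\<lbrakk>u \<in> carrier U; v \<in> carrier V\<rbrakk> \<Longrightarrow> bilinear_map R W X (tensor_module R UW VX)
    (\<lambda>w x. pure_tensor R UW VX (pure_tensor R U W u w) (pure_tensor R V X v x))"
  by (intro bilinear_mapI linear_map_pure_tensor_left linear_map_pure_tensor_right linear_map_id) auto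

private lemma middle_four_bilinear':
  "t \<in> carrier (tensor_module R W X) \<Longrightarrow> bilinear_map R U V (tensor_module R UW VX)
    (\<lambda>u v. tensor_lift R (tensor_module R UW VX)
      (\<lambda>w x. pure_tensor R UW VX (pure_tensor R U W u w) (pure_tensor R V X v x)) t)"
  by (intro bilinear_mapI tensor_lift_linear_param[of W X] middle_four_bilinear
      linear_map_pure_tensor_left linear_map_pure_tensor_right linear_map_id) auto

private lemma middle_four_bilinear'':
  "bilinear_map R (tensor_module R U V) (tensor_module R W X) (tensor_module R UW VX)
    (\<lambda>s t. tensor_lift R (tensor_module R UW VX) (\<lambda>u v. tensor_lift R (tensor_module R UW VX)
      (\<lambda>w x. pure_tensor R UW VX (pure_tensor R U W u w) (pure_tensor R V X v x)) t) s)"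
proof (rule bilinear_mapI)
  show "linear_map R (tensor_module R W X) (tensor_module R UW VX)
      (\<lambda>t. tensor_lift R (tensor_module R UW VX) (\<lambda>u v. tensor_lift R (tensor_module R UW VX)
        (\<lambda>w x. pure_tensor R UW VX (pure_tensor R U W u w) (pure_tensor R V X v x)) t) s)"
    if "s \<in> carrier (tensor_module R U V)" for s
    using that by (intro tensor_lift_linear_param[of U V] middle_four_bilinear'
        linear_map_tensor_lift[of _ W X] linear_map_id middle_four_bilinear) auto
qed (intro linear_map_tensor_lift[of _ U V] linear_map_id middle_four_bilinear'; simp)

lemma linear_map_middle_four:
  assumes "linear_map R Y (tensor_module R (tensor_module R U V) (tensor_module R W X)) h"
  shows "linear_map R Y (tensor_module R UW VX) (\<lambda>y. middle_four R U V W X (h y))"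
  unfolding middle_four_def Let_def
  by (rule linear_map_tensor_lift[OF assms _ _ _ middle_four_bilinear'']) auto

lemma middle_four_pure [simp]:
  "\<lbrakk>u \<in> carrier U; v \<in> carrier V; w \<in> carrier W; x \<in> carrier X\<rbrakk> \<Longrightarrow>
    middle_four R U V W X (pure_tensor R (tensor_module R U V) (tensor_module R W X)
      (pure_tensor R U V u v) (pure_tensor R W X w x)) =
    pure_tensor R UW VX (pure_tensor R U W u w) (pure_tensor R V X v x)"
  unfolding middle_four_def Let_def
  by (simp add: tensor_lift_pure[OF _ _ _ middle_four_bilinear''] tensor_lift_pure[OF _ _ _ middle_four_bilinear']
      tensor_lift_pure[OF _ _ _ middle_four_bilinear])

end

lemma linear_map_tensor_interchange:
  assumes "linear_map R X (tensor_module R (tensor_module R V V) (tensor_module R W W)) h"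
    and "module R V" "module R W"
  shows "linear_map R X (tensor_module R (tensor_module R V W) (tensor_module R V W))
    (\<lambda>x. tensor_interchange R V W (h x))"
  using linear_map_middle_four[OF assms(2,2,3,3,1)] by (simp only: tensor_interchange_middle_four)

lemma tensor_interchange_pure [simp]:
  assumes "module R V" "module R W"
    and "v \<in> carrier V" "v' \<in> carrier V" "w \<in> carrier W" "w' \<in> carrier W"
  shows "tensor_interchange R V W (pure_tensor R (tensor_module R V V) (tensor_module R W W)
      (pure_tensor R V V v v') (pure_tensor R W W w w')) =
    pure_tensor R (tensor_module R V W) (tensor_module R V W) (pure_tensor R V W v w) (pure_tensor R V W v' w')"
  using middle_four_pure[OF assms(1,1,2,2) assms(3-)] by (simp only: tensor_interchange_middle_four)

section \<open>The unitors\<close>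

context
  fixes V :: "('a, 'v, 'm) module_scheme"
  assumes V [simp]: "module R V"
begin

interpretation V: module R V by (rule V)

lemma smult_bilinear:
  "bilinear_map R (self_module R) V V (\<lambda>a v. a \<odot>\<^bsub>V\<^esub> v)"
  "bilinear_map R V (self_module R) V (\<lambda>v a. a \<odot>\<^bsub>V\<^esub> v)"
  by (auto intro!: bilinear_mapI linear_mapI
      simp: V.smult_l_distr V.smult_r_distr V.smult_assoc1 simp flip: V.smult_assoc1)
    (simp add: m_comm V.smult_assoc1)+

lemma linear_map_tensor_unit:
  "linear_map R X (tensor_module R (self_module R) V) h \<Longrightarrow> linear_map R X V (\<lambda>x. tensor_lunit R V (h x))"
  "linear_map R X (tensor_module R V (self_module R)) g \<Longrightarrow> linear_map R X V (\<lambda>x. tensor_runit R V (g x))"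
  unfolding tensor_lunit_def tensor_runit_def
  by (auto intro: linear_map_tensor_lift smult_bilinear module_self)

lemma tensor_unit_pure [simp]:
  "\<lbrakk>a \<in> carrier R; v \<in> carrier V\<rbrakk> \<Longrightarrow> tensor_lunit R V (pure_tensor R (self_module R) V a v) = a \<odot>\<^bsub>V\<^esub> v"
  "\<lbrakk>a \<in> carrier R; v \<in> carrier V\<rbrakk> \<Longrightarrow> tensor_runit R V (pure_tensor R V (self_module R) v a) = a \<odot>\<^bsub>V\<^esub> v"
  unfolding tensor_lunit_def tensor_runit_def
  by (simp_all add: tensor_lift_pure[OF _ _ _ smult_bilinear(1)] tensor_lift_pure[OF _ _ _ smult_bilinear(2)] module_self)

end

lemmas linear_intros = linear_map_id linear_map_tensor_map linear_map_tensor_assoc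
  linear_map_middle_four linear_map_tensor_interchange linear_map_tensor_unit linear_map_pure_tensor_left linear_map_pure_tensor_right

end

section \<open>Independence of the ring components\<close>

text \<open>
  Tensor products see only these four components, so a tensor coalgebra and the underlying tensor
  module, although different records, have equal tensor products.
\<close>

definition same_module ::
  "('k, 'v, 'm) module_scheme \<Rightarrow> ('k, 'v, 'n) module_scheme \<Rightarrow> bool"
  where "same_module V V' \<longleftrightarrow> carrier V = carrier V' \<and> \<zero>\<^bsub>V\<^esub> = \<zero>\<^bsub>V'\<^esub> \<and> add V = add V' \<and> smult V = smult V'"

lemma same_module_sym: "same_module V V' \<Longrightarrow> same_module V' V"
  by (simp add: same_module_def)

lemma same_module_refl: "same_module V V"
  by (simp add: same_module_def)

text \<open>The two records may have different types, so they cannot be equated; the identity on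
  elements carries the axioms across.\<close>

lemma (in cring) same_module_module: "\<lbrakk>module R V; same_module V V'\<rbrakk> \<Longrightarrow> module R V'"
  by (rule module_image[where F = V and h = "\<lambda>x. x"]) (auto simp: same_module_def)

lemma linear_map_same_module:
  "\<lbrakk>same_module V V'; same_module W W'\<rbrakk> \<Longrightarrow> linear_map K V W f \<longleftrightarrow> linear_map K V' W' f"
  by (simp add: linear_map_def same_module_def)

lemma tensor_relators_mono:
  assumes "same_module V V'" "same_module W W'"
  shows "tensor_relators K V W \<subseteq> tensor_relators K V' W'"
proof
  have eq: "carrier V = carrier V'" "add V = add V'" "smult V = smult V'"
    "carrier W = carrier W'" "add W = add W'" "smult W = smult W'"
    using assms by (auto simp: same_module_def)
  show "r \<in> tensor_relators K V' W'" if "r \<in> tensor_relators K V W" for r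
    using that unfolding eq by cases (auto simp: eq intro: tensor_relators.intros)
qed

context
  fixes V :: "('k, 'v, 'm) module_scheme" and V' :: "('k, 'v, 'n) module_scheme"
    and W :: "('k, 'w, 'o) module_scheme" and W' :: "('k, 'w, 'p) module_scheme"
    and K :: "('k, 'r) ring_scheme"
  assumes V: "same_module V V'" and W: "same_module W W'"
begin

lemma tensor_null_same_module: "tensor_null K V W = tensor_null K V' W'"
proof -
  have "tensor_relators K V W = tensor_relators K V' W'"
    using tensor_relators_mono[OF V W] tensor_relators_mono[OF same_module_sym[OF V] same_module_sym[OF W]]
    by blast
  then show ?thesis
    using V W by (simp add: tensor_null_def same_module_def)
qed

lemma tensor_module_same_module: "tensor_module K V W = tensor_module K V' W'"
  using V W by (simp add: tensor_module_def tensor_null_same_module same_module_def)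

lemma pure_tensor_same_module: "pure_tensor K V W = pure_tensor K V' W'"
  using V W by (simp add: pure_tensor_def fun_eq_iff tensor_null_same_module same_module_def)

lemma tensor_map_same_module: "tensor_map K V W = tensor_map K V' W'"
  by (simp add: tensor_map_def fun_eq_iff tensor_module_same_module pure_tensor_same_module)

end

section \<open>Tensor and unit coalgebras viewed as plain modules\<close>

lemma tensor_coalgebra_simps [simp]:
  "carrier (tensor_coalgebra K C D) = carrier (tensor_module K C D)"
  "\<zero>\<^bsub>tensor_coalgebra K C D\<^esub> = \<zero>\<^bsub>tensor_module K C D\<^esub>"
  "add (tensor_coalgebra K C D) = add (tensor_module K C D)"
  "smult (tensor_coalgebra K C D) = smult (tensor_module K C D)"
  "comult (tensor_coalgebra K C D) = (\<lambda>t. tensor_interchange K C D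
    (tensor_map K (tensor_module K C C) (tensor_module K D D) (comult C) (comult D) t))"
  "counit (tensor_coalgebra K C D) = tensor_lift K (self_module K) (\<lambda>c d. counit C c \<otimes>\<^bsub>K\<^esub> counit D d)"
  by (simp_all add: tensor_coalgebra_def fun_eq_iff)

lemma unit_coalgebra_simps [simp]:
  "carrier (unit_coalgebra K) = carrier K"
  "\<zero>\<^bsub>unit_coalgebra K\<^esub> = \<zero>\<^bsub>K\<^esub>"
  "add (unit_coalgebra K) = add K"
  "smult (unit_coalgebra K) = mult K"
  "comult (unit_coalgebra K) = (\<lambda>a. pure_tensor K (self_module K) (self_module K) a \<one>\<^bsub>K\<^esub>)"
  "counit (unit_coalgebra K) = (\<lambda>a. a)"
  by (simp_all add: unit_coalgebra_def)

lemma same_module_coalgebra: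
  "same_module (tensor_coalgebra K C D) (tensor_module K C D)"
  "same_module (unit_coalgebra K) (self_module K)"
  by (simp_all add: same_module_def)

text \<open>A normal form: tensor constructions with a tensor or unit coalgebra as a factor are
  rewritten to those over the underlying \<open>tensor_module\<close> or \<open>self_module\<close>,
  so both occur in one shape only.\<close>

lemmas coalgebra_same_module [simp] =
  tensor_module_same_module[OF same_module_coalgebra(1) same_module_refl]
  tensor_module_same_module[OF same_module_coalgebra(2) same_module_refl]
  tensor_module_same_module[OF same_module_refl same_module_coalgebra(1)]
  tensor_module_same_module[OF same_module_refl same_module_coalgebra(2)]
  pure_tensor_same_module[OF same_module_coalgebra(1) same_module_refl]
  pure_tensor_same_module[OF same_module_coalgebra(2) same_module_refl]
  pure_tensor_same_module[OF same_module_refl same_module_coalgebra(1)]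
  pure_tensor_same_module[OF same_module_refl same_module_coalgebra(2)]
  tensor_map_same_module[OF same_module_coalgebra(1) same_module_refl]
  tensor_map_same_module[OF same_module_coalgebra(2) same_module_refl]
  tensor_map_same_module[OF same_module_refl same_module_coalgebra(1)]
  tensor_map_same_module[OF same_module_refl same_module_coalgebra(2)]
  linear_map_same_module[OF same_module_coalgebra(1) same_module_refl]
  linear_map_same_module[OF same_module_coalgebra(2) same_module_refl]
  linear_map_same_module[OF same_module_refl same_module_coalgebra(1)]
  linear_map_same_module[OF same_module_refl same_module_coalgebra(2)]

text \<open>The target enters only through scaling and finite sums; unfolding the sum shows that it
  depends on carrier, zero and addition alone.\<close>

lemma tensor_lift_same_module:
  assumes "same_module U U'"
  shows "tensor_lift K U f = tensor_lift K U' f"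
  by (rule ext) (use assms in \<open>simp add: tensor_lift_def finsum_def finprod_def same_module_def\<close>)

lemma tensor_assoc_same_module:
  assumes "same_module U U'" "same_module V V'" "same_module W W'"
  shows "tensor_assoc K U V W = tensor_assoc K U' V' W'"
  by (simp add: tensor_assoc_def tensor_module_same_module[OF assms(2,3)] pure_tensor_same_module[OF assms(2,3)]
     tensor_module_same_module[OF assms(1) same_module_refl] pure_tensor_same_module[OF assms(1) same_module_refl])

lemma tensor_assoc_coalgebra [simp]:
  "tensor_assoc K (tensor_coalgebra K C D) V W = tensor_assoc K (tensor_module K C D) V W"
  "tensor_assoc K U (tensor_coalgebra K C D) W = tensor_assoc K U (tensor_module K C D) W"
  "tensor_assoc K U V (tensor_coalgebra K C D) = tensor_assoc K U V (tensor_module K C D)"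
  "tensor_assoc K (unit_coalgebra K) V W = tensor_assoc K (self_module K) V W"
  "tensor_assoc K U (unit_coalgebra K) W = tensor_assoc K U (self_module K) W"
  "tensor_assoc K U V (unit_coalgebra K) = tensor_assoc K U V (self_module K)"
  by (intro tensor_assoc_same_module same_module_coalgebra same_module_refl)+

lemma tensor_unit_coalgebra [simp]:
  "tensor_lunit K (tensor_coalgebra K C D) = tensor_lunit K (tensor_module K C D)"
  "tensor_lunit K (unit_coalgebra K) = tensor_lunit K (self_module K)"
  "tensor_runit K (tensor_coalgebra K C D) = tensor_runit K (tensor_module K C D)"
  "tensor_runit K (unit_coalgebra K) = tensor_runit K (self_module K)"
  unfolding tensor_lunit_def tensor_runit_def
  using tensor_lift_same_module[OF same_module_coalgebra(1)] tensor_lift_same_module[OF same_module_coalgebra(2)]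
  by simp_all

lemma tensor_interchange_coalgebra [simp]:
  "tensor_interchange K (tensor_coalgebra K C D) W = tensor_interchange K (tensor_module K C D) W"
  "tensor_interchange K V (tensor_coalgebra K C D) = tensor_interchange K V (tensor_module K C D)"
  "tensor_interchange K (unit_coalgebra K) W = tensor_interchange K (self_module K) W"
  "tensor_interchange K V (unit_coalgebra K) = tensor_interchange K V (self_module K)"
  by (simp_all add: tensor_interchange_def)

section \<open>Tensor products of coalgebras\<close>

lemma coalgebra_module [simp]: "coalgebra K C \<Longrightarrow> module K C"
  by (simp add: coalgebra_def)

lemmas coalgebra_laws = coalgebra.coassoc coalgebra.counit_left coalgebra.counit_right

context field
begin

declare module_self [simp]

text \<open>With the identity as inner map these rules assert linearity of the structure maps
  themselves, which is a side condition whenever \<open>tensor_map\<close> is evaluated on a pure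
  tensor.\<close>

declare coalgebra.comult_linear [simp] coalgebra.counit_linear [simp]
  linear_map_tensor_map [OF linear_map_id, simp]
  linear_map_tensor_assoc [OF _ _ _ linear_map_id, simp]
  linear_map_tensor_interchange [OF linear_map_id, simp]
  linear_map_tensor_unit [OF _ linear_map_id, simp]

lemma module_coalgebra [simp]:
  "\<lbrakk>module R C; module R D\<rbrakk> \<Longrightarrow> module R (tensor_coalgebra R C D)"
  "module R (unit_coalgebra R)"
  using same_module_module[OF module_tensor same_module_sym[OF same_module_coalgebra(1)]]
    same_module_module[OF module_self same_module_sym[OF same_module_coalgebra(2)]] by simp_all

lemma linear_map_coalgebra:
  assumes "linear_map R X C h" "coalgebra R C"
  shows "linear_map R X (tensor_module R C C) (\<lambda>x. comult C (h x))"
    and "linear_map R X (self_module R) (\<lambda>x. counit C (h x))"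
  using linear_map_comp[OF coalgebra.comult_linear[OF assms(2)] assms(1)]
    linear_map_comp[OF coalgebra.counit_linear[OF assms(2)] assms(1)] .

lemma comult_closed [simp]:
  "\<lbrakk>coalgebra R C; c \<in> carrier C\<rbrakk> \<Longrightarrow> comult C c \<in> carrier (tensor_module R C C)"
  by (rule linear_map_closed[OF coalgebra.comult_linear])

lemma counit_closed [simp]: "\<lbrakk>coalgebra R C; c \<in> carrier C\<rbrakk> \<Longrightarrow> counit C c \<in> carrier R"
  using linear_map_closed[OF coalgebra.counit_linear] by fastforce

lemma mult_bilinear: "bilinear_map R (self_module R) (self_module R) (self_module R) (\<otimes>)"
  by (intro bilinear_mapI linear_mapI) (simp_all add: l_distr r_distr m_ac)

lemma tensor_map_closed:
  assumes "t \<in> carrier (tensor_module R V' W')" "module R V" "module R W" "module R V'" "module R W'"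
    and "linear_map R V' V f" "linear_map R W' W g"
  shows "tensor_map R V W f g t \<in> carrier (tensor_module R V W)"
  by (rule linear_map_closed[OF linear_map_tensor_map[OF linear_map_id] assms(1)]) fact+

lemma tensor_assoc_closed:
  assumes "t \<in> carrier (tensor_module R (tensor_module R U V) W)" "module R U" "module R V" "module R W"
  shows "tensor_assoc R U V W t \<in> carrier (tensor_module R U (tensor_module R V W))"
  by (rule linear_map_closed[OF linear_map_tensor_assoc[OF assms(2-4) linear_map_id] assms(1)])

lemma tensor_interchange_closed:
  assumes "t \<in> carrier (tensor_module R (tensor_module R V V) (tensor_module R W W))" "module R V" "module R W"
  shows "tensor_interchange R V W t \<in>
    carrier (tensor_module R (tensor_module R V W) (tensor_module R V W))"
  by (rule linear_map_closed[OF linear_map_tensor_interchange[OF linear_map_id assms(2,3)] assms(1)])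

lemma tensor_unit_closed:
  assumes "module R V"
  shows "s \<in> carrier (tensor_module R (self_module R) V) \<Longrightarrow> tensor_lunit R V s \<in> carrier V"
    and "t \<in> carrier (tensor_module R V (self_module R)) \<Longrightarrow> tensor_runit R V t \<in> carrier V"
  using linear_map_closed[OF linear_map_tensor_unit(1)[OF assms linear_map_id]]
    linear_map_closed[OF linear_map_tensor_unit(2)[OF assms linear_map_id]] by simp_all

lemmas tensor_closed = pure_tensor_closed tensor_map_closed tensor_assoc_closed
  tensor_interchange_closed tensor_unit_closed

section \<open>The tensor product of two coalgebras is a coalgebra\<close>

context
  fixes C :: "('a, 'c, 'm) coalgebra_scheme" and D :: "('a, 'd, 'n) coalgebra_scheme"
  assumes C [simp]: "coalgebra R C" and D [simp]: "coalgebra R D"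
begin

private lemma counit_bilinear: "bilinear_map R C D (self_module R) (\<lambda>c d. counit C c \<otimes> counit D d)"
  using bilinear_map_comp[OF mult_bilinear linear_map_id coalgebra.counit_linear[OF C] coalgebra.counit_linear[OF D]] .

lemma linear_map_tensor_counit:
  "linear_map R X (tensor_module R C D) h \<Longrightarrow>
    linear_map R X (self_module R) (\<lambda>x. tensor_lift R (self_module R) (\<lambda>c d. counit C c \<otimes> counit D d) (h x))"
  by (rule linear_map_tensor_lift[OF _ _ _ _ counit_bilinear]) auto

lemma tensor_counit_pure [simp]:
  "\<lbrakk>c \<in> carrier C; d \<in> carrier D\<rbrakk> \<Longrightarrow>
    tensor_lift R (self_module R) (\<lambda>c d. counit C c \<otimes> counit D d) (pure_tensor R C D c d) =
    counit C c \<otimes> counit D d"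
  by (rule tensor_lift_pure[OF _ _ _ counit_bilinear]) auto

private lemmas intros = linear_intros linear_map_coalgebra linear_map_tensor_counit tensor_closed

private abbreviation (input) "CC \<equiv> tensor_module R C C"
private abbreviation (input) "DD \<equiv> tensor_module R D D"
private abbreviation (input) "CD \<equiv> tensor_module R C D"

private abbreviation (input) "cmult t \<equiv> tensor_interchange R C D (tensor_map R CC DD (comult C) (comult D) t)"

text \<open>The regrouping of \<open>(C \<otimes> (C \<otimes> C)) \<otimes> (D \<otimes> (D
  \<otimes> D))\<close> into \<open>CD \<otimes> (CD \<otimes> CD)\<close>. Each side of
  coassociativity for the tensor product is this one map applied to the corresponding sides for
  \<open>C\<close> and \<open>D\<close>, so the law follows from coassociativity of the
  factors.\<close>

private abbreviation (input) "shuffle t \<equiv>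
  tensor_map R CD (tensor_module R CD CD) (\<lambda>x. x) (tensor_interchange R C D) (middle_four R C CC D DD t)"

private abbreviation (input) "lcomult s t \<equiv> pure_tensor R (tensor_module R C CC) (tensor_module R D DD)
  (tensor_assoc R C C C (tensor_map R CC C (comult C) (\<lambda>x. x) s))
  (tensor_assoc R D D D (tensor_map R DD D (comult D) (\<lambda>x. x) t))"

text \<open>Evaluating \<open>coassoc_left\<close> on pure tensors brings in new coproducts in the
  left factors, which the associator has to split. They are the tensors \<open>s\<close> and
  \<open>t\<close> here.\<close>

private lemma coassoc_left_pure:
  assumes [simp]: "c \<in> carrier C" "d \<in> carrier D"
  shows "\<forall>s\<in>carrier CC. \<forall>t\<in>carrier DD.
    tensor_assoc R CD CD CD (pure_tensor R (tensor_module R CD CD) CD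
      (tensor_interchange R C D (pure_tensor R CC DD s t)) (pure_tensor R C D c d)) =
    shuffle (pure_tensor R (tensor_module R C CC) (tensor_module R D DD)
      (tensor_assoc R C C C (pure_tensor R CC C s c)) (tensor_assoc R D D D (pure_tensor R DD D t d)))"
proof (rule tensor_ext2)
  fix c' c'' d' d''
  assume [simp]: "c' \<in> carrier C" "c'' \<in> carrier C" "d' \<in> carrier D" "d'' \<in> carrier D"
  show "tensor_assoc R CD CD CD (pure_tensor R (tensor_module R CD CD) CD (tensor_interchange R C D
      (pure_tensor R CC DD (pure_tensor R C C c' c'') (pure_tensor R D D d' d''))) (pure_tensor R C D c d)) =
    shuffle (pure_tensor R (tensor_module R C CC) (tensor_module R D DD)
      (tensor_assoc R C C C (pure_tensor R CC C (pure_tensor R C C c' c'') c))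
      (tensor_assoc R D D D (pure_tensor R DD D (pure_tensor R D D d' d'') d)))"
    by simp
qed (rule intros | simp)+

private lemma cmult_linear [simp]: "linear_map R CD (tensor_module R CD CD) (\<lambda>t. cmult t)"
  by (rule intros | simp)+

private lemma coassoc_left:
  "\<forall>s\<in>carrier CC. \<forall>t\<in>carrier DD.
    tensor_assoc R CD CD CD (tensor_map R (tensor_module R CD CD) CD (\<lambda>t. cmult t) (\<lambda>x. x)
      (tensor_interchange R C D (pure_tensor R CC DD s t))) = shuffle (lcomult s t)"
proof (rule tensor_ext2)
  fix c c' d d'
  assume [simp]: "c \<in> carrier C" "c' \<in> carrier C" "d \<in> carrier D" "d' \<in> carrier D"
  show "tensor_assoc R CD CD CD (tensor_map R (tensor_module R CD CD) CD (\<lambda>t. cmult t) (\<lambda>x. x)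
      (tensor_interchange R C D (pure_tensor R CC DD (pure_tensor R C C c c') (pure_tensor R D D d d')))) =
      shuffle (lcomult (pure_tensor R C C c c') (pure_tensor R D D d d'))"
    using coassoc_left_pure[of c' d'] by simp
qed (rule intros | simp)+

text \<open>The second coproducts pass through \<open>middle_four\<close> as undivided factors and
  are split only by the same final interchange on both sides, so one evaluation on pure tensors is
  enough.\<close>

private lemma coassoc_right:
  "\<forall>s\<in>carrier CC. \<forall>t\<in>carrier DD.
    tensor_map R CD (tensor_module R CD CD) (\<lambda>x. x) (\<lambda>t. cmult t)
      (tensor_interchange R C D (pure_tensor R CC DD s t)) =
    shuffle (pure_tensor R (tensor_module R C CC) (tensor_module R D DD)
      (tensor_map R C CC (\<lambda>x. x) (comult C) s) (tensor_map R D DD (\<lambda>x. x) (comult D) t))"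
proof (rule tensor_ext2)
  fix c c' d d'
  assume [simp]: "c \<in> carrier C" "c' \<in> carrier C" "d \<in> carrier D" "d' \<in> carrier D"
  show "tensor_map R CD (tensor_module R CD CD) (\<lambda>x. x) (\<lambda>t. cmult t)
      (tensor_interchange R C D (pure_tensor R CC DD (pure_tensor R C C c c') (pure_tensor R D D d d'))) =
    shuffle (pure_tensor R (tensor_module R C CC) (tensor_module R D DD)
      (tensor_map R C CC (\<lambda>x. x) (comult C) (pure_tensor R C C c c'))
      (tensor_map R D DD (\<lambda>x. x) (comult D) (pure_tensor R D D d d')))"
    by simp
qed (rule intros | simp)+

private abbreviation (input) "ccounit t \<equiv> tensor_lift R (self_module R) (\<lambda>c d. counit C c \<otimes> counit D d) t"

private lemma ccounit_linear [simp]: "linear_map R CD (self_module R) (\<lambda>t. ccounit t)"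
  by (rule intros | simp)+

private lemma tensor_counit_left:
  "\<forall>s\<in>carrier CC. \<forall>t\<in>carrier DD.
    tensor_lunit R CD (tensor_map R (self_module R) CD (\<lambda>t. ccounit t) (\<lambda>x. x)
      (tensor_interchange R C D (pure_tensor R CC DD s t))) =
    pure_tensor R C D (tensor_lunit R C (tensor_map R (self_module R) C (counit C) (\<lambda>x. x) s))
      (tensor_lunit R D (tensor_map R (self_module R) D (counit D) (\<lambda>x. x) t))"
proof (rule tensor_ext2)
  fix c c' d d'
  assume [simp]: "c \<in> carrier C" "c' \<in> carrier C" "d \<in> carrier D" "d' \<in> carrier D"
  show "tensor_lunit R CD (tensor_map R (self_module R) CD (\<lambda>t. ccounit t) (\<lambda>x. x)
      (tensor_interchange R C D (pure_tensor R CC DD (pure_tensor R C C c c') (pure_tensor R D D d d')))) =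
    pure_tensor R C D (tensor_lunit R C (tensor_map R (self_module R) C (counit C) (\<lambda>x. x) (pure_tensor R C C c c')))
      (tensor_lunit R D (tensor_map R (self_module R) D (counit D) (\<lambda>x. x) (pure_tensor R D D d d')))"
    \<comment> \<open>Both sides are \<open>counit C c \<otimes> counit D d\<close> times the pure
      tensor of \<open>c'\<close> and \<open>d'\<close>; on the right the two scalars are first
      pulled out of the factors.\<close>
    by (simp add: pure_tensor_smult module_closed m_comm flip: module.smult_assoc1[OF module_tensor])
qed (rule intros | simp)+

private lemma tensor_counit_right:
  "\<forall>s\<in>carrier CC. \<forall>t\<in>carrier DD.
    tensor_runit R CD (tensor_map R CD (self_module R) (\<lambda>x. x) (\<lambda>t. ccounit t)
      (tensor_interchange R C D (pure_tensor R CC DD s t))) =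
    pure_tensor R C D (tensor_runit R C (tensor_map R C (self_module R) (\<lambda>x. x) (counit C) s))
      (tensor_runit R D (tensor_map R D (self_module R) (\<lambda>x. x) (counit D) t))"
proof (rule tensor_ext2)
  fix c c' d d'
  assume [simp]: "c \<in> carrier C" "c' \<in> carrier C" "d \<in> carrier D" "d' \<in> carrier D"
  show "tensor_runit R CD (tensor_map R CD (self_module R) (\<lambda>x. x) (\<lambda>t. ccounit t)
      (tensor_interchange R C D (pure_tensor R CC DD (pure_tensor R C C c c') (pure_tensor R D D d d')))) =
    pure_tensor R C D (tensor_runit R C (tensor_map R C (self_module R) (\<lambda>x. x) (counit C) (pure_tensor R C C c c')))
      (tensor_runit R D (tensor_map R D (self_module R) (\<lambda>x. x) (counit D) (pure_tensor R D D d d')))"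
    by (simp add: pure_tensor_smult module_closed m_comm flip: module.smult_assoc1[OF module_tensor])
qed (rule intros | simp)+

lemma coalgebra_tensor [simp]: "coalgebra R (tensor_coalgebra R C D)"
proof (intro coalgebra.intro coalgebra_axioms.intro)
  \<comment> \<open>The laws are proved over the underlying tensor module, where the linearity rules
    apply, and then read back for the coalgebra record. On a pure tensor \<open>cmult\<close>
    produces \<open>comult C c\<close> and \<open>comult D d\<close>, which become the tensors
    \<open>s\<close> and \<open>t\<close> of the preceding lemmas.\<close>
  have "\<forall>t\<in>carrier CD. tensor_assoc R CD CD CD (tensor_map R (tensor_module R CD CD) CD (\<lambda>t. cmult t) (\<lambda>x. x) (cmult t)) =
      tensor_map R CD (tensor_module R CD CD) (\<lambda>x. x) (\<lambda>t. cmult t) (cmult t)"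
  proof (rule tensor_ext)
    fix c d assume [simp]: "c \<in> carrier C" "d \<in> carrier D"
    show "tensor_assoc R CD CD CD (tensor_map R (tensor_module R CD CD) CD (\<lambda>t. cmult t) (\<lambda>x. x) (cmult (pure_tensor R C D c d))) =
      tensor_map R CD (tensor_module R CD CD) (\<lambda>x. x) (\<lambda>t. cmult t) (cmult (pure_tensor R C D c d))"
      by (simp add: coassoc_left coassoc_right coalgebra_laws)
  qed (rule intros | simp)+
  then show "tensor_assoc R (tensor_coalgebra R C D) (tensor_coalgebra R C D) (tensor_coalgebra R C D)
      (tensor_map R (tensor_module R (tensor_coalgebra R C D) (tensor_coalgebra R C D)) (tensor_coalgebra R C D)
        (comult (tensor_coalgebra R C D)) (\<lambda>x. x) (comult (tensor_coalgebra R C D) t)) =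
    tensor_map R (tensor_coalgebra R C D) (tensor_module R (tensor_coalgebra R C D) (tensor_coalgebra R C D))
      (\<lambda>x. x) (comult (tensor_coalgebra R C D)) (comult (tensor_coalgebra R C D) t)"
    if "t \<in> carrier (tensor_coalgebra R C D)" for t
    using that by simp
  have "\<forall>t\<in>carrier CD. tensor_lunit R CD (tensor_map R (self_module R) CD (\<lambda>t. ccounit t) (\<lambda>x. x) (cmult t)) = t"
  proof (rule tensor_ext)
    fix c d assume [simp]: "c \<in> carrier C" "d \<in> carrier D"
    show "tensor_lunit R CD (tensor_map R (self_module R) CD (\<lambda>t. ccounit t) (\<lambda>x. x) (cmult (pure_tensor R C D c d))) =
        pure_tensor R C D c d"
      by (simp add: tensor_counit_left coalgebra_laws)
  qed (rule intros | simp)+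
  then show "tensor_lunit R (tensor_coalgebra R C D) (tensor_map R (self_module R) (tensor_coalgebra R C D)
      (counit (tensor_coalgebra R C D)) (\<lambda>x. x) (comult (tensor_coalgebra R C D) t)) = t"
    if "t \<in> carrier (tensor_coalgebra R C D)" for t
    using that by simp
  have "\<forall>t\<in>carrier CD. tensor_runit R CD (tensor_map R CD (self_module R) (\<lambda>x. x) (\<lambda>t. ccounit t) (cmult t)) = t"
  proof (rule tensor_ext)
    fix c d assume [simp]: "c \<in> carrier C" "d \<in> carrier D"
    show "tensor_runit R CD (tensor_map R CD (self_module R) (\<lambda>x. x) (\<lambda>t. ccounit t) (cmult (pure_tensor R C D c d))) =
        pure_tensor R C D c d"
      by (simp add: tensor_counit_right coalgebra_laws)
  qed (rule intros | simp)+
  then show "tensor_runit R (tensor_coalgebra R C D) (tensor_map R (tensor_coalgebra R C D) (self_module R)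
      (\<lambda>x. x) (counit (tensor_coalgebra R C D)) (comult (tensor_coalgebra R C D) t)) = t"
    if "t \<in> carrier (tensor_coalgebra R C D)" for t
    using that by simp
  show "linear_map R (tensor_coalgebra R C D) (tensor_module R (tensor_coalgebra R C D) (tensor_coalgebra R C D))
      (comult (tensor_coalgebra R C D))"
    using cmult_linear by simp
  show "linear_map R (tensor_coalgebra R C D) (self_module R) (counit (tensor_coalgebra R C D))"
    using ccounit_linear by simp
qed (simp_all add: field_axioms)

end

lemmas coalgebra_intros = linear_intros linear_map_coalgebra linear_map_tensor_counit tensor_closed

lemma coalgebra_unit [simp]: "coalgebra R (unit_coalgebra R)"
proof (intro coalgebra.intro coalgebra_axioms.intro)
  have *: "linear_map R (self_module R) (tensor_module R (self_module R) (self_module R))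
      (\<lambda>a. pure_tensor R (self_module R) (self_module R) a \<one>)"
    by (rule linear_intros | simp)+
  then show "linear_map R (unit_coalgebra R) (tensor_module R (unit_coalgebra R) (unit_coalgebra R)) (comult (unit_coalgebra R))"
    by simp
  fix c assume "c \<in> carrier (unit_coalgebra R)"
  then have [simp]: "c \<in> carrier R" by simp
  show "tensor_assoc R (unit_coalgebra R) (unit_coalgebra R) (unit_coalgebra R)
      (tensor_map R (tensor_module R (unit_coalgebra R) (unit_coalgebra R)) (unit_coalgebra R)
        (comult (unit_coalgebra R)) (\<lambda>x. x) (comult (unit_coalgebra R) c)) =
    tensor_map R (unit_coalgebra R) (tensor_module R (unit_coalgebra R) (unit_coalgebra R))
      (\<lambda>x. x) (comult (unit_coalgebra R)) (comult (unit_coalgebra R) c)"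
    by (simp add: *)
qed (simp_all add: field_axioms)

end

section \<open>Coalgebra maps\<close>

lemma coalgebra_mapD:
  assumes "coalgebra_map K C D f"
  shows "linear_map K C D f"
    and "c \<in> carrier C \<Longrightarrow> comult D (f c) = tensor_map K D D f f (comult C c)"
    and "c \<in> carrier C \<Longrightarrow> counit D (f c) = counit C c"
  using assms by (simp_all add: coalgebra_map_def)

context field
begin

lemma coalgebra_map_id:
  assumes "coalgebra R C"
  shows "coalgebra_map R C C (\<lambda>x. x)"
  using assms by (simp add: coalgebra_map_def tensor_map_id)

lemma coalgebra_map_comp:
  assumes [simp]: "coalgebra R C" "coalgebra R D" "coalgebra R E"
    and g: "coalgebra_map R D E g" and f: "coalgebra_map R C D f"
  shows "coalgebra_map R C E (\<lambda>x. g (f x))"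
  using linear_map_comp[OF coalgebra_mapD(1)[OF g] coalgebra_mapD(1)[OF f]]
    coalgebra_mapD[OF g] coalgebra_mapD[OF f] linear_map_closed[OF coalgebra_mapD(1)[OF f]]
  by (simp add: coalgebra_map_def tensor_map_tensor_map[of E E D D C C])

lemma coalgebra_map_cong:
  assumes [simp]: "coalgebra R C" "coalgebra R D"
    and f: "coalgebra_map R C D f" and eq: "\<And>x. x \<in> carrier C \<Longrightarrow> g x = f x"
  shows "coalgebra_map R C D g"
proof -
  have "tensor_map R D D g g (comult C c) = tensor_map R D D f f (comult C c)" if "c \<in> carrier C" for c
    using that coalgebra_mapD(1)[OF f] by (intro tensor_map_cong[of D D C C] eq) simp_all
  moreover have "linear_map R C D g"
    by (rule linear_map_cong[OF coalgebra_mapD(1)[OF f] _ eq]) simp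
  ultimately show ?thesis
    unfolding coalgebra_map_def using coalgebra_mapD(2,3)[OF f] by (metis eq)
qed

section \<open>Tensor products of coalgebra maps, associator and unitors are coalgebra maps\<close>

lemma coalgebra_map_tensor_map:
  assumes [simp]: "coalgebra R C" "coalgebra R D" "coalgebra R C'" "coalgebra R D'"
    and f: "coalgebra_map R C C' f" and g: "coalgebra_map R D D' g"
  shows "coalgebra_map R (tensor_coalgebra R C D) (tensor_coalgebra R C' D') (tensor_map R C' D' f g)"
proof -
  note [simp] = coalgebra_mapD[OF f] coalgebra_mapD[OF g]
    linear_map_closed[OF coalgebra_mapD(1)[OF f]] linear_map_closed[OF coalgebra_mapD(1)[OF g]]
  let ?CD = "tensor_module R C D" and ?CD' = "tensor_module R C' D'"
  \<comment> \<open>Naturality of the interchange, with the coproducts of \<open>C\<close> and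
    \<open>D\<close> replaced by arbitrary tensors.\<close>
  have *: "\<forall>s\<in>carrier (tensor_module R C C). \<forall>t\<in>carrier (tensor_module R D D).
      tensor_interchange R C' D' (pure_tensor R (tensor_module R C' C') (tensor_module R D' D')
        (tensor_map R C' C' f f s) (tensor_map R D' D' g g t)) =
      tensor_map R ?CD' ?CD' (tensor_map R C' D' f g) (tensor_map R C' D' f g)
        (tensor_interchange R C D (pure_tensor R (tensor_module R C C) (tensor_module R D D) s t))"
    by (rule tensor_ext2) (rule coalgebra_intros coalgebra_mapD(1)[OF f] coalgebra_mapD(1)[OF g] | simp)+
  have "\<forall>t\<in>carrier ?CD. comult (tensor_coalgebra R C' D') (tensor_map R C' D' f g t) =
      tensor_map R ?CD' ?CD' (tensor_map R C' D' f g) (tensor_map R C' D' f g) (comult (tensor_coalgebra R C D) t)"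
    unfolding tensor_coalgebra_simps
    by (rule tensor_ext) (rule coalgebra_intros coalgebra_mapD(1)[OF f] coalgebra_mapD(1)[OF g] | simp add: *)+
  moreover have "\<forall>t\<in>carrier ?CD. counit (tensor_coalgebra R C' D') (tensor_map R C' D' f g t) =
      counit (tensor_coalgebra R C D) t"
    unfolding tensor_coalgebra_simps
    by (rule tensor_ext) (rule coalgebra_intros coalgebra_mapD(1)[OF f] coalgebra_mapD(1)[OF g] | simp)+
  ultimately show ?thesis
    by (simp add: coalgebra_map_def)
qed

lemma coalgebra_map_tensor_assoc:
  assumes [simp]: "coalgebra R C" "coalgebra R D" "coalgebra R E"
  shows "coalgebra_map R (tensor_coalgebra R (tensor_coalgebra R C D) E)
    (tensor_coalgebra R C (tensor_coalgebra R D E)) (tensor_assoc R C D E)"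
proof -
  let ?CD = "tensor_module R C D" and ?DE = "tensor_module R D E"
  let ?T = "tensor_module R C ?DE"
  \<comment> \<open>Compatibility of the interchange with the associator; \<open>r\<close>,
    \<open>s\<close> and \<open>t\<close> stand for the coproducts in \<open>C\<close>,
    \<open>D\<close> and \<open>E\<close>.\<close>
  have *: "\<forall>r\<in>carrier (tensor_module R C C). \<forall>s\<in>carrier (tensor_module R D D). \<forall>t\<in>carrier (tensor_module R E E).
    tensor_interchange R C ?DE (pure_tensor R (tensor_module R C C) (tensor_module R ?DE ?DE) r
      (tensor_interchange R D E (pure_tensor R (tensor_module R D D) (tensor_module R E E) s t))) =
    tensor_map R ?T ?T (tensor_assoc R C D E) (tensor_assoc R C D E) (tensor_interchange R ?CD E
      (pure_tensor R (tensor_module R ?CD ?CD) (tensor_module R E E)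
        (tensor_interchange R C D (pure_tensor R (tensor_module R C C) (tensor_module R D D) r s)) t))"
    by (rule tensor_ext3) (rule coalgebra_intros | simp)+
  have cm [simp]: "linear_map R ?CD (tensor_module R ?CD ?CD) (\<lambda>t. tensor_interchange R C D
      (tensor_map R (tensor_module R C C) (tensor_module R D D) (comult C) (comult D) t))"
    "linear_map R ?DE (tensor_module R ?DE ?DE) (\<lambda>t. tensor_interchange R D E
      (tensor_map R (tensor_module R D D) (tensor_module R E E) (comult D) (comult E) t))"
    by (rule coalgebra_intros | simp)+
  have "\<forall>t\<in>carrier (tensor_module R ?CD E).
      comult (tensor_coalgebra R C (tensor_coalgebra R D E)) (tensor_assoc R C D E t) =
      tensor_map R ?T ?T (tensor_assoc R C D E) (tensor_assoc R C D E)
        (comult (tensor_coalgebra R (tensor_coalgebra R C D) E) t)"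
    unfolding tensor_coalgebra_simps coalgebra_same_module tensor_interchange_coalgebra
    by (rule tensor_ext_left) (rule coalgebra_intros | simp add: *)+
  moreover have "\<forall>t\<in>carrier (tensor_module R ?CD E).
      counit (tensor_coalgebra R C (tensor_coalgebra R D E)) (tensor_assoc R C D E t) =
      counit (tensor_coalgebra R (tensor_coalgebra R C D) E) t"
  proof (rule tensor_ext_left[where X = "self_module R"])
    fix c d e assume [simp]: "c \<in> carrier C" "d \<in> carrier D" "e \<in> carrier E"
    show "counit (tensor_coalgebra R C (tensor_coalgebra R D E))
        (tensor_assoc R C D E (pure_tensor R ?CD E (pure_tensor R C D c d) e)) =
      counit (tensor_coalgebra R (tensor_coalgebra R C D) E) (pure_tensor R ?CD E (pure_tensor R C D c d) e)"
      \<comment> \<open>Both counits are the product of the same three scalars, bracketed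
        differently.\<close>
      using tensor_counit_pure[of C "tensor_coalgebra R D E" c "pure_tensor R D E d e"]
        tensor_counit_pure[of "tensor_coalgebra R C D" E "pure_tensor R C D c d" e]
      by (simp add: m_assoc)
  next
    show "linear_map R (tensor_module R ?CD E) (self_module R)
        (\<lambda>t. counit (tensor_coalgebra R C (tensor_coalgebra R D E)) (tensor_assoc R C D E t))"
    proof -
      have "linear_map R ?T (self_module R) (counit (tensor_coalgebra R C (tensor_coalgebra R D E)))"
        using coalgebra.counit_linear[of R "tensor_coalgebra R C (tensor_coalgebra R D E)"] by simp
      from linear_map_comp[OF this linear_map_tensor_assoc[OF _ _ _ linear_map_id]] show ?thesis
        by (simp only: assms coalgebra_module)
    qed
    show "linear_map R (tensor_module R ?CD E) (self_module R)
        (counit (tensor_coalgebra R (tensor_coalgebra R C D) E))"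
      using coalgebra.counit_linear[of R "tensor_coalgebra R (tensor_coalgebra R C D) E"] by simp
  qed simp_all
  ultimately show ?thesis
    by (simp add: coalgebra_map_def)
qed

lemma linear_map_scale:
  assumes "linear_map R X V h" "module R V" "a \<in> carrier R"
  shows "linear_map R X V (\<lambda>x. a \<odot>\<^bsub>V\<^esub> h x)"
proof -
  interpret V: module R V by fact
  have "linear_map R V V (\<lambda>v. a \<odot>\<^bsub>V\<^esub> v)"
    using assms(3) by (intro linear_mapI) (simp_all add: V.smult_r_distr m_comm flip: V.smult_assoc1)
  from linear_map_comp[OF this assms(1)] show ?thesis .
qed

lemma coalgebra_map_tensor_lunit:
  assumes [simp]: "coalgebra R C"
  shows "coalgebra_map R (tensor_coalgebra R (unit_coalgebra R) C) C (tensor_lunit R C)"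
proof -
  interpret C: coalgebra R C by fact
  let ?K = "self_module R"
  let ?KC = "tensor_module R ?K C"
  \<comment> \<open>The coproduct of the scalar \<open>a\<close> is the pure tensor of
    \<open>a\<close> and \<open>\<one>\<close>, so after the interchange \<open>a\<close> scales the
    first leg of \<open>s\<close> and \<open>\<one>\<close> the second; this is \<open>a\<close>
    times \<open>s\<close>.\<close>
  have *: "\<forall>s\<in>carrier (tensor_module R C C).
      a \<odot>\<^bsub>tensor_module R C C\<^esub> s = tensor_map R C C (tensor_lunit R C) (tensor_lunit R C)
        (tensor_interchange R ?K C (pure_tensor R (tensor_module R ?K ?K) (tensor_module R C C)
          (pure_tensor R ?K ?K a \<one>) s))" if [simp]: "a \<in> carrier R" for a
    by (rule tensor_ext) (rule coalgebra_intros linear_map_scale | simp add: module.smult_assoc1 pure_tensor_smult)+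
  have [simp]: "linear_map R ?K (tensor_module R ?K ?K) (\<lambda>a. pure_tensor R ?K ?K a \<one>)"
    by (rule coalgebra_intros | simp)+
  have "\<forall>t\<in>carrier ?KC. comult C (tensor_lunit R C t) = tensor_map R C C (tensor_lunit R C) (tensor_lunit R C)
      (comult (tensor_coalgebra R (unit_coalgebra R) C) t)"
    unfolding tensor_coalgebra_simps coalgebra_same_module tensor_interchange_coalgebra unit_coalgebra_simps
    by (rule tensor_ext) (rule coalgebra_intros | simp add: * linear_map_smult[OF C.comult_linear])+
  moreover have "\<forall>t\<in>carrier ?KC. counit C (tensor_lunit R C t) = counit (tensor_coalgebra R (unit_coalgebra R) C) t"
  proof (rule tensor_ext)
    fix a c assume "a \<in> carrier ?K" and [simp]: "c \<in> carrier C"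
    then have [simp]: "a \<in> carrier R" by simp
    show "counit C (tensor_lunit R C (pure_tensor R ?K C a c)) =
        counit (tensor_coalgebra R (unit_coalgebra R) C) (pure_tensor R ?K C a c)"
      using tensor_counit_pure[of "unit_coalgebra R" C a c] linear_map_smult[OF C.counit_linear, of a c] by simp
  next
    show "linear_map R ?KC ?K (\<lambda>t. counit C (tensor_lunit R C t))"
      by (rule coalgebra_intros | simp)+
    show "linear_map R ?KC ?K (counit (tensor_coalgebra R (unit_coalgebra R) C))"
      using coalgebra.counit_linear[of R "tensor_coalgebra R (unit_coalgebra R) C"] by simp
  qed simp_all
  ultimately show ?thesis
    by (simp add: coalgebra_map_def)
qed

lemma coalgebra_map_tensor_runit:
  assumes [simp]: "coalgebra R C"
  shows "coalgebra_map R (tensor_coalgebra R C (unit_coalgebra R)) C (tensor_runit R C)"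
proof -
  interpret C: coalgebra R C by fact
  let ?K = "self_module R"
  let ?CK = "tensor_module R C ?K"
  have *: "\<forall>s\<in>carrier (tensor_module R C C).
      a \<odot>\<^bsub>tensor_module R C C\<^esub> s = tensor_map R C C (tensor_runit R C) (tensor_runit R C)
        (tensor_interchange R C ?K (pure_tensor R (tensor_module R C C) (tensor_module R ?K ?K)
          s (pure_tensor R ?K ?K a \<one>)))" if [simp]: "a \<in> carrier R" for a
    by (rule tensor_ext) (rule coalgebra_intros linear_map_scale | simp add: module.smult_assoc1 pure_tensor_smult)+
  have [simp]: "linear_map R ?K (tensor_module R ?K ?K) (\<lambda>a. pure_tensor R ?K ?K a \<one>)"
    by (rule coalgebra_intros | simp)+
  have "\<forall>t\<in>carrier ?CK. comult C (tensor_runit R C t) = tensor_map R C C (tensor_runit R C) (tensor_runit R C)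
      (comult (tensor_coalgebra R C (unit_coalgebra R)) t)"
    unfolding tensor_coalgebra_simps coalgebra_same_module tensor_interchange_coalgebra unit_coalgebra_simps
    by (rule tensor_ext) (rule coalgebra_intros | simp add: * linear_map_smult[OF C.comult_linear])+
  moreover have "\<forall>t\<in>carrier ?CK. counit C (tensor_runit R C t) = counit (tensor_coalgebra R C (unit_coalgebra R)) t"
  proof (rule tensor_ext)
    fix c a assume "a \<in> carrier ?K" and [simp]: "c \<in> carrier C"
    then have [simp]: "a \<in> carrier R" by simp
    show "counit C (tensor_runit R C (pure_tensor R C ?K c a)) =
        counit (tensor_coalgebra R C (unit_coalgebra R)) (pure_tensor R C ?K c a)"
      using tensor_counit_pure[of C "unit_coalgebra R" c a] linear_map_smult[OF C.counit_linear, of a c]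
      by (simp add: m_comm)
  next
    show "linear_map R ?CK ?K (\<lambda>t. counit C (tensor_runit R C t))"
      by (rule coalgebra_intros | simp)+
    show "linear_map R ?CK ?K (counit (tensor_coalgebra R C (unit_coalgebra R)))"
      using coalgebra.counit_linear[of R "tensor_coalgebra R C (unit_coalgebra R)"] by simp
  qed simp_all
  ultimately show ?thesis
    by (simp add: coalgebra_map_def)
qed

section \<open>Transport of coalgebra structure along surjections and injections\<close>

lemma coalgebra_image:
  assumes H [simp]: "coalgebra R H" and H' [simp]: "module R H'" and f: "linear_map R H H' f"
    and surj: "f ` carrier H = carrier H'"
    and comult: "\<And>h. h \<in> carrier H \<Longrightarrow> comult H' (f h) = tensor_map R H' H' f f (comult H h)"
    and counit: "\<And>h. h \<in> carrier H \<Longrightarrow> counit H' (f h) = counit H h"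
  shows "coalgebra R H'"
proof (intro coalgebra.intro coalgebra_axioms.intro)
  note [simp] = f comult counit linear_map_closed[OF f]
  interpret H: coalgebra R H by fact
  have preimage: "\<exists>h\<in>carrier H. x = f h" if "x \<in> carrier H'" for x
    using that unfolding surj[symmetric] by auto
  \<comment> \<open>Since \<open>f\<close> is a linear surjection, linearity of a map out of
    \<open>H'\<close> may be tested after composing with \<open>f\<close>. The structure maps of
    \<open>H'\<close> are known only on values of \<open>f\<close>.\<close>
  have lin: "linear_map R H' U g" if g: "linear_map R H U (\<lambda>h. g (f h))" for U :: "('a, 'u, 'l) module_scheme" and g
  proof (rule linear_mapI)
    fix x assume "x \<in> carrier H'"
    then obtain u where u: "u \<in> carrier H" "x = f u" using preimage by blast
    then show "g x \<in> carrier U"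
      using linear_map_closed[OF g u(1)] by simp
    show "g (a \<odot>\<^bsub>H'\<^esub> x) = a \<odot>\<^bsub>U\<^esub> g x" if "a \<in> carrier R" for a
      using u linear_map_smult[OF g that u(1)] linear_map_smult[OF f that u(1)] by simp
    fix y assume "y \<in> carrier H'"
    then obtain v where v: "v \<in> carrier H" "y = f v" using preimage by blast
    then show "g (x \<oplus>\<^bsub>H'\<^esub> y) = g x \<oplus>\<^bsub>U\<^esub> g y"
      using u linear_map_add[OF g u(1) v(1)] linear_map_add[OF f u(1) v(1)] by simp
  qed
  show cl [simp]: "linear_map R H' (tensor_module R H' H') (comult H')"
    by (rule lin, rule linear_map_cong[of _ _ _ "\<lambda>h. tensor_map R H' H' f f (comult H h)"])
      (rule coalgebra_intros | simp)+
  show ul [simp]: "linear_map R H' (self_module R) (counit H')"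
    by (rule lin, rule linear_map_cong[of _ _ _ "counit H"]) (rule coalgebra_intros | simp)+
  fix x assume "x \<in> carrier H'"
  then obtain h where x: "x = f h" and h [simp]: "h \<in> carrier H" using preimage by blast
  \<comment> \<open>As for tensor coalgebras, a coproduct in the left factor must be split by the
    associator; \<open>s\<close> is its generalisation.\<close>
  have *: "\<forall>s\<in>carrier (tensor_module R H H).
      tensor_assoc R H' H' H' (pure_tensor R (tensor_module R H' H') H' (tensor_map R H' H' f f s) (f c)) =
      tensor_map R H' (tensor_module R H' H') f (tensor_map R H' H' f f)
        (tensor_assoc R H H H (pure_tensor R (tensor_module R H H) H s c))" if [simp]: "c \<in> carrier H" for c
    by (rule tensor_ext) (rule coalgebra_intros | simp)+
  have left: "\<forall>s\<in>carrier (tensor_module R H H).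
      tensor_assoc R H' H' H' (tensor_map R (tensor_module R H' H') H' (comult H') (\<lambda>x. x) (tensor_map R H' H' f f s)) =
      tensor_map R H' (tensor_module R H' H') f (tensor_map R H' H' f f)
        (tensor_assoc R H H H (tensor_map R (tensor_module R H H) H (comult H) (\<lambda>x. x) s))"
    by (rule tensor_ext) (rule cl ul coalgebra_intros | simp add: *)+
  have right: "\<forall>s\<in>carrier (tensor_module R H H).
      tensor_map R H' (tensor_module R H' H') (\<lambda>x. x) (comult H') (tensor_map R H' H' f f s) =
      tensor_map R H' (tensor_module R H' H') f (tensor_map R H' H' f f)
        (tensor_map R H (tensor_module R H H) (\<lambda>x. x) (comult H) s)"
    by (rule tensor_ext) (rule cl ul coalgebra_intros | simp)+
  show "tensor_assoc R H' H' H' (tensor_map R (tensor_module R H' H') H' (comult H') (\<lambda>x. x) (comult H' x)) =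
      tensor_map R H' (tensor_module R H' H') (\<lambda>x. x) (comult H') (comult H' x)"
    by (simp add: x left right coalgebra_laws)
  have "\<forall>s\<in>carrier (tensor_module R H H).
      tensor_lunit R H' (tensor_map R (self_module R) H' (counit H') (\<lambda>x. x) (tensor_map R H' H' f f s)) =
      f (tensor_lunit R H (tensor_map R (self_module R) H (counit H) (\<lambda>x. x) s))"
    by (rule tensor_ext)
      (rule cl ul coalgebra_intros linear_map_comp[OF f] | simp add: linear_map_smult[OF f])+
  then show "tensor_lunit R H' (tensor_map R (self_module R) H' (counit H') (\<lambda>x. x) (comult H' x)) = x"
    by (simp add: x coalgebra_laws)
  have "\<forall>s\<in>carrier (tensor_module R H H).
      tensor_runit R H' (tensor_map R H' (self_module R) (\<lambda>x. x) (counit H') (tensor_map R H' H' f f s)) =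
      f (tensor_runit R H (tensor_map R H (self_module R) (\<lambda>x. x) (counit H) s))"
    by (rule tensor_ext)
      (rule cl ul coalgebra_intros linear_map_comp[OF f] | simp add: linear_map_smult[OF f])+
  then show "tensor_runit R H' (tensor_map R H' (self_module R) (\<lambda>x. x) (counit H') (comult H' x)) = x"
    by (simp add: x coalgebra_laws)
qed (simp_all add: field_axioms)

text \<open>Copies a coalgebra to another type, which lets a universal property for test coalgebras
  on one type act on coalgebras whose type embeds into it.\<close>

lemma coalgebra_transport:
  fixes H :: "('a, 'x) coalgebra" and \<iota> :: "'x \<Rightarrow> 'y"
  assumes H [simp]: "coalgebra R H" and \<iota>: "inj \<iota>"
  obtains H' :: "('a, 'y) coalgebra" and j where "coalgebra R H'"
    "coalgebra_map R H H' \<iota>" "coalgebra_map R H' H j" "\<And>h. j (\<iota> h) = h" "\<iota> ` carrier H = carrier H'"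
proof -
  interpret H: coalgebra R H by fact
  define \<kappa> where "\<kappa> = inv_into UNIV \<iota>"
  have inv [simp]: "\<kappa> (\<iota> h) = h" for h using \<iota> by (simp add: \<kappa>_def)
  \<comment> \<open>The coproduct of the copy is a tensor over the copy itself. To avoid circularity
    the module \<open>M\<close> comes first and is then extended; tensors over \<open>M\<close> and
    over \<open>H'\<close> agree because they share the module components.\<close>
  define M :: "('a, 'y) module" where "M = \<lparr>carrier = \<iota> ` carrier H, mult = undefined, one = undefined,
    zero = \<iota> \<zero>\<^bsub>H\<^esub>, add = (\<lambda>x y. \<iota> (\<kappa> x \<oplus>\<^bsub>H\<^esub> \<kappa> y)), smult = (\<lambda>a x. \<iota> (a \<odot>\<^bsub>H\<^esub> \<kappa> x))\<rparr>"
  define H' where "H' = module.extend M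
    \<lparr>comult = \<lambda>x. tensor_map R M M \<iota> \<iota> (comult H (\<kappa> x)), counit = \<lambda>x. counit H (\<kappa> x)\<rparr>"
  
  have same: "same_module H' M"
    by (simp add: same_module_def H'_def module.defs)
  have H'_simps: "carrier H' = \<iota> ` carrier H" "\<zero>\<^bsub>H'\<^esub> = \<iota> \<zero>\<^bsub>H\<^esub>"
    "x \<oplus>\<^bsub>H'\<^esub> y = \<iota> (\<kappa> x \<oplus>\<^bsub>H\<^esub> \<kappa> y)" "a \<odot>\<^bsub>H'\<^esub> x = \<iota> (a \<odot>\<^bsub>H\<^esub> \<kappa> x)"
    "comult H' x = tensor_map R H' H' \<iota> \<iota> (comult H (\<kappa> x))" "counit H' x = counit H (\<kappa> x)" for x y a
    by (simp_all add: tensor_map_same_module[OF same same]) (simp_all add: H'_def M_def module.defs)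
  have module [simp]: "module R H'"
    by (rule module_image[where F = H and h = \<iota>]) (simp_all add: H'_simps)
  have \<iota>_lin: "linear_map R H H' \<iota>"
    by (rule linear_mapI) (simp_all add: H'_simps)
  have H': "coalgebra R H'"
    by (rule coalgebra_image[OF H module \<iota>_lin]) (simp_all add: H'_simps)
  moreover have "coalgebra_map R H H' \<iota>"
    by (simp add: coalgebra_map_def \<iota>_lin H'_simps)
  moreover have "coalgebra_map R H' H (\<kappa>)"
  proof -
    have lin: "linear_map R H' H (\<kappa>)"
      by (rule linear_mapI) (auto simp: H'_simps)
    have "tensor_map R H H (\<kappa>) (\<kappa>) (tensor_map R H' H' \<iota> \<iota> (comult H h)) = comult H h"
      if "h \<in> carrier H" for h
      using that by (simp add: tensor_map_tensor_map[of H H H' H' H H] lin \<iota>_lin tensor_map_id)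
    with lin show ?thesis
      by (auto simp: coalgebra_map_def H'_simps(1) H'_simps(5,6))
  qed
  ultimately show ?thesis
    using that H'_simps(1) by simp
qed

end

section \<open>Measurings\<close>

lemma hom_module_simps:
  "f \<in> carrier (hom_module K V W) \<longleftrightarrow> f \<in> extensional (carrier V) \<and> linear_map K V W f"
  "\<zero>\<^bsub>hom_module K V W\<^esub> = (\<lambda>x\<in>carrier V. \<zero>\<^bsub>W\<^esub>)"
  "f \<oplus>\<^bsub>hom_module K V W\<^esub> g = (\<lambda>x\<in>carrier V. f x \<oplus>\<^bsub>W\<^esub> g x)"
  "a \<odot>\<^bsub>hom_module K V W\<^esub> f = (\<lambda>x\<in>carrier V. a \<odot>\<^bsub>W\<^esub> f x)"
  by (simp_all add: hom_module_def)

lemma hom_module_eqI: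
  assumes "f \<in> carrier (hom_module K V W)" "g \<in> carrier (hom_module K V W)"
    and "\<And>x. x \<in> carrier V \<Longrightarrow> f x = g x"
  shows "f = g"
  using assms by (auto simp: hom_module_simps intro: extensionalityI)

context field
begin

lemma module_hom:
  assumes "module R V" "module R W"
  shows "module R (hom_module R V W)"
proof -
  interpret V: module R V by fact
  interpret W: module R W by fact
  let ?H = "hom_module R V W"
  have add: "f \<oplus>\<^bsub>?H\<^esub> g \<in> carrier ?H" if "f \<in> carrier ?H" "g \<in> carrier ?H" for f g
  proof -
    have lin: "linear_map R V W f" "linear_map R V W g" using that by (simp_all add: hom_module_simps)
    note [simp] = lin[THEN linear_map_closed] lin[THEN linear_map_add] lin[THEN linear_map_smult]
    show ?thesis
      by (auto simp: hom_module_simps W.a_ac W.smult_r_distr intro!: linear_mapI)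
  qed
  have smult: "a \<odot>\<^bsub>?H\<^esub> f \<in> carrier ?H" if "a \<in> carrier R" "f \<in> carrier ?H" for a f
  proof -
    have lin: "linear_map R V W f" using that by (simp add: hom_module_simps)
    note [simp] = lin[THEN linear_map_closed] lin[THEN linear_map_add] lin[THEN linear_map_smult]
    show ?thesis
      using that(1) by (auto simp: hom_module_simps W.smult_r_distr m_comm simp flip: W.smult_assoc1 intro!: linear_mapI)
  qed
  have zero: "\<zero>\<^bsub>?H\<^esub> \<in> carrier ?H"
    by (auto simp: hom_module_simps intro!: linear_mapI)
  have closed: "f x \<in> carrier W" if "f \<in> carrier ?H" "x \<in> carrier V" for f x
    using that by (auto simp: hom_module_simps intro: linear_map_closed)
  show ?thesis
  proof (intro moduleI abelian_groupI)
    show "\<exists>g\<in>carrier ?H. g \<oplus>\<^bsub>?H\<^esub> f = \<zero>\<^bsub>?H\<^esub>" if f: "f \<in> carrier ?H" for f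
    proof
      \<comment> \<open>Taking the negative as a scalar multiple reuses closure under
        scaling.\<close>
      show "(\<ominus> \<one>) \<odot>\<^bsub>?H\<^esub> f \<in> carrier ?H" using f by (intro smult) auto
      show "((\<ominus> \<one>) \<odot>\<^bsub>?H\<^esub> f) \<oplus>\<^bsub>?H\<^esub> f = \<zero>\<^bsub>?H\<^esub>"
        using closed[OF f] by (auto simp: hom_module_simps W.smult_l_minus W.l_neg)
    qed
    show "\<zero>\<^bsub>?H\<^esub> \<oplus>\<^bsub>?H\<^esub> f = f" if f: "f \<in> carrier ?H" for f
      using closed[OF f] by (intro hom_module_eqI[OF add[OF zero f] f]) (simp add: hom_module_simps)
    show "\<one> \<odot>\<^bsub>?H\<^esub> f = f" if f: "f \<in> carrier ?H" for f
      using closed[OF f] by (intro hom_module_eqI[OF smult[OF one_closed f] f]) (simp add: hom_module_simps)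
  qed (simp_all add: is_cring add smult zero,
      auto simp: hom_module_simps fun_eq_iff restrict_def W.a_ac W.smult_r_distr W.smult_l_distr W.smult_assoc1
        linear_map_closed)
qed

lemma linear_map_eval:
  assumes "linear_map R X (hom_module R V W) h" "v \<in> carrier V"
  shows "linear_map R X W (\<lambda>x. h x v)"
  using linear_map_closed[OF assms(1)] linear_map_add[OF assms(1)] linear_map_smult[OF assms(1)] assms(2)
  by (intro linear_mapI) (auto simp: hom_module_simps intro: linear_map_closed)

lemma hom_linear:
  "\<lbrakk>linear_map R X (hom_module R V W) h; x \<in> carrier X\<rbrakk> \<Longrightarrow> linear_map R V W (h x)"
  using linear_map_closed[of R X "hom_module R V W" h x] by (simp add: hom_module_simps)

lemma hom_bilinear:
  "linear_map R X (hom_module R V W) h \<Longrightarrow> bilinear_map R X V W h"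
  by (rule bilinear_mapI) (rule hom_linear linear_map_eval; assumption)+

lemma linear_map_homI:
  assumes "bilinear_map R X V W h" "\<And>x. x \<in> carrier X \<Longrightarrow> h x \<in> extensional (carrier V)" "module R X" "module R V"
  shows "linear_map R X (hom_module R V W) h"
proof -
  interpret X: module R X by fact
  interpret V: module R V by fact
  note lin = bilinear_mapD[OF assms(1)]
  show ?thesis
    using lin assms(2) linear_map_add[OF lin(2)] linear_map_smult[OF lin(2)]
    by (intro linear_mapI) (auto simp: hom_module_simps fun_eq_iff extensional_def)
qed

text \<open>Composition is prescribed on pure tensors only, whereas a measuring acts by every
  tensor; this linear extension is the action by which the tensor product of two measuring
  coalgebras measures.\<close>

definition comp_action ::
  "('a, 'v, 'm) module_scheme \<Rightarrow> ('a, 'w, 'n) module_scheme \<Rightarrow> ('h \<Rightarrow> 'u \<Rightarrow> 'w) \<Rightarrow> ('l \<Rightarrow> 'v \<Rightarrow> 'u)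
    \<Rightarrow> ('a, 'h, 'l) tensor \<Rightarrow> 'v \<Rightarrow> 'w"
  where "comp_action V W \<sigma> \<tau> = tensor_lift R (hom_module R V W) (\<lambda>h l. compose (carrier V) (\<sigma> h) (\<tau> l))"

context
  fixes U :: "('a, 'u, 'l1) module_scheme" and V :: "('a, 'v, 'l2) module_scheme" and W :: "('a, 'w, 'l3) module_scheme"
    and H :: "('a, 'h, 'l4) module_scheme" and L :: "('a, 'l, 'l5) module_scheme" and \<sigma> \<tau>
  assumes [simp]: "module R U" "module R V" "module R W" "module R H" "module R L"
    and \<sigma>: "linear_map R H (hom_module R V W) \<sigma>" and \<tau>: "linear_map R L (hom_module R U V) \<tau>"
begin

private lemma compose_bilinear:
  "bilinear_map R H L (hom_module R U W) (\<lambda>h l. compose (carrier U) (\<sigma> h) (\<tau> l))"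
proof (rule bilinear_mapI)
  note closed = linear_map_closed[OF hom_linear[OF \<tau>]]
  note \<sigma>' = linear_map_add[OF hom_linear[OF \<sigma>]] linear_map_smult[OF hom_linear[OF \<sigma>]]
  show "linear_map R L (hom_module R U W) (\<lambda>l. compose (carrier U) (\<sigma> h) (\<tau> l))" if h: "h \<in> carrier H" for h
  proof (rule linear_map_homI)
    show "bilinear_map R L U W (\<lambda>l. compose (carrier U) (\<sigma> h) (\<tau> l))"
      by (rule bilinear_map_cong[OF bilinear_map_comp[OF hom_bilinear[OF \<tau>] hom_linear[OF \<sigma> h] linear_map_id linear_map_id]])
        (simp_all add: compose_def)
  qed simp_all
  show "linear_map R H (hom_module R U W) (\<lambda>h. compose (carrier U) (\<sigma> h) (\<tau> l))" if l: "l \<in> carrier L" for l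
  proof (rule linear_map_homI)
    show "bilinear_map R H U W (\<lambda>h. compose (carrier U) (\<sigma> h) (\<tau> l))"
      by (rule bilinear_map_cong[OF bilinear_map_comp[OF hom_bilinear[OF \<sigma>] linear_map_id linear_map_id hom_linear[OF \<tau> l]]])
        (simp_all add: compose_def)
  qed simp_all
qed

lemma comp_action_linear: "linear_map R (tensor_module R H L) (hom_module R U W) (comp_action U W \<sigma> \<tau>)"
  unfolding comp_action_def by (rule tensor_lift_linear[OF _ _ _ compose_bilinear]) (simp_all add: module_hom)

lemma comp_action_pure:
  "\<lbrakk>h \<in> carrier H; l \<in> carrier L\<rbrakk> \<Longrightarrow>
    comp_action U W \<sigma> \<tau> (pure_tensor R H L h l) = compose (carrier U) (\<sigma> h) (\<tau> l)"
  unfolding comp_action_def by (rule tensor_lift_pure[OF _ _ _ compose_bilinear]) (simp_all add: module_hom)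

end

section \<open>Measurings of algebras\<close>

lemma measures_algD:
  assumes "measures_alg R A B H \<rho>"
  shows "coalgebra R H" "linear_map R H (hom_module R A B) \<rho>"
    "\<lbrakk>h \<in> carrier H; x \<in> carrier A; y \<in> carrier A\<rbrakk> \<Longrightarrow>
      \<rho> h (x \<otimes>\<^bsub>A\<^esub> y) = tensor_lift R B (\<lambda>h h'. \<rho> h x \<otimes>\<^bsub>B\<^esub> \<rho> h' y) (comult H h)"
    "h \<in> carrier H \<Longrightarrow> \<rho> h \<one>\<^bsub>A\<^esub> = counit H h \<odot>\<^bsub>B\<^esub> \<one>\<^bsub>B\<^esub>"
  using assms by (simp_all add: measures_alg_def)

lemma algebra_mult_bilinear:
  assumes "assoc_algebra R A"
  shows "bilinear_map R A A A (\<otimes>\<^bsub>A\<^esub>)"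
proof -
  interpret A: assoc_algebra R A by fact
  show ?thesis
    by (intro bilinear_mapI linear_mapI)
      (simp_all add: A.A.l_distr A.A.r_distr A.smult_mult_left A.smult_mult_right)
qed

lemma assoc_algebra_module: "assoc_algebra R A \<Longrightarrow> module R A"
  by (simp add: assoc_algebra_def)

lemma action_mult_bilinear:
  assumes "assoc_algebra R B" "linear_map R H (hom_module R A B) \<rho>" "x \<in> carrier A" "y \<in> carrier A"
  shows "bilinear_map R H H B (\<lambda>h h'. \<rho> h x \<otimes>\<^bsub>B\<^esub> \<rho> h' y)"
  by (rule bilinear_map_comp[OF algebra_mult_bilinear linear_map_id]) (rule assms linear_map_eval)+

text \<open>Because \<open>f\<close> respects coproducts, the sum over \<open>comult H (f h)\<close>
  is the sum over \<open>comult L h\<close> with \<open>f\<close> applied to both legs. This makes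
  \<open>\<pi>\<close> after a coalgebra map a measuring, and moves measurings to copies of their
  coalgebras.\<close>

lemma measures_alg_precomp:
  assumes B: "assoc_algebra R B" and \<rho>: "measures_alg R A B H \<rho>"
    and L [simp]: "coalgebra R L" and f: "coalgebra_map R L H f"
  shows "measures_alg R A B L (\<lambda>x. \<rho> (f x))"
proof -
  note H [simp] = measures_algD(1)[OF \<rho>] and lin = measures_algD(2)[OF \<rho>] and [simp] = assoc_algebra_module[OF B]
  note f' [simp] = linear_map_closed[OF coalgebra_mapD(1)[OF f]]
  have "\<rho> (f h) (x \<otimes>\<^bsub>A\<^esub> y) = tensor_lift R B (\<lambda>h h'. \<rho> (f h) x \<otimes>\<^bsub>B\<^esub> \<rho> (f h') y) (comult L h)"
    if [simp]: "h \<in> carrier L" and xy: "x \<in> carrier A" "y \<in> carrier A" for h x y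
  proof -
    have "\<rho> (f h) (x \<otimes>\<^bsub>A\<^esub> y) = tensor_lift R B (\<lambda>h h'. \<rho> h x \<otimes>\<^bsub>B\<^esub> \<rho> h' y) (tensor_map R H H f f (comult L h))"
      using measures_algD(3)[OF \<rho> _ xy] coalgebra_mapD(2)[OF f] by simp
    also have "\<dots> = tensor_lift R B (\<lambda>h h'. \<rho> (f h) x \<otimes>\<^bsub>B\<^esub> \<rho> (f h') y) (comult L h)"
      using coalgebra_mapD(1)[OF f]
      by (intro tensor_lift_tensor_map[of H H L L B] action_mult_bilinear[OF B lin xy]) simp_all
    finally show ?thesis .
  qed
  then show ?thesis
    using linear_map_comp[OF lin coalgebra_mapD(1)[OF f]] measures_algD(4)[OF \<rho>] coalgebra_mapD(3)[OF f]
    by (simp add: measures_alg_def)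
qed

text \<open>Expanding the action of \<open>l\<close> on a product and then that of \<open>h\<close>
  yields a double sum in which the left legs of both coproducts act on \<open>a\<close> and the
  right legs on \<open>a'\<close>. This is the pairing of legs that the interchange in the coproduct
  of a tensor coalgebra creates.\<close>

lemma measures_alg_comp:
  assumes A: "assoc_algebra R A" and B: "assoc_algebra R B" and C: "assoc_algebra R C"
    and \<sigma>: "measures_alg R B C H \<sigma>" and \<tau>: "measures_alg R A B L \<tau>"
  shows "measures_alg R A C (tensor_coalgebra R H L) (comp_action A C \<sigma> \<tau>)"
proof -
  interpret A: assoc_algebra R A by fact
  interpret B: assoc_algebra R B by fact
  interpret C: assoc_algebra R C by fact
  note [simp] = assoc_algebra_module[OF A] assoc_algebra_module[OF B] assoc_algebra_module[OF C]
  note [simp] = measures_algD(1)[OF \<sigma>] measures_algD(1)[OF \<tau>]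
  note \<sigma>_lin = measures_algD(2)[OF \<sigma>] and \<tau>_lin = measures_algD(2)[OF \<tau>]
  let ?HL = "tensor_module R H L" and ?HH = "tensor_module R H H" and ?LL = "tensor_module R L L"
  let ?\<rho> = "comp_action A C \<sigma> \<tau>"
  note \<rho>_lin = comp_action_linear[of A B C H L, OF _ _ _ _ _ \<sigma>_lin \<tau>_lin, simplified]
  note \<rho>_pure = comp_action_pure[of A B C H L, OF _ _ _ _ _ \<sigma>_lin \<tau>_lin, simplified]
  have \<tau>_closed [simp]: "\<tau> l a \<in> carrier B" if "l \<in> carrier L" "a \<in> carrier A" for l a
    using linear_map_closed[OF hom_linear[OF \<tau>_lin]] that by simp
  have mult: "\<forall>t\<in>carrier ?HL. ?\<rho> t (a \<otimes>\<^bsub>A\<^esub> a') =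
      tensor_lift R C (\<lambda>x y. ?\<rho> x a \<otimes>\<^bsub>C\<^esub> ?\<rho> y a') (comult (tensor_coalgebra R H L) t)"
    if a [simp]: "a \<in> carrier A" "a' \<in> carrier A" for a a'
  proof -
    note bil = action_mult_bilinear[OF C \<rho>_lin a]
    note lift = linear_map_tensor_lift[OF _ _ _ _ bil]
    let ?F = "\<lambda>t. tensor_lift R C (\<lambda>x y. ?\<rho> x a \<otimes>\<^bsub>C\<^esub> ?\<rho> y a') (tensor_interchange R H L t)"
    \<comment> \<open>Here \<open>s\<close> stands for \<open>comult H h\<close>, while the two legs
      from \<open>L\<close> are fixed elements.\<close>
    have 1: "\<forall>s\<in>carrier ?HH. tensor_lift R C (\<lambda>x y. \<sigma> x (\<tau> l a) \<otimes>\<^bsub>C\<^esub> \<sigma> y (\<tau> l' a')) s =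
        ?F (pure_tensor R ?HH ?LL s (pure_tensor R L L l l'))"
      if [simp]: "l \<in> carrier L" "l' \<in> carrier L" for l l'
    proof (rule tensor_ext)
      show "linear_map R ?HH C (tensor_lift R C (\<lambda>x y. \<sigma> x (\<tau> l a) \<otimes>\<^bsub>C\<^esub> \<sigma> y (\<tau> l' a')))"
        by (intro tensor_lift_linear action_mult_bilinear[OF C \<sigma>_lin]) simp_all
      show "linear_map R ?HH C (\<lambda>s. ?F (pure_tensor R ?HH ?LL s (pure_tensor R L L l l')))"
        by (rule lift coalgebra_intros | simp)+
    qed (simp_all add: tensor_lift_pure[OF _ _ _ bil] tensor_lift_pure[OF _ _ _ action_mult_bilinear[OF C \<sigma>_lin]]
        \<rho>_pure compose_def)
    \<comment> \<open>Now \<open>t\<close> stands for the coproduct in \<open>L\<close>. On each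
      pure tensor the measuring law of \<open>\<sigma>\<close> splits the product, and the previous
      fact applies to \<open>comult H h\<close>.\<close>
    have 2: "\<forall>t\<in>carrier ?LL. \<sigma> h (tensor_lift R B (\<lambda>x y. \<tau> x a \<otimes>\<^bsub>B\<^esub> \<tau> y a') t) =
        ?F (pure_tensor R ?HH ?LL (comult H h) t)"
      if [simp]: "h \<in> carrier H" for h
    proof (rule tensor_ext)
      show "linear_map R ?LL C (\<lambda>t. \<sigma> h (tensor_lift R B (\<lambda>x y. \<tau> x a \<otimes>\<^bsub>B\<^esub> \<tau> y a') t))"
        by (intro linear_map_comp[OF hom_linear[OF \<sigma>_lin]] tensor_lift_linear action_mult_bilinear[OF B \<tau>_lin]) simp_all
      show "linear_map R ?LL C (\<lambda>t. ?F (pure_tensor R ?HH ?LL (comult H h) t))"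
        by (rule lift coalgebra_intros | simp)+
    qed (simp_all add: 1[rule_format, symmetric] tensor_lift_pure[OF _ _ _ action_mult_bilinear[OF B \<tau>_lin]]
        measures_algD(3)[OF \<sigma>])
    show ?thesis
    proof (rule tensor_ext)
      show "linear_map R ?HL C (\<lambda>t. ?\<rho> t (a \<otimes>\<^bsub>A\<^esub> a'))"
        by (intro linear_map_eval[OF \<rho>_lin]) simp
      show "linear_map R ?HL C (\<lambda>t. tensor_lift R C (\<lambda>x y. ?\<rho> x a \<otimes>\<^bsub>C\<^esub> ?\<rho> y a') (comult (tensor_coalgebra R H L) t))"
        unfolding tensor_coalgebra_simps by (rule lift coalgebra_intros | simp)+
    qed (simp_all add: \<rho>_pure compose_def measures_algD(3)[OF \<tau>] 2)
  qed
  have unit: "\<forall>t\<in>carrier ?HL. ?\<rho> t \<one>\<^bsub>A\<^esub> = counit (tensor_coalgebra R H L) t \<odot>\<^bsub>C\<^esub> \<one>\<^bsub>C\<^esub>"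
  proof (rule tensor_ext)
    show "linear_map R ?HL C (\<lambda>t. ?\<rho> t \<one>\<^bsub>A\<^esub>)"
      by (intro linear_map_eval[OF \<rho>_lin]) simp
    have "linear_map R (self_module R) C (\<lambda>a. a \<odot>\<^bsub>C\<^esub> \<one>\<^bsub>C\<^esub>)"
      by (rule bilinear_mapD(2)[OF smult_bilinear(1)]) simp_all
    moreover have "linear_map R ?HL (self_module R) (counit (tensor_coalgebra R H L))"
      using coalgebra.counit_linear[of R "tensor_coalgebra R H L"] by simp
    ultimately show "linear_map R ?HL C (\<lambda>t. counit (tensor_coalgebra R H L) t \<odot>\<^bsub>C\<^esub> \<one>\<^bsub>C\<^esub>)"
      by (rule linear_map_comp)
  qed (simp_all add: \<rho>_pure compose_def measures_algD(4)[OF \<sigma>] measures_algD(4)[OF \<tau>]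
      linear_map_smult[OF hom_linear[OF \<sigma>_lin]] m_comm flip: C.smult_assoc1)
  show ?thesis
    unfolding measures_alg_def using mult unit \<rho>_lin by simp
qed

text \<open>The linear extension of \<open>\<one> \<mapsto> id\<close>, hence the only candidate for
  the action of the unit coalgebra.\<close>

lemma identity_action_linear:
  assumes "module R A"
  shows "linear_map R (self_module R) (hom_module R A A) (\<lambda>a. \<lambda>x\<in>carrier A. a \<odot>\<^bsub>A\<^esub> x)"
proof (rule linear_map_homI)
  show "bilinear_map R (self_module R) A A (\<lambda>a. \<lambda>x\<in>carrier A. a \<odot>\<^bsub>A\<^esub> x)"
    by (rule bilinear_map_cong[OF smult_bilinear(1)]) (simp_all add: assms)
qed (simp_all add: assms)

text \<open>The coproduct of \<open>a\<close> is the pure tensor of \<open>a\<close> and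
  \<open>\<one>\<close>, so the measuring law says that scaling a product by \<open>a\<close> is
  scaling its first factor.\<close>

lemma measures_alg_identity:
  assumes A: "assoc_algebra R A"
  shows "measures_alg R A A (unit_coalgebra R) (\<lambda>a. \<lambda>x\<in>carrier A. a \<odot>\<^bsub>A\<^esub> x)"
proof -
  interpret A: assoc_algebra R A by fact
  note [simp] = assoc_algebra_module[OF A]
  note lin = identity_action_linear[of A, simplified]
  have "tensor_lift R A (\<lambda>b b'. (b \<odot>\<^bsub>A\<^esub> x) \<otimes>\<^bsub>A\<^esub> (b' \<odot>\<^bsub>A\<^esub> y))
      (pure_tensor R (self_module R) (self_module R) a \<one>) = (a \<odot>\<^bsub>A\<^esub> x) \<otimes>\<^bsub>A\<^esub> (\<one> \<odot>\<^bsub>A\<^esub> y)"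
    if "a \<in> carrier R" and xy: "x \<in> carrier A" "y \<in> carrier A" for a x y
    by (rule tensor_lift_pure[OF _ _ _ bilinear_map_cong[OF action_mult_bilinear[OF A lin xy]]])
      (simp_all add: that)
  then show ?thesis
    unfolding measures_alg_def using lin by (simp add: A.smult_mult_left)
qed

section \<open>Measurings of coalgebras\<close>

lemma measures_coalgD:
  assumes "measures_coalg R C D L \<phi>"
  shows "coalgebra R L" "linear_map R L (hom_module R C D) \<phi>"
    "coalgebra_map R (tensor_coalgebra R L C) D (tensor_lift R D \<phi>)"
  using assms by (simp_all add: measures_coalg_def)

text \<open>The map induced by the new action is the old induced map after
  \<open>f \<otimes> id\<close>, a composite of coalgebra maps.\<close>

lemma measures_coalg_precomp:
  assumes C [simp]: "coalgebra R C" and D [simp]: "coalgebra R D" and \<phi>: "measures_coalg R C D L \<phi>"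
    and H [simp]: "coalgebra R H" and f: "coalgebra_map R H L f"
  shows "measures_coalg R C D H (\<lambda>x. \<phi> (f x))"
proof -
  note [simp] = measures_coalgD(1)[OF \<phi>] and lin = measures_coalgD(2)[OF \<phi>] and f_lin = coalgebra_mapD(1)[OF f]
  have "coalgebra_map R (tensor_coalgebra R H C) D (\<lambda>t. tensor_lift R D \<phi> (tensor_map R L C f (\<lambda>x. x) t))"
    by (rule coalgebra_map_comp[OF _ _ _ measures_coalgD(3)[OF \<phi>]
        coalgebra_map_tensor_map[OF _ _ _ _ f coalgebra_map_id]]) simp_all
  moreover have "tensor_lift R D (\<lambda>x. \<phi> (f x)) t = tensor_lift R D \<phi> (tensor_map R L C f (\<lambda>x. x) t)"
    if "t \<in> carrier (tensor_coalgebra R H C)" for t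
    using that by (simp add: tensor_lift_tensor_map[of L C H C D] hom_bilinear[OF lin] f_lin)
  ultimately have "coalgebra_map R (tensor_coalgebra R H C) D (tensor_lift R D (\<lambda>x. \<phi> (f x)))"
    by (rule coalgebra_map_cong[rotated 2]) simp_all
  then show ?thesis
    unfolding measures_coalg_def using linear_map_comp[OF lin f_lin] by simp
qed

lemma measures_coalg_comp:
  assumes C [simp]: "coalgebra R C" and D [simp]: "coalgebra R D" and E [simp]: "coalgebra R E"
    and \<sigma>: "measures_coalg R D E H \<sigma>" and \<tau>: "measures_coalg R C D L \<tau>"
  shows "measures_coalg R C E (tensor_coalgebra R H L) (comp_action C E \<sigma> \<tau>)"
proof -
  note [simp] = measures_coalgD(1)[OF \<sigma>] measures_coalgD(1)[OF \<tau>]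
  note \<sigma>_lin = measures_coalgD(2)[OF \<sigma>] and \<tau>_lin = measures_coalgD(2)[OF \<tau>]
  let ?\<rho> = "comp_action C E \<sigma> \<tau>" and ?HL = "tensor_module R H L"
  note \<rho>_lin = comp_action_linear[of C D E H L, OF _ _ _ _ _ \<sigma>_lin \<tau>_lin, simplified]
  note \<rho>_pure = comp_action_pure[of C D E H L, OF _ _ _ _ _ \<sigma>_lin \<tau>_lin, simplified]
  \<comment> \<open>Currying the composite action gives this map: reassociate, let \<open>L\<close>
    act on \<open>C\<close>, then let \<open>H\<close> act on the result. Each stage is a coalgebra
    map.\<close>
  let ?g = "\<lambda>t. tensor_lift R E \<sigma> (tensor_map R H D (\<lambda>x. x) (tensor_lift R D \<tau>) (tensor_assoc R H L C t))"
  have \<tau>_lift [simp]: "linear_map R (tensor_module R L C) D (tensor_lift R D \<tau>)"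
    using coalgebra_mapD(1)[OF measures_coalgD(3)[OF \<tau>]] by simp
  have g: "coalgebra_map R (tensor_coalgebra R (tensor_coalgebra R H L) C) E ?g"
    by (rule coalgebra_map_comp[OF _ _ _ measures_coalgD(3)[OF \<sigma>] coalgebra_map_comp[OF _ _ _
        coalgebra_map_tensor_map[OF _ _ _ _ coalgebra_map_id measures_coalgD(3)[OF \<tau>]]
        coalgebra_map_tensor_assoc]]) simp_all
  have eq: "\<forall>t\<in>carrier (tensor_module R ?HL C). tensor_lift R E ?\<rho> t = ?g t"
  proof (rule tensor_ext_left[where X = E])
    show "linear_map R (tensor_module R ?HL C) E (tensor_lift R E ?\<rho>)"
      by (rule tensor_lift_linear[OF _ _ _ hom_bilinear[OF \<rho>_lin]]) simp_all
    show "linear_map R (tensor_module R ?HL C) E ?g"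
      by (rule linear_map_tensor_lift[OF _ _ _ _ hom_bilinear[OF \<sigma>_lin]] coalgebra_intros | simp)+
  qed (simp_all add: tensor_lift_pure[OF _ _ _ hom_bilinear[OF \<rho>_lin]] \<rho>_pure compose_def
      tensor_lift_pure[OF _ _ _ hom_bilinear[OF \<sigma>_lin]] tensor_lift_pure[OF _ _ _ hom_bilinear[OF \<tau>_lin]]
      linear_map_closed[OF hom_linear[OF \<tau>_lin]])
  have "coalgebra_map R (tensor_coalgebra R (tensor_coalgebra R H L) C) E (tensor_lift R E ?\<rho>)"
    by (rule coalgebra_map_cong[OF _ _ g]) (simp_all add: eq)
  then show ?thesis
    unfolding measures_coalg_def using \<rho>_lin by simp
qed

text \<open>The induced map \<open>K \<otimes> C \<rightarrow> C\<close> is the left unitor.\<close>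

lemma measures_coalg_identity:
  assumes C [simp]: "coalgebra R C"
  shows "measures_coalg R C C (unit_coalgebra R) (\<lambda>a. \<lambda>x\<in>carrier C. a \<odot>\<^bsub>C\<^esub> x)"
proof -
  note lin = identity_action_linear[of C, simplified]
  have "tensor_lift R C (\<lambda>a. \<lambda>x\<in>carrier C. a \<odot>\<^bsub>C\<^esub> x) t = tensor_lunit R C t"
    if "t \<in> carrier (tensor_module R (self_module R) C)" for t
    unfolding tensor_lunit_def
    using that by (intro tensor_lift_cong[of "self_module R" C] smult_bilinear) simp_all
  then have "coalgebra_map R (tensor_coalgebra R (unit_coalgebra R) C) C (tensor_lift R C (\<lambda>a. \<lambda>x\<in>carrier C. a \<odot>\<^bsub>C\<^esub> x))"
    by (intro coalgebra_map_cong[OF _ _ coalgebra_map_tensor_lunit]) simp_all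
  then show ?thesis
    unfolding measures_coalg_def using lin by simp
qed

end

section \<open>The enriched category\<close>

context field
begin

text \<open>The predicate \<open>meas\<close> speaks of coalgebras on \<open>'h\<close> and cannot
  be applied to \<open>H\<close>, whose type is \<open>'x\<close>. The hypothesis therefore asks for
  it after every coalgebra map into \<open>H\<close> from a coalgebra on \<open>'h\<close>; it is
  used for the copy of \<open>H\<close>.\<close>

lemma universal_measuring_lift:
  fixes H :: "('a, 'x) coalgebra" and \<iota> :: "'x \<Rightarrow> 'h"
  assumes univ: "universal_measuring TYPE('h) R meas P \<pi>"
    and H: "coalgebra R H" and P: "coalgebra R P" and \<iota>: "inj \<iota>"
    and meas: "\<And>(H' :: ('a, 'h) coalgebra) j. \<lbrakk>coalgebra R H'; coalgebra_map R H' H j\<rbrakk> \<Longrightarrow> meas H' (\<lambda>x. \<rho> (j x))"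
  shows "\<exists>f. coalgebra_map R H P f \<and> (\<forall>h\<in>carrier H. \<pi> (f h) = \<rho> h)"
proof -
  obtain H' :: "('a, 'h) coalgebra" and j where H': "coalgebra R H'" "coalgebra_map R H H' \<iota>"
    "coalgebra_map R H' H j" "\<And>h. j (\<iota> h) = h" "\<iota> ` carrier H = carrier H'"
    using coalgebra_transport[OF H \<iota>] by metis
  obtain f where f: "coalgebra_map R H' P f" "\<forall>h\<in>carrier H'. \<pi> (f h) = \<rho> (j h)"
    using univ meas[OF H'(1,3)] unfolding universal_measuring_def by metis
  have "coalgebra_map R H P (\<lambda>h. f (\<iota> h))"
    by (rule coalgebra_map_comp[OF H H'(1) P f(1) H'(2)])
  moreover have "\<forall>h\<in>carrier H. \<pi> (f (\<iota> h)) = \<rho> h"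
    using f(2) H'(4) by (simp flip: H'(5))
  ultimately show ?thesis by blast
qed

lemma universal_measuring_unique:
  fixes H :: "('a, 'h) coalgebra"
  assumes univ: "universal_measuring TYPE('h) R meas P \<pi>"
    and H: "coalgebra R H" and P: "coalgebra R P" and meas: "meas H (\<lambda>x. \<pi> (f x))"
    and f: "coalgebra_map R H P f" and g: "coalgebra_map R H P g"
    and eq: "\<And>h. h \<in> carrier H \<Longrightarrow> \<pi> (f h) = \<pi> (g h)" and h: "h \<in> carrier H"
  shows "f h = g h"
proof -
  \<comment> \<open>Uniqueness in the universal property is among extensional maps, so both maps are
    cut down to the carrier; each then mediates the one measuring
    \<open>\<pi> \<circ> f\<close>.\<close>
  have "coalgebra_map R H P (restrict f (carrier H))" "coalgebra_map R H P (restrict g (carrier H))"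
    by (rule coalgebra_map_cong[OF H P f] coalgebra_map_cong[OF H P g]; simp)+
  moreover have "\<exists>!u. u \<in> extensional (carrier H) \<and> coalgebra_map R H P u \<and> (\<forall>h\<in>carrier H. \<pi> (u h) = \<pi> (f h))"
    using univ meas unfolding universal_measuring_def by blast
  moreover have "\<forall>h\<in>carrier H. \<pi> (restrict f (carrier H) h) = \<pi> (f h)"
    "\<forall>h\<in>carrier H. \<pi> (restrict g (carrier H) h) = \<pi> (f h)"
    using eq by simp_all
  ultimately have "restrict f (carrier H) = restrict g (carrier H)"
    using restrict_extensional[of f "carrier H"] restrict_extensional[of g "carrier H"] by blast
  then show ?thesis using h by (metis restrict_apply')
qed

text \<open>
  The universal property concerns test coalgebras on the type \<open>'h\<close> only.  The ones needed are
  \<open>K\<close>, \<open>P \<otimes> P\<close>, \<open>K \<otimes> P\<close>, \<open>P \<otimes> K\<close> and \<open>(P \<otimes> P) \<otimes> P\<close>, whose types all embed into \<open>'h\<close>.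
\<close>

context
  assumes large: "\<exists>\<iota> :: ('a, ('a, 'p, 'p) tensor, 'p) tensor \<Rightarrow> 'h. inj \<iota>"
begin

text \<open>Elements of a tensor type are sets of functions on pairs. Reindexing functions along a
  left inverse of \<open>\<phi>\<close> is injective since that inverse is onto, and taking images
  embeds the sets; no algebraic structure is involved.\<close>

lemma tensor_injection:
  fixes \<phi> :: "'x \<times> 'y \<Rightarrow> ('a, 'p, 'p) tensor \<times> 'p"
  assumes "inj \<phi>"
  shows "\<exists>\<iota> :: ('a, 'x, 'y) tensor \<Rightarrow> 'h. inj \<iota>"
proof -
  obtain \<iota> :: "('a, ('a, 'p, 'p) tensor, 'p) tensor \<Rightarrow> 'h" where \<iota>: "inj \<iota>"
    using large by blast
  have inj: "inj (\<lambda>r :: 'x \<times> 'y \<Rightarrow> 'a. r \<circ> inv_into UNIV \<phi>)"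
    by (rule injI) (metis assms comp_assoc comp_id inv_o_cancel)
  have "inj (\<lambda>X. \<iota> ((\<lambda>r. r \<circ> inv_into UNIV \<phi>) ` X))"
    by (rule injI) (drule injD[OF \<iota>], simp only: inj_image_eq_iff[OF inj])
  then show ?thesis by blast
qed

text \<open>Only types are to be embedded, so any set of functions can serve as a code, coset or
  not: a point \<open>p\<close> is coded by the indicator function of \<open>(p, p)\<close>, a
  scalar by a constant function.\<close>

lemma test_injections:
  shows "\<exists>\<iota> :: 'a \<Rightarrow> 'h. inj \<iota>" "\<exists>\<iota> :: ('a, 'p, 'p) tensor \<Rightarrow> 'h. inj \<iota>"
    "\<exists>\<iota> :: ('a, 'a, 'p) tensor \<Rightarrow> 'h. inj \<iota>" "\<exists>\<iota> :: ('a, 'p, 'a) tensor \<Rightarrow> 'h. inj \<iota>"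
proof -
  obtain \<iota> :: "('a, ('a, 'p, 'p) tensor, 'p) tensor \<Rightarrow> 'h" where "inj \<iota>"
    using large by blast
  then have "inj (\<lambda>a. \<iota> {\<lambda>_. a})"
    by (auto intro!: injI dest!: injD simp: fun_eq_iff)
  then show "\<exists>\<iota> :: 'a \<Rightarrow> 'h. inj \<iota>" by blast
  let ?s = "\<lambda>p :: 'p. {\<lambda>q. if q = (p, p) then \<one> else \<zero>} :: ('a, 'p, 'p) tensor"
  let ?c = "\<lambda>a. {\<lambda>_. a} :: ('a, 'p, 'p) tensor"
  have s: "p = p'" if "(\<lambda>q. if q = (p, p) then \<one> else \<zero>) = (\<lambda>q. if q = (p', p') then \<one> else \<zero>)" for p p' :: 'p
    using fun_cong[OF that, of "(p, p)"] by (auto split: if_splits)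
  have c: "a = a'" if "(\<lambda>_ :: 'p \<times> 'p. a) = (\<lambda>_. a')" for a a' :: 'a
    using fun_cong[OF that] by simp
  show "\<exists>\<iota> :: ('a, 'p, 'p) tensor \<Rightarrow> 'h. inj \<iota>"
    by (rule tensor_injection[of "\<lambda>(p, q). (?s p, q)"]) (auto intro!: injI dest: s)
  show "\<exists>\<iota> :: ('a, 'a, 'p) tensor \<Rightarrow> 'h. inj \<iota>"
    by (rule tensor_injection[of "\<lambda>(a, q). (?c a, q)"]) (auto intro!: injI dest: c)
  show "\<exists>\<iota> :: ('a, 'p, 'a) tensor \<Rightarrow> 'h. inj \<iota>"
    by (rule tensor_injection[of "\<lambda>(q, a). (?c a, q)"]) (auto intro!: injI dest: c)
qed

end

end

text \<open>The common core of the two halves. Objects are arbitrary extensions of modules, which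
  covers algebras and coalgebras, and measuring is visible only in its consequences
  \<open>unique\<close>, \<open>comp_ex\<close> and \<open>ident_ex\<close>.\<close>

locale measuring_category = field K for K :: "('k, 'r) ring_scheme" (structure) +
  fixes Ob :: "('k, 'a, 'm) module_scheme set"
    and P :: "('k, 'a, 'm) module_scheme \<Rightarrow> ('k, 'a, 'm) module_scheme \<Rightarrow> ('k, 'p) coalgebra"
    and \<pi> :: "('k, 'a, 'm) module_scheme \<Rightarrow> ('k, 'a, 'm) module_scheme \<Rightarrow> 'p \<Rightarrow> 'a \<Rightarrow> 'a"
    and T :: "'h itself"
  assumes Ob_module [simp]: "A \<in> Ob \<Longrightarrow> module K A"
    and P_coalgebra [simp]: "\<lbrakk>A \<in> Ob; B \<in> Ob\<rbrakk> \<Longrightarrow> coalgebra K (P A B)"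
    and action_linear: "\<lbrakk>A \<in> Ob; B \<in> Ob\<rbrakk> \<Longrightarrow> linear_map K (P A B) (hom_module K A B) (\<pi> A B)"
    and unique: "\<And>A B (H :: ('k, 'h) coalgebra) f g h.
      \<lbrakk>A \<in> Ob; B \<in> Ob; coalgebra K H; coalgebra_map K H (P A B) f; coalgebra_map K H (P A B) g;
       \<And>h. h \<in> carrier H \<Longrightarrow> \<pi> A B (f h) = \<pi> A B (g h); h \<in> carrier H\<rbrakk> \<Longrightarrow> f h = g h"
    and comp_ex: "\<lbrakk>A \<in> Ob; B \<in> Ob; C \<in> Ob\<rbrakk> \<Longrightarrow>
      \<exists>\<mu>. coalgebra_map K (tensor_coalgebra K (P B C) (P A B)) (P A C) \<mu> \<and>
        (\<forall>t\<in>carrier (tensor_coalgebra K (P B C) (P A B)).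
          \<pi> A C (\<mu> t) = comp_action A C (\<pi> B C) (\<pi> A B) t)"
    and ident_ex: "A \<in> Ob \<Longrightarrow> \<exists>\<eta>. coalgebra_map K (unit_coalgebra K) (P A A) \<eta> \<and>
        (\<forall>a\<in>carrier (unit_coalgebra K). \<pi> A A (\<eta> a) = (\<lambda>x\<in>carrier A. a \<odot>\<^bsub>A\<^esub> x))"
    and large: "\<exists>\<iota> :: ('k, ('k, 'p, 'p) tensor, 'p) tensor \<Rightarrow> 'h. inj \<iota>"
begin

lemma action_closed: "\<lbrakk>A \<in> Ob; B \<in> Ob; f \<in> carrier (P A B); x \<in> carrier A\<rbrakk> \<Longrightarrow> \<pi> A B f x \<in> carrier B"
  using linear_map_closed[OF hom_linear[OF action_linear]] by blast

text \<open>Extends \<open>unique\<close> to coalgebras on any type embedding into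
  \<open>'h\<close>: \<open>f\<close> and \<open>g\<close> are pulled back along \<open>j\<close> to
  the copy of \<open>H\<close>, where equality of actions is inherited because \<open>j\<close> maps
  into \<open>carrier H\<close>.\<close>

lemma unique_on_injection:
  fixes H :: "('k, 'x) coalgebra" and \<iota> :: "'x \<Rightarrow> 'h"
  assumes \<iota>: "inj \<iota>" and AB [simp]: "A \<in> Ob" "B \<in> Ob" and H: "coalgebra K H"
    and f: "coalgebra_map K H (P A B) f" and g: "coalgebra_map K H (P A B) g"
    and eq: "\<And>h. h \<in> carrier H \<Longrightarrow> \<pi> A B (f h) = \<pi> A B (g h)" and h: "h \<in> carrier H"
  shows "f h = g h"
proof -
  obtain H' :: "('k, 'h) coalgebra" and j where H': "coalgebra K H'" "coalgebra_map K H H' \<iota>"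
    "coalgebra_map K H' H j" "\<And>h. j (\<iota> h) = h" "\<iota> ` carrier H = carrier H'"
    using coalgebra_transport[OF H \<iota>] by metis
  have "f (j (\<iota> h)) = g (j (\<iota> h))"
  proof (rule unique[OF AB H'(1)])
    show "coalgebra_map K H' (P A B) (\<lambda>x. f (j x))" "coalgebra_map K H' (P A B) (\<lambda>x. g (j x))"
      by (rule coalgebra_map_comp[OF H'(1) H _ f H'(3)] coalgebra_map_comp[OF H'(1) H _ g H'(3)]; simp)+
    show "\<pi> A B (f (j x)) = \<pi> A B (g (j x))" if "x \<in> carrier H'" for x
      using that linear_map_closed[OF coalgebra_mapD(1)[OF H'(3)]] by (intro eq)
    show "\<iota> h \<in> carrier H'" using h H'(5) by blast
  qed
  then show ?thesis by (simp add: H'(4))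
qed

definition comp_map where
  "comp_map A B C = (SOME \<mu>. coalgebra_map K (tensor_coalgebra K (P B C) (P A B)) (P A C) \<mu> \<and>
    (\<forall>t\<in>carrier (tensor_coalgebra K (P B C) (P A B)). \<pi> A C (\<mu> t) = comp_action A C (\<pi> B C) (\<pi> A B) t))"

definition ident_map where
  "ident_map A = (SOME \<eta>. coalgebra_map K (unit_coalgebra K) (P A A) \<eta> \<and>
    (\<forall>a\<in>carrier (unit_coalgebra K). \<pi> A A (\<eta> a) = (\<lambda>x\<in>carrier A. a \<odot>\<^bsub>A\<^esub> x)))"

lemma comp_map:
  assumes "A \<in> Ob" "B \<in> Ob" "C \<in> Ob"
  shows "coalgebra_map K (tensor_coalgebra K (P B C) (P A B)) (P A C) (comp_map A B C)"
    and "t \<in> carrier (tensor_module K (P B C) (P A B)) \<Longrightarrow>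
      \<pi> A C (comp_map A B C t) = comp_action A C (\<pi> B C) (\<pi> A B) t"
  using someI_ex[OF comp_ex[OF assms]] by (simp_all add: comp_map_def)

lemma ident_map:
  assumes "A \<in> Ob"
  shows "coalgebra_map K (unit_coalgebra K) (P A A) (ident_map A)"
    and "a \<in> carrier K \<Longrightarrow> \<pi> A A (ident_map A a) = (\<lambda>x\<in>carrier A. a \<odot>\<^bsub>A\<^esub> x)"
  using someI_ex[OF ident_ex[OF assms]] by (simp_all add: ident_map_def)

lemma comp_map_linear [simp]:
  "\<lbrakk>A \<in> Ob; B \<in> Ob; C \<in> Ob\<rbrakk> \<Longrightarrow> linear_map K (tensor_module K (P B C) (P A B)) (P A C) (comp_map A B C)"
  using coalgebra_mapD(1)[OF comp_map(1)] by simp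

lemma ident_map_linear [simp]: "A \<in> Ob \<Longrightarrow> linear_map K (self_module K) (P A A) (ident_map A)"
  using coalgebra_mapD(1)[OF ident_map(1)] by simp

lemma comp_map_pure:
  "\<lbrakk>A \<in> Ob; B \<in> Ob; C \<in> Ob; g \<in> carrier (P B C); f \<in> carrier (P A B)\<rbrakk> \<Longrightarrow>
    \<pi> A C (comp_map A B C (pure_tensor K (P B C) (P A B) g f)) = compose (carrier A) (\<pi> B C g) (\<pi> A B f)"
  using comp_action_pure[of A B C "P B C" "P A B" "\<pi> B C" "\<pi> A B" g f]
  by (simp add: comp_map(2) action_linear)

lemma is_composition_comp_map:
  assumes [simp]: "A \<in> Ob" "B \<in> Ob" "C \<in> Ob"
  shows "is_composition K P \<pi> A B C (comp_map A B C)"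
  unfolding is_composition_def unique_on_def
proof (intro conjI allI impI ballI)
  let ?T = "tensor_coalgebra K (P B C) (P A B)"
  show "coalgebra_map K ?T (P A C) (comp_map A B C)"
    by (rule comp_map) simp_all
  show "\<pi> A C (comp_map A B C (pure_tensor K (P B C) (P A B) g f)) = compose (carrier A) (\<pi> B C g) (\<pi> A B f)"
    if "g \<in> carrier (P B C)" "f \<in> carrier (P A B)" for g f
    using that by (simp add: comp_map_pure)
  fix \<mu> t
  assume \<mu>: "coalgebra_map K ?T (P A C) \<mu> \<and> (\<forall>g\<in>carrier (P B C). \<forall>f\<in>carrier (P A B).
    \<pi> A C (\<mu> (pure_tensor K (P B C) (P A B) g f)) = compose (carrier A) (\<pi> B C g) (\<pi> A B f))"
    and t: "t \<in> carrier ?T"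
  obtain \<iota> :: "('k, 'p, 'p) tensor \<Rightarrow> 'h" where \<iota>: "inj \<iota>"
    using test_injections(2)[OF large] by blast
  have lin: "linear_map K (tensor_module K (P B C) (P A B)) (P A C) \<mu>"
    using coalgebra_mapD(1)[of K ?T "P A C" \<mu>] \<mu> by simp
  \<comment> \<open>The condition fixes actions on pure tensors only. Since both actions are linear
    into \<open>hom_module\<close>, they agree on all tensors, as uniqueness requires.\<close>
  have "\<forall>t\<in>carrier (tensor_module K (P B C) (P A B)). \<pi> A C (\<mu> t) = \<pi> A C (comp_map A B C t)"
  proof (rule tensor_ext)
    show "linear_map K (tensor_module K (P B C) (P A B)) (hom_module K A C) (\<lambda>t. \<pi> A C (\<mu> t))"
      by (rule linear_map_comp[OF action_linear lin]) simp_all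
    show "linear_map K (tensor_module K (P B C) (P A B)) (hom_module K A C) (\<lambda>t. \<pi> A C (comp_map A B C t))"
      by (rule linear_map_comp[OF action_linear comp_map_linear]) simp_all
  qed (use \<mu> in \<open>simp_all add: comp_map_pure\<close>)
  then show "\<mu> t = comp_map A B C t"
    using \<mu> t by (intro unique_on_injection[OF \<iota>, of A C ?T]) (simp_all add: comp_map(1))
qed

lemma is_identity_ident_map:
  assumes [simp]: "A \<in> Ob"
  shows "is_identity K P \<pi> A (ident_map A)"
  unfolding is_identity_def unique_on_def
proof (intro conjI allI impI ballI)
  show "coalgebra_map K (unit_coalgebra K) (P A A) (ident_map A)"
    by (rule ident_map) simp
  have id: "(\<lambda>x\<in>carrier A. \<one> \<odot>\<^bsub>A\<^esub> x) = (\<lambda>x\<in>carrier A. x)"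
    using module.smult_one[OF Ob_module[OF assms]] by auto
  then show one: "\<pi> A A (ident_map A \<one>) = (\<lambda>x\<in>carrier A. x)"
    by (simp add: ident_map(2))
  fix \<eta> a
  assume \<eta>: "coalgebra_map K (unit_coalgebra K) (P A A) \<eta> \<and> \<pi> A A (\<eta> \<one>) = (\<lambda>a\<in>carrier A. a)"
    and a: "a \<in> carrier (unit_coalgebra K)"
  obtain \<iota> :: "'k \<Rightarrow> 'h" where \<iota>: "inj \<iota>"
    using test_injections(1)[OF large] by blast
  \<comment> \<open>By linearity the action at the grouplike element \<open>\<one>\<close>
    determines the action of every scalar.\<close>
  have scale: "\<pi> A A (\<eta>' b) = b \<odot>\<^bsub>hom_module K A A\<^esub> \<pi> A A (\<eta>' \<one>)"
    if \<eta>': "linear_map K (self_module K) (P A A) \<eta>'" and b: "b \<in> carrier K" for b \<eta>'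
    using linear_map_smult[OF linear_map_comp[OF action_linear \<eta>'], of b \<one>] b by simp
  have "linear_map K (self_module K) (P A A) \<eta>"
    using coalgebra_mapD(1)[of K "unit_coalgebra K" "P A A" \<eta>] \<eta> by simp
  then have "\<pi> A A (\<eta> b) = \<pi> A A (ident_map A b)" if "b \<in> carrier K" for b
    using that \<eta> one scale[of \<eta> b] scale[of "ident_map A" b] by simp
  then show "\<eta> a = ident_map A a"
    using \<eta> a by (intro unique_on_injection[OF \<iota>, of A A "unit_coalgebra K"]) (simp_all add: ident_map(1))
qed

section \<open>Associativity and unit laws\<close>

lemma comp_map_assoc:
  assumes [simp]: "A \<in> Ob" "B \<in> Ob" "C \<in> Ob" "D \<in> Ob"
    and x: "x \<in> carrier (tensor_coalgebra K (tensor_coalgebra K (P C D) (P B C)) (P A B))"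
  shows "comp_map A B D (tensor_map K (P B D) (P A B) (comp_map B C D) (\<lambda>u. u) x) =
    comp_map A C D (tensor_map K (P C D) (P A C) (\<lambda>u. u) (comp_map A B C) (tensor_assoc K (P C D) (P B C) (P A B) x))"
    (is "?F x = ?G x")
proof -
  let ?T = "tensor_coalgebra K (tensor_coalgebra K (P C D) (P B C)) (P A B)"
  obtain \<iota> :: "('k, ('k, 'p, 'p) tensor, 'p) tensor \<Rightarrow> 'h" where \<iota>: "inj \<iota>"
    using large by blast
  have F: "coalgebra_map K ?T (P A D) ?F"
    by (rule coalgebra_map_comp[OF _ _ _ comp_map(1)[of A B D]
        coalgebra_map_tensor_map[OF _ _ _ _ comp_map(1) coalgebra_map_id]]) simp_all
  have G: "coalgebra_map K ?T (P A D) ?G"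
    by (rule coalgebra_map_comp[OF _ _ _ comp_map(1)[of A C D] coalgebra_map_comp[OF _ _ _
        coalgebra_map_tensor_map[OF _ _ _ _ coalgebra_map_id comp_map(1)] coalgebra_map_tensor_assoc]]) simp_all
  note closed = linear_map_closed[OF comp_map_linear]
  have "\<forall>x\<in>carrier (tensor_module K (tensor_module K (P C D) (P B C)) (P A B)). \<pi> A D (?F x) = \<pi> A D (?G x)"
  proof (rule tensor_ext_left)
    fix h g f assume [simp]: "h \<in> carrier (P C D)" "g \<in> carrier (P B C)" "f \<in> carrier (P A B)"
    let ?t = "pure_tensor K (tensor_module K (P C D) (P B C)) (P A B) (pure_tensor K (P C D) (P B C) h g) f"
    have "\<pi> A D (?F ?t) = compose (carrier A) (compose (carrier B) (\<pi> C D h) (\<pi> B C g)) (\<pi> A B f)"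
      by (simp add: comp_map_pure closed)
    \<comment> \<open>The inner restriction to \<open>carrier B\<close> changes nothing, as
      \<open>\<pi> A B f\<close> maps \<open>carrier A\<close> into
      \<open>carrier B\<close>.\<close>
    also have "\<dots> = compose (carrier A) (\<pi> C D h) (compose (carrier A) (\<pi> B C g) (\<pi> A B f))"
      by (auto simp: compose_def action_closed)
    also have "\<dots> = \<pi> A D (?G ?t)"
      by (simp add: comp_map_pure closed)
    finally show "\<pi> A D (?F ?t) = \<pi> A D (?G ?t)" .
  next
    have "linear_map K ?T (hom_module K A D) (\<lambda>x. \<pi> A D (?F x))" "linear_map K ?T (hom_module K A D) (\<lambda>x. \<pi> A D (?G x))"
      by (rule linear_map_comp[OF action_linear coalgebra_mapD(1)[OF F]]
        linear_map_comp[OF action_linear coalgebra_mapD(1)[OF G]]; simp)+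
    then show "linear_map K (tensor_module K (tensor_module K (P C D) (P B C)) (P A B)) (hom_module K A D) (\<lambda>x. \<pi> A D (?F x))"
      "linear_map K (tensor_module K (tensor_module K (P C D) (P B C)) (P A B)) (hom_module K A D) (\<lambda>x. \<pi> A D (?G x))"
      by simp_all
  qed simp_all
  then show ?thesis
    using x by (intro unique_on_injection[OF \<iota> _ _ _ F G]) simp_all
qed

lemma comp_map_ident_left:
  assumes [simp]: "A \<in> Ob" "B \<in> Ob" and y: "y \<in> carrier (tensor_coalgebra K (unit_coalgebra K) (P A B))"
  shows "comp_map A B B (tensor_map K (P B B) (P A B) (ident_map B) (\<lambda>u. u) y) = tensor_lunit K (P A B) y"
    (is "?F y = ?G y")
proof -
  let ?T = "tensor_coalgebra K (unit_coalgebra K) (P A B)"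
  obtain \<iota> :: "('k, 'k, 'p) tensor \<Rightarrow> 'h" where \<iota>: "inj \<iota>"
    using test_injections(3)[OF large] by blast
  have F: "coalgebra_map K ?T (P A B) ?F"
    by (rule coalgebra_map_comp[OF _ _ _ comp_map(1)[of A B B]
        coalgebra_map_tensor_map[OF _ _ _ _ ident_map(1) coalgebra_map_id]]) simp_all
  have G: "coalgebra_map K ?T (P A B) ?G"
    by (rule coalgebra_map_tensor_lunit) simp
  have "\<forall>y\<in>carrier (tensor_module K (self_module K) (P A B)). \<pi> A B (?F y) = \<pi> A B (?G y)"
  proof (rule tensor_ext)
    fix a f assume "a \<in> carrier (self_module K)" and [simp]: "f \<in> carrier (P A B)"
    then have [simp]: "a \<in> carrier K" by simp
    \<comment> \<open>Both sides act as \<open>a\<close> times \<open>\<pi> A B f\<close>.\<close>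
    show "\<pi> A B (?F (pure_tensor K (self_module K) (P A B) a f)) = \<pi> A B (?G (pure_tensor K (self_module K) (P A B) a f))"
      using linear_map_smult[OF action_linear, of A B a f] linear_map_closed[OF ident_map_linear, of B a]
      by (auto simp: comp_map_pure ident_map(2) compose_def hom_module_simps action_closed)
  next
    have "linear_map K ?T (hom_module K A B) (\<lambda>x. \<pi> A B (?F x))" "linear_map K ?T (hom_module K A B) (\<lambda>x. \<pi> A B (?G x))"
      by (rule linear_map_comp[OF action_linear coalgebra_mapD(1)[OF F]]
        linear_map_comp[OF action_linear coalgebra_mapD(1)[OF G]]; simp)+
    then show "linear_map K (tensor_module K (self_module K) (P A B)) (hom_module K A B) (\<lambda>x. \<pi> A B (?F x))"
      "linear_map K (tensor_module K (self_module K) (P A B)) (hom_module K A B) (\<lambda>x. \<pi> A B (?G x))"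
      by simp_all
  qed simp_all
  then show ?thesis
    using y by (intro unique_on_injection[OF \<iota> _ _ _ F G]) simp_all
qed

lemma comp_map_ident_right:
  assumes [simp]: "A \<in> Ob" "B \<in> Ob" and z: "z \<in> carrier (tensor_coalgebra K (P A B) (unit_coalgebra K))"
  shows "comp_map A A B (tensor_map K (P A B) (P A A) (\<lambda>u. u) (ident_map A) z) = tensor_runit K (P A B) z"
    (is "?F z = ?G z")
proof -
  let ?T = "tensor_coalgebra K (P A B) (unit_coalgebra K)"
  obtain \<iota> :: "('k, 'p, 'k) tensor \<Rightarrow> 'h" where \<iota>: "inj \<iota>"
    using test_injections(4)[OF large] by blast
  have F: "coalgebra_map K ?T (P A B) ?F"
    by (rule coalgebra_map_comp[OF _ _ _ comp_map(1)[of A A B]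
        coalgebra_map_tensor_map[OF _ _ _ _ coalgebra_map_id ident_map(1)]]) simp_all
  have G: "coalgebra_map K ?T (P A B) ?G"
    by (rule coalgebra_map_tensor_runit) simp
  have "\<forall>z\<in>carrier (tensor_module K (P A B) (self_module K)). \<pi> A B (?F z) = \<pi> A B (?G z)"
  proof (rule tensor_ext)
    fix f a assume "a \<in> carrier (self_module K)" and [simp]: "f \<in> carrier (P A B)"
    then have [simp]: "a \<in> carrier K" by simp
    \<comment> \<open>Here the scalar is applied before \<open>f\<close> acts; homogeneity of
      \<open>\<pi> A B f\<close> moves it outside.\<close>
    show "\<pi> A B (?F (pure_tensor K (P A B) (self_module K) f a)) = \<pi> A B (?G (pure_tensor K (P A B) (self_module K) f a))"
      using linear_map_smult[OF action_linear, of A B a f] linear_map_closed[OF ident_map_linear, of A a]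
        linear_map_smult[OF hom_linear[OF action_linear], of A B f a]
      by (auto simp: comp_map_pure ident_map(2) compose_def hom_module_simps)
  next
    have "linear_map K ?T (hom_module K A B) (\<lambda>x. \<pi> A B (?F x))" "linear_map K ?T (hom_module K A B) (\<lambda>x. \<pi> A B (?G x))"
      by (rule linear_map_comp[OF action_linear coalgebra_mapD(1)[OF F]]
        linear_map_comp[OF action_linear coalgebra_mapD(1)[OF G]]; simp)+
    then show "linear_map K (tensor_module K (P A B) (self_module K)) (hom_module K A B) (\<lambda>x. \<pi> A B (?F x))"
      "linear_map K (tensor_module K (P A B) (self_module K)) (hom_module K A B) (\<lambda>x. \<pi> A B (?G x))"
      by simp_all
  qed simp_all
  then show ?thesis
    using z by (intro unique_on_injection[OF \<iota> _ _ _ F G]) simp_all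
qed

theorem enriched_category: "coalgebra_enriched_category K Ob P comp_map ident_map"
  by (rule coalgebra_enriched_category.intro)
    (rule P_coalgebra comp_map(1) ident_map(1) comp_map_assoc comp_map_ident_left comp_map_ident_right;
      assumption)+

end

section \<open>The two instances: algebras and coalgebras\<close>

context field
begin

lemma enriched_algebras:
  fixes P :: "('a, 'c) module \<Rightarrow> ('a, 'c) module \<Rightarrow> ('a, 'p) coalgebra"
  assumes large: "\<exists>\<iota> :: ('a, ('a, 'p, 'p) tensor, 'p) tensor \<Rightarrow> 'h. inj \<iota>"
    and univ: "\<And>A B. \<lbrakk>assoc_algebra R A; assoc_algebra R B\<rbrakk> \<Longrightarrow>
      universal_measuring_alg TYPE('h) R A B (P A B) (\<pi> A B)"
  shows "\<exists>comp ident.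
      (\<forall>A B C. assoc_algebra R A \<longrightarrow> assoc_algebra R B \<longrightarrow> assoc_algebra R C \<longrightarrow>
        is_composition R P \<pi> A B C (comp A B C)) \<and>
      (\<forall>A. assoc_algebra R A \<longrightarrow> is_identity R P \<pi> A (ident A)) \<and>
      coalgebra_enriched_category R {A. assoc_algebra R A} P comp ident"
proof -
  obtain \<iota>\<^sub>p :: "('a, 'p, 'p) tensor \<Rightarrow> 'h" and \<iota>\<^sub>k :: "'a \<Rightarrow> 'h" where inj_p: "inj \<iota>\<^sub>p" and inj_k: "inj \<iota>\<^sub>k"
    using test_injections(1,2)[OF large] by blast
  have meas: "measures_alg R A B (P A B) (\<pi> A B)"
    and univ': "universal_measuring TYPE('h) R (measures_alg R A B) (P A B) (\<pi> A B)"
    if "assoc_algebra R A" "assoc_algebra R B" for A B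
    using univ that by (simp_all add: universal_measuring_alg_def)
  note P = measures_algD(1)[OF meas]
  interpret measuring_category R "{A. assoc_algebra R A}" P \<pi> "TYPE('h)"
  proof (rule measuring_category.intro[OF field_axioms], rule measuring_category_axioms.intro, unfold mem_Collect_eq)
    show "module R A" if "assoc_algebra R A" for A :: "('a, 'c) module"
      using that by (rule assoc_algebra_module)
  next
    fix A B :: "('a, 'c) module" assume A: "assoc_algebra R A" and B: "assoc_algebra R B"
    show "coalgebra R (P A B)" by (rule P[OF A B])
    show "linear_map R (P A B) (hom_module R A B) (\<pi> A B)" by (rule measures_algD(2)[OF meas[OF A B]])
    show "f h = g h"
      if "coalgebra R H" "coalgebra_map R H (P A B) f" "coalgebra_map R H (P A B) g"
        "\<And>h. h \<in> carrier H \<Longrightarrow> \<pi> A B (f h) = \<pi> A B (g h)" "h \<in> carrier H"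
      for H :: "('a, 'h) coalgebra" and f g h
      by (rule universal_measuring_unique[OF univ'[OF A B] that(1) P[OF A B]
          measures_alg_precomp[OF B meas[OF A B] that(1,2)] that(2-5)])
  next
    fix A :: "('a, 'c) module" assume A: "assoc_algebra R A"
    show "\<exists>\<eta>. coalgebra_map R (unit_coalgebra R) (P A A) \<eta> \<and>
        (\<forall>a\<in>carrier (unit_coalgebra R). \<pi> A A (\<eta> a) = (\<lambda>x\<in>carrier A. a \<odot>\<^bsub>A\<^esub> x))"
      by (rule universal_measuring_lift[OF univ'[OF A A] coalgebra_unit P[OF A A] inj_k])
        (rule measures_alg_precomp[OF A measures_alg_identity[OF A]])
  next
    fix A B C :: "('a, 'c) module" assume A: "assoc_algebra R A" and B: "assoc_algebra R B" and C: "assoc_algebra R C"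
    show "\<exists>\<mu>. coalgebra_map R (tensor_coalgebra R (P B C) (P A B)) (P A C) \<mu> \<and>
        (\<forall>t\<in>carrier (tensor_coalgebra R (P B C) (P A B)). \<pi> A C (\<mu> t) = comp_action A C (\<pi> B C) (\<pi> A B) t)"
      by (rule universal_measuring_lift[OF univ'[OF A C] coalgebra_tensor[OF P[OF B C] P[OF A B]] P[OF A C] inj_p])
        (rule measures_alg_precomp[OF C measures_alg_comp[OF A B C meas[OF B C] meas[OF A B]]])
  qed (rule large)
  show ?thesis
    using is_composition_comp_map is_identity_ident_map enriched_category by blast
qed

lemma enriched_coalgebras:
  fixes P :: "('a, 'c) coalgebra \<Rightarrow> ('a, 'c) coalgebra \<Rightarrow> ('a, 'p) coalgebra"
  assumes large: "\<exists>\<iota> :: ('a, ('a, 'p, 'p) tensor, 'p) tensor \<Rightarrow> 'h. inj \<iota>"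
    and univ: "\<And>C D. \<lbrakk>coalgebra R C; coalgebra R D\<rbrakk> \<Longrightarrow>
      universal_measuring_coalg TYPE('h) R C D (P C D) (\<pi> C D)"
  shows "\<exists>comp ident.
      (\<forall>C D E. coalgebra R C \<longrightarrow> coalgebra R D \<longrightarrow> coalgebra R E \<longrightarrow>
        is_composition R P \<pi> C D E (comp C D E)) \<and>
      (\<forall>C. coalgebra R C \<longrightarrow> is_identity R P \<pi> C (ident C)) \<and>
      coalgebra_enriched_category R {C. coalgebra R C} P comp ident"
proof -
  obtain \<iota>\<^sub>p :: "('a, 'p, 'p) tensor \<Rightarrow> 'h" and \<iota>\<^sub>k :: "'a \<Rightarrow> 'h" where inj_p: "inj \<iota>\<^sub>p" and inj_k: "inj \<iota>\<^sub>k"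
    using test_injections(1,2)[OF large] by blast
  have meas: "measures_coalg R C D (P C D) (\<pi> C D)"
    and univ': "universal_measuring TYPE('h) R (measures_coalg R C D) (P C D) (\<pi> C D)"
    if "coalgebra R C" "coalgebra R D" for C D
    using univ that by (simp_all add: universal_measuring_coalg_def)
  note P = measures_coalgD(1)[OF meas]
  interpret measuring_category R "{C. coalgebra R C}" P \<pi> "TYPE('h)"
  proof (rule measuring_category.intro[OF field_axioms], rule measuring_category_axioms.intro, unfold mem_Collect_eq)
    show "module R C" if "coalgebra R C" for C :: "('a, 'c) coalgebra"
      using that by simp
  next
    fix C D :: "('a, 'c) coalgebra" assume C: "coalgebra R C" and D: "coalgebra R D"
    show "coalgebra R (P C D)" by (rule P[OF C D])
    show "linear_map R (P C D) (hom_module R C D) (\<pi> C D)" by (rule measures_coalgD(2)[OF meas[OF C D]])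
    show "f h = g h"
      if "coalgebra R H" "coalgebra_map R H (P C D) f" "coalgebra_map R H (P C D) g"
        "\<And>h. h \<in> carrier H \<Longrightarrow> \<pi> C D (f h) = \<pi> C D (g h)" "h \<in> carrier H"
      for H :: "('a, 'h) coalgebra" and f g h
      by (rule universal_measuring_unique[OF univ'[OF C D] that(1) P[OF C D]
          measures_coalg_precomp[OF C D meas[OF C D] that(1,2)] that(2-5)])
  next
    fix C :: "('a, 'c) coalgebra" assume C: "coalgebra R C"
    show "\<exists>\<eta>. coalgebra_map R (unit_coalgebra R) (P C C) \<eta> \<and>
        (\<forall>a\<in>carrier (unit_coalgebra R). \<pi> C C (\<eta> a) = (\<lambda>x\<in>carrier C. a \<odot>\<^bsub>C\<^esub> x))"
      by (rule universal_measuring_lift[OF univ'[OF C C] coalgebra_unit P[OF C C] inj_k])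
        (rule measures_coalg_precomp[OF C C measures_coalg_identity[OF C]])
  next
    fix C D E :: "('a, 'c) coalgebra" assume C: "coalgebra R C" and D: "coalgebra R D" and E: "coalgebra R E"
    show "\<exists>\<mu>. coalgebra_map R (tensor_coalgebra R (P D E) (P C D)) (P C E) \<mu> \<and>
        (\<forall>t\<in>carrier (tensor_coalgebra R (P D E) (P C D)). \<pi> C E (\<mu> t) = comp_action C E (\<pi> D E) (\<pi> C D) t)"
      by (rule universal_measuring_lift[OF univ'[OF C E] coalgebra_tensor[OF P[OF D E] P[OF C D]] P[OF C E] inj_p])
        (rule measures_coalg_precomp[OF C E measures_coalg_comp[OF C D E meas[OF D E] meas[OF C D]]])
  qed (rule large)
  show ?thesis
    using is_composition_comp_map is_identity_ident_map enriched_category by blast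
qed

end

theorem proposition2p11:
  fixes K :: "('k, 'r) ring_scheme"
  assumes "field K"
    and large: "\<exists>\<iota> :: ('k, ('k, 'p, 'p) tensor, 'p) tensor \<Rightarrow> 'h. inj \<iota>"
  shows
    "(\<forall>(P :: ('k, 'a) module \<Rightarrow> ('k, 'a) module \<Rightarrow> ('k, 'p) coalgebra) \<pi>.
        (\<forall>A B. assoc_algebra K A \<longrightarrow> assoc_algebra K B \<longrightarrow>
          universal_measuring_alg TYPE('h) K A B (P A B) (\<pi> A B)) \<longrightarrow>
        (\<exists>comp ident.
          (\<forall>A B C. assoc_algebra K A \<longrightarrow> assoc_algebra K B \<longrightarrow> assoc_algebra K C \<longrightarrow>
            is_composition K P \<pi> A B C (comp A B C)) \<and>
          (\<forall>A. assoc_algebra K A \<longrightarrow> is_identity K P \<pi> A (ident A)) \<and>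
          coalgebra_enriched_category K {A. assoc_algebra K A} P comp ident)) \<and>
     (\<forall>(P :: ('k, 'c) coalgebra \<Rightarrow> ('k, 'c) coalgebra \<Rightarrow> ('k, 'p) coalgebra) \<pi>.
        (\<forall>C D. coalgebra K C \<longrightarrow> coalgebra K D \<longrightarrow>
          universal_measuring_coalg TYPE('h) K C D (P C D) (\<pi> C D)) \<longrightarrow>
        (\<exists>comp ident.
          (\<forall>C D E. coalgebra K C \<longrightarrow> coalgebra K D \<longrightarrow> coalgebra K E \<longrightarrow>
            is_composition K P \<pi> C D E (comp C D E)) \<and>
          (\<forall>C. coalgebra K C \<longrightarrow> is_identity K P \<pi> C (ident C)) \<and>
          coalgebra_enriched_category K {C. coalgebra K C} P comp ident))"
proof (rule conjI; intro allI impI)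
  fix P :: "('k, 'a) module \<Rightarrow> ('k, 'a) module \<Rightarrow> ('k, 'p) coalgebra" and \<pi>
  assume univ: "\<forall>A B. assoc_algebra K A \<longrightarrow> assoc_algebra K B \<longrightarrow>
    universal_measuring_alg TYPE('h) K A B (P A B) (\<pi> A B)"
  show "\<exists>comp ident.
      (\<forall>A B C. assoc_algebra K A \<longrightarrow> assoc_algebra K B \<longrightarrow> assoc_algebra K C \<longrightarrow>
        is_composition K P \<pi> A B C (comp A B C)) \<and>
      (\<forall>A. assoc_algebra K A \<longrightarrow> is_identity K P \<pi> A (ident A)) \<and>
      coalgebra_enriched_category K {A. assoc_algebra K A} P comp ident"
    by (rule field.enriched_algebras[OF assms]) (simp add: univ)
next
  fix P :: "('k, 'c) coalgebra \<Rightarrow> ('k, 'c) coalgebra \<Rightarrow> ('k, 'p) coalgebra" and \<pi>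
  assume univ: "\<forall>C D. coalgebra K C \<longrightarrow> coalgebra K D \<longrightarrow>
    universal_measuring_coalg TYPE('h) K C D (P C D) (\<pi> C D)"
  show "\<exists>comp ident.
      (\<forall>C D E. coalgebra K C \<longrightarrow> coalgebra K D \<longrightarrow> coalgebra K E \<longrightarrow>
        is_composition K P \<pi> C D E (comp C D E)) \<and>
      (\<forall>C. coalgebra K C \<longrightarrow> is_identity K P \<pi> C (ident C)) \<and>
      coalgebra_enriched_category K {C. coalgebra K C} P comp ident"
    by (rule field.enriched_coalgebras[OF assms]) (simp add: univ)
qed

end
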